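(* Let $d\ge 1$ be an integer and let $(U_i)_{i\ge 1}$ be a sequence of open subsets of the torus $\mathbb{T}^d$. Let $Q\subset\mathbb{R}^d$ be a $d$-dimensional (non-degenerate) cube and suppose that for each $i\ge 1$ there is an affine transformation $L_i:\mathbb{R}^d\to\mathbb{R}^d$ with singular values \[ 0<\alpha_d(L_i)\le\cdots\le\alpha_1(L_i)<1 \] such that $R_i=L_i(Q)$, regarded as a subset of $\mathbb{T}^d$ via the quotient map $\mathbb{R}^d\to\mathbb{T}^d$, satisfies $R_i\subset U_i$. Let $v=(v_i)_{i\ge 1}$ be a sequence of independent random vectors, each uniformly distributed on $\mathbb{T}^d$. Put $V_i(v_i)=U_i+v_i$ and \[ E(v)=\limsup_{i\to\infty}V_i(v_i)=\bigcap_{n\ge 1}\bigcup_{i\ge n}V_i(v_i). \] Define \[ s=\inf\Bigl\{\,t\in(0,d] : \sum_{i=1}^\infty \Phi^t(L_i)<\infty \ \text{ or } \ t=d\,\Bigr\}, \] where $\Phi^t$ is the singular value function. Then almost surely $E(v)\in\mathscr{G}^s(\mathbb{T}^d)$.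
   Context: $\mathbb{T}^d=\mathbb{R}^d/\mathbb{Z}^d$ is the $d$-dimensional torus, with addition inherited from $\mathbb{R}^d$. "Uniformly distributed" means with law the normalised Lebesgue measure on $\mathbb{T}^d$. The singular values of an affine transformation are those of its linear part. For $0<t\le d$ and an affine transformation $L$ with singular values $\alpha_1(L)\ge\cdots\ge\alpha_d(L)>0$, the singular value function is \[ \Phi^t(L)=\alpha_1(L)\alpha_2(L)\cdots\alpha_{m-1}(L)\,\alpha_m(L)^{t-m+1}, \] where $m$ is the integer such that $m-1<t\le m$. Large intersection classes (Falconer). Identify $\mathbb{T}^d$ with $[0,1)^d$. A dyadic cube is a set of the form $\prod_{j=1}^d[k_j2^{-n},(k_j+1)2^{-n})$ with integers $n\ge 0$ and $0\le k_j<2^n$; $|D|$ denotes the diameter of the cube $D$. For $t>0$ and $A\subset\mathbb{T}^d$ let \[ \mathcal{M}^t_\infty(A)=\inf\Bigl\{\sum_j|D_j|^t : (D_j)\text{ a countable family of dyadic cubes with } A\subset\bigcup_jD_j\Bigr\}. \] The class $\mathscr{G}^s(\mathbb{T}^d)$ consists of all $G_\delta$ sets $A\subset\mathbb{T}^d$ such that $\mathcal{M}^t_\infty(A\cap D)=\mathcal{M}^t_\infty(D)$ for every $0<t<s$ and every dyadic cube $D$ (for $s=0$ this condition is empty). For $0<s\le d$, countable intersections of sets in $\mathscr{G}^s(\mathbb{T}^d)$ belong to $\mathscr{G}^s(\mathbb{T}^d)$, and every set in $\mathscr{G}^s(\mathbb{T}^d)$ has Hausdorff dimension at least $s$. *)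

theory Defs
  imports "HOL-Probability.Probability" "HOL-Computational_Algebra.Polynomial"
begin

section \<open>The torus\<close>

text \<open>
  The torus of dimension \<open>CARD('d)\<close> is represented by the fundamental domain \<open>[0,1)^d\<close>.
  It carries the topology of the quotient of \<open>real ^ 'd\<close> by the integer lattice (not the
  subspace topology); the quotient map is \<open>torus_proj\<close>.
\<close>

definition torus :: "(real ^ 'd) set" where
  "torus = {x. \<forall>j. 0 \<le> x $ j \<and> x $ j < 1}"

definition torus_proj :: "real ^ 'd \<Rightarrow> real ^ 'd" where
  "torus_proj x = (\<chi> j. frac (x $ j))"

definition torus_topology :: "(real ^ 'd) topology" where
  "torus_topology = topology (\<lambda>U. U \<subseteq> torus \<and> open (torus_proj -` U))"

lemma torus_proj_in_torus [simp]: "torus_proj x \<in> torus"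
  by (simp add: torus_proj_def torus_def frac_lt_1)

lemma torus_proj_id: "x \<in> torus \<Longrightarrow> torus_proj x = x"
  by (simp add: torus_proj_def torus_def vec_eq_iff frac_eq)

lemma range_torus_proj: "range torus_proj = torus"
  by (auto intro!: range_eqI torus_proj_id[symmetric])

lemma torus_proj_eq_iff: "torus_proj x = torus_proj y \<longleftrightarrow> (\<forall>j. x $ j - y $ j \<in> \<int>)"
proof -
  have "frac a = frac b \<longleftrightarrow> a - b \<in> \<int>" for a b :: real
  proof
    assume "frac a = frac b"
    then have "a - b = of_int (\<lfloor>a\<rfloor> - \<lfloor>b\<rfloor>)" by (simp add: frac_def)
    then show "a - b \<in> \<int>" by (metis Ints_of_int)
  next
    assume "a - b \<in> \<int>"
    then obtain k where "a = b + of_int k" by (metis Ints_cases add.commute diff_add_cancel)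
    then show "frac a = frac b" by (simp add: frac_def)
  qed
  then show ?thesis by (simp add: torus_proj_def vec_eq_iff)
qed

lemma openin_torus_topology:
  fixes U :: "(real ^ 'd) set"
  shows "openin torus_topology U \<longleftrightarrow> U \<subseteq> torus \<and> open (torus_proj -` U)"
proof -
  have "istopology (\<lambda>U :: (real ^ 'd) set. U \<subseteq> torus \<and> open (torus_proj -` U))"
    unfolding istopology_def by (auto simp: vimage_Union)
  then show ?thesis by (simp add: torus_topology_def)
qed

lemma topspace_torus_topology [simp]: "topspace torus_topology = (torus :: (real ^ 'd) set)"
proof
  show "topspace torus_topology \<subseteq> (torus :: (real ^ 'd) set)"
    by (auto simp: topspace_def openin_torus_topology)
  have "torus_proj -` torus = (UNIV :: (real ^ 'd) set)" by auto
  then have "openin torus_topology (torus :: (real ^ 'd) set)" by (simp add: openin_torus_topology)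
  then show "(torus :: (real ^ 'd) set) \<subseteq> topspace torus_topology" by (rule openin_subset)
qed

lemma quotient_map_torus_proj: "quotient_map euclidean torus_topology torus_proj"
  by (auto simp: quotient_map_def range_torus_proj openin_torus_topology vimage_def)

definition torus_translate :: "real ^ 'd \<Rightarrow> (real ^ 'd) set \<Rightarrow> (real ^ 'd) set" where
  "torus_translate v A = (\<lambda>x. torus_proj (x + v)) ` A"

definition torus_measure :: "(real ^ 'd) measure" where
  "torus_measure = restrict_space lborel torus"

lemma torus_in_borel: "(torus :: (real ^ 'd) set) \<in> sets borel"
proof -
  have "torus = (\<Inter>j. {x :: real ^ 'd. 0 \<le> x $ j} \<inter> {x. x $ j < 1})"
    by (auto simp: torus_def)
  also have "\<dots> \<in> sets borel"
    by (intro sets.finite_INT sets.Int borel_closed borel_open)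
       (auto intro!: closed_Collect_le open_Collect_less continuous_intros)
  finally show ?thesis .
qed

lemma prob_space_torus_measure: "prob_space (torus_measure :: (real ^ 'd) measure)"
proof
  have sub: "box 0 1 \<subseteq> (torus :: (real ^ 'd) set)" "torus \<subseteq> (cbox 0 1 :: (real ^ 'd) set)"
    by (auto simp: torus_def mem_box_cart less_imp_le)
  have *: "(\<Prod>b\<in>Basis. (1 - 0 :: real ^ 'd) \<bullet> b) = 1"
    by (intro prod.neutral ballI) (auto simp: Basis_vec_def inner_axis)
  have **: "\<forall>b\<in>Basis. (0 :: real ^ 'd) \<bullet> b \<le> 1 \<bullet> b"
    by (auto simp: Basis_vec_def inner_axis)
  have "emeasure lborel (torus :: (real ^ 'd) set) \<le> 1"
    using emeasure_mono[OF sub(2), of lborel] * ** by (simp add: emeasure_lborel_cbox_eq)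
  moreover have "emeasure lborel (torus :: (real ^ 'd) set) \<ge> 1"
    using emeasure_mono[OF sub(1), of lborel] torus_in_borel * **
    by (simp add: emeasure_lborel_box_eq)
  ultimately show "emeasure torus_measure (space torus_measure :: (real ^ 'd) set) = 1"
    by (simp add: torus_measure_def space_restrict_space emeasure_restrict_space torus_in_borel)
qed


section \<open>Large intersection classes\<close>

definition dyadic_cube :: "(real ^ 'd) set \<Rightarrow> bool" where
  "dyadic_cube D \<longleftrightarrow> (\<exists>(n :: nat) k :: 'd \<Rightarrow> nat. (\<forall>j. k j < 2 ^ n) \<and>
     D = {x. \<forall>j. real (k j) / 2 ^ n \<le> x $ j \<and> x $ j < (real (k j) + 1) / 2 ^ n})"

text \<open>
  Covers are taken to be sets of cubes rather than indexed families: repeating a cube in a family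
  only increases the sum. Diameters are Euclidean, in \<open>[0,1)^d\<close>.
\<close>

definition net_content :: "real \<Rightarrow> (real ^ 'd) set \<Rightarrow> ennreal" where
  "net_content t A =
     (INF \<D> \<in> {\<D>. countable \<D> \<and> (\<forall>D\<in>\<D>. dyadic_cube D) \<and> A \<subseteq> \<Union>\<D>}.
        \<Sum>\<^sub>\<infinity>D\<in>\<D>. ennreal (diameter D powr t))"

definition large_intersection_class :: "real \<Rightarrow> (real ^ 'd) set set" where
  "large_intersection_class s =
     {A. gdelta_in torus_topology A \<and>
         (\<forall>t D. 0 < t \<and> t < s \<and> dyadic_cube D \<longrightarrow> net_content t (A \<inter> D) = net_content t D)}"


section \<open>Cubes, affine transformations and singular values\<close>

text \<open>
  A cube may be rotated, and may contain or omit any of its faces: each edge \<open>J j\<close> is an open,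
  closed or half-open interval of length \<open>r\<close>.
\<close>

definition nondegenerate_cube :: "(real ^ 'd) set \<Rightarrow> bool" where
  "nondegenerate_cube Q \<longleftrightarrow>
     (\<exists>(a :: real ^ 'd) (f :: real ^ 'd \<Rightarrow> real ^ 'd) J (r :: real). orthogonal_transformation f \<and> 0 < r \<and>
        (\<forall>j. {0<..<r} \<subseteq> J j \<and> J j \<subseteq> {0..r}) \<and>
        Q = (\<lambda>x. a + f x) ` {x. \<forall>j. x $ j \<in> J j})"

definition affine_transformation :: "(real ^ 'd \<Rightarrow> real ^ 'd) \<Rightarrow> bool" where
  "affine_transformation L \<longleftrightarrow> linear (\<lambda>x. L x - L 0)"

definition linear_part :: "(real ^ 'd \<Rightarrow> real ^ 'd) \<Rightarrow> real ^ 'd ^ 'd" where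
  "linear_part L = matrix (\<lambda>x. L x - L 0)"

definition charpoly :: "real ^ 'd ^ 'd \<Rightarrow> real poly" where
  "charpoly A = det (\<chi> i j. (if i = j then [:0, 1:] else 0) - [:A $ i $ j:])"

text \<open>
  The singular values of a matrix \<open>A\<close> are the square roots of the eigenvalues of \<open>A\<^sup>T A\<close>,
  listed in decreasing order and with multiplicity. As \<open>A\<^sup>T A\<close> is symmetric and positive
  semidefinite, its characteristic polynomial splits over the reals with nonnegative roots, so
  the list has length \<open>CARD('d)\<close>.
\<close>

definition singular_values :: "real ^ 'd ^ 'd \<Rightarrow> real list" where
  "singular_values A =
     rev (sorted_list_of_multiset (image_mset sqrt (proots (charpoly (transpose A ** A)))))"

text \<open>The index \<open>k\<close> runs over \<open>{1..CARD('d)}\<close>; the largest singular value is at \<open>k = 1\<close>.\<close>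

definition singular_value :: "nat \<Rightarrow> (real ^ 'd \<Rightarrow> real ^ 'd) \<Rightarrow> real" where
  "singular_value k L = singular_values (linear_part L) ! (k - 1)"

text \<open>For \<open>t > 0\<close>, the integer \<open>m\<close> with \<open>m - 1 < t \<le> m\<close> is the ceiling of \<open>t\<close>.\<close>

definition singular_value_function :: "real \<Rightarrow> (real ^ 'd \<Rightarrow> real ^ 'd) \<Rightarrow> real" where
  "singular_value_function t L =
     (let m = nat \<lceil>t\<rceil>
      in (\<Prod>k = 1..m - 1. singular_value k L) * singular_value m L powr (t - real m + 1))"

end

theory Submission
  imports Defs
begin

text \<open>
  Write \<open>d = CARD('d)\<close>, \<open>\<Phi> = singular_value_function\<close>, and let \<open>W\<^sub>N\<close> be the union of the translates
  with index at least \<open>N\<close>, so that the limsup set is the intersection of the open sets \<open>W\<^sub>N\<close>. The proof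
  has a deterministic half, which reduces the class \<open>\<G>\<^sup>s\<close> to a crude lower bound for the dyadic
  content of each single \<open>W\<^sub>N\<close>, and a probabilistic half, which proves that bound almost surely.

  Deterministic half. A lower bound \<open>c * |D|^t\<close> for the cost of covering \<open>W \<inter> interior D\<close>, with the same
  \<open>c > 0\<close> for all dyadic \<open>D\<close>, improves itself to \<open>c = 1\<close> if \<open>t < d\<close> (\<open>content_ge_improve_constant\<close>):
  apply it in all subcubes of a fixed small relative size, where the factor gained from \<open>t < d\<close>
  compensates \<open>c\<close>. With \<open>c = 1\<close> the bound passes to countable intersections of open sets
  (\<open>content_Inter\<close>): if a family of cubes is too cheap to cover \<open>D\<close>, then it is too cheap for some
  cube with closure in \<open>W\<^sub>0 \<inter> interior D\<close>, then for a cube inside \<open>W\<^sub>1\<close> and the former cube, and so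
  on; the point common to these nested cubes lies in every \<open>W\<^sub>N\<close> and in no cube of the family.

  Probabilistic half. Let \<open>t < \<tau> < s\<close>, so that \<open>\<Sum>\<Phi>\<^sup>\<tau>(L\<^sub>i)\<close> diverges. On each \<open>L\<^sub>i(Q)\<close> put the image of the uniform
  distribution on a small cube with edges along the right singular vectors of \<open>L\<^sub>i\<close>. Computing volumes
  along the singular directions shows that a dyadic cube of side \<open>\<delta>\<close> has mass at most
  \<open>K * \<delta>^\<tau> / \<Phi>\<^sup>\<tau>(L\<^sub>i)\<close>, uniformly over all translates (\<open>cube_mass_le\<close>). Give the i-th translated measure
  the weight \<open>\<Phi>\<^sup>\<tau>(L\<^sub>i)\<close> and add over a finite block of indices, with total weight \<open>S\<close>. By
  independence the mass of \<open>D\<close> concentrates at its mean, \<open>S\<close> times the volume of \<open>D\<close>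
  (\<open>total_mass_concentration\<close>). In the expected dyadic \<open>t\<close>-energy on \<open>D\<close> the off-diagonal part has
  order \<open>S\<^sup>2\<close>, while the mass bound keeps the diagonal part of order \<open>S\<close> (\<open>expected_energy_le\<close>). So for
  large \<open>S\<close> the block has, with probability at least one half, enough mass and so little energy that every cover
  of \<open>W\<^sub>N \<inter> interior D\<close> costs at least \<open>c * |D|^t\<close> (\<open>well_spread_content\<close>). Disjoint blocks
  are independent and divergence supplies infinitely many of them, hence almost surely some block
  is of this kind (\<open>AE_content\<close>).
\<close>

section \<open>Dyadic cubes\<close>

text \<open>
  Cubes are addressed by a point that they contain. This makes nesting a matter of comparing levels
  and turns most combinatorics into rewriting.
\<close>

definition dcube :: "nat \<Rightarrow> real ^ 'd \<Rightarrow> (real ^ 'd) set" where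
  "dcube n x = {y. \<forall>j. \<lfloor>2 ^ n * y $ j\<rfloor> = \<lfloor>2 ^ n * x $ j\<rfloor>}"

lemma dcube_self [simp]: "x \<in> dcube n x"
  by (simp add: dcube_def)

lemma dcube_eq: "y \<in> dcube n x \<Longrightarrow> dcube n y = dcube n x"
  by (auto simp: dcube_def)

lemma dcube_antimono:
  assumes "m \<le> n"
  shows "dcube n x \<subseteq> dcube m x"
proof -
  have "\<lfloor>2 ^ m * a\<rfloor> = \<lfloor>2 ^ n * a\<rfloor> div 2 ^ (n - m)" for a :: real
  proof -
    have "(2 :: real) ^ n = 2 ^ m * 2 ^ (n - m)"
      using assms by (simp flip: power_add)
    then have "2 ^ m * a = (2 ^ n * a) / real_of_int (2 ^ (n - m))"
      by simp
    then show ?thesis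
      using floor_divide_real_eq_div[of "2 ^ (n - m)" "2 ^ n * a"] by simp
  qed
  then show ?thesis by (auto simp: dcube_def)
qed

lemma dcube_nested:
  assumes "dcube m x \<inter> dcube n y \<noteq> {}" "m \<le> n"
  shows "dcube n y \<subseteq> dcube m x"
  using assms by (metis dcube_antimono dcube_eq disjoint_iff)

lemma dcube_eq_box:
  "dcube n x = {y. \<forall>j. real_of_int \<lfloor>2 ^ n * x $ j\<rfloor> / 2 ^ n \<le> y $ j
                      \<and> y $ j < (real_of_int \<lfloor>2 ^ n * x $ j\<rfloor> + 1) / 2 ^ n}"
  unfolding dcube_def floor_eq_iff by (simp add: field_simps)

lemma dyadic_cube_iff: "dyadic_cube D \<longleftrightarrow> (\<exists>n. \<exists>x\<in>torus. D = dcube n x)"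
proof
  assume "dyadic_cube D"
  then obtain n and k :: "'a \<Rightarrow> nat" where k: "\<And>j. k j < 2 ^ n" and
    D: "D = {x. \<forall>j. real (k j) / 2 ^ n \<le> x $ j \<and> x $ j < (real (k j) + 1) / 2 ^ n}"
    by (auto simp: dyadic_cube_def)
  define x :: "real ^ 'a" where "x = (\<chi> j. real (k j) / 2 ^ n)"
  have "real (k j) < 2 ^ n" for j
    using k[of j] by (metis of_nat_less_iff of_nat_numeral of_nat_power)
  then have "x \<in> torus" by (auto simp: torus_def x_def)
  moreover have "D = dcube n x"
    unfolding dcube_eq_box D by (simp add: x_def)
  ultimately show "\<exists>n. \<exists>x\<in>torus. D = dcube n x" by blast
next
  assume "\<exists>n. \<exists>x\<in>torus. D = dcube n x"
  then obtain n and x :: "real ^ 'a" where x: "x \<in> torus" and D: "D = dcube n x" by blast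
  define k where "k = (\<lambda>j. nat \<lfloor>2 ^ n * x $ j\<rfloor>)"
  have k: "real (k j) = real_of_int \<lfloor>2 ^ n * x $ j\<rfloor>" for j
    using x by (simp add: k_def torus_def)
  have "real (k j) < 2 ^ n" for j
  proof -
    have "real (k j) \<le> 2 ^ n * x $ j" unfolding k by simp
    also have "\<dots> < 2 ^ n" using x by (simp add: torus_def)
    finally show ?thesis .
  qed
  then have "k j < 2 ^ n" for j
    by (metis of_nat_less_iff of_nat_numeral of_nat_power)
  then show "dyadic_cube D"
    unfolding dyadic_cube_def D dcube_eq_box k[symmetric] by blast
qed

lemma dyadic_cubeI [intro]: "x \<in> torus \<Longrightarrow> dyadic_cube (dcube n x)"
  by (auto simp: dyadic_cube_iff)

lemma dyadic_cube_nested: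
  assumes "dyadic_cube C" "dyadic_cube D" "C \<inter> D \<noteq> {}"
  shows "C \<subseteq> D \<or> D \<subseteq> C"
proof -
  obtain m x n y where "C = dcube m x" "D = dcube n y"
    using assms by (auto simp: dyadic_cube_iff)
  then show ?thesis
    using assms(3) dcube_nested[of m x n y] dcube_nested[of n y m x]
    by (metis Int_commute nle_le)
qed

lemma dcube_level_mono:
  assumes "dcube n y \<subset> dcube m x"
  shows "m < n"
proof (rule ccontr)
  assume "\<not> m < n"
  moreover have "dcube n y \<inter> dcube m x \<noteq> {}" using dcube_self[of y n] assms by blast
  ultimately have "dcube m x \<subseteq> dcube n y" by (intro dcube_nested) auto
  with assms show False by blast
qed

lemma dcube_subset_torus:
  assumes "x \<in> torus"
  shows "dcube n x \<subseteq> torus"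
proof -
  have "dcube 0 x = torus"
  proof -
    have x: "\<lfloor>x $ j\<rfloor> = 0" for j using assms by (simp add: torus_def floor_eq_iff)
    have f: "\<lfloor>a\<rfloor> = 0 \<longleftrightarrow> 0 \<le> a \<and> a < 1" for a :: real by linarith
    show ?thesis unfolding dcube_def torus_def power_0 mult_1_left x f ..
  qed
  then show ?thesis using dcube_antimono[of 0 n x] by simp
qed

lemma dyadic_cube_subset_torus: "dyadic_cube D \<Longrightarrow> D \<subseteq> torus"
  using dcube_subset_torus by (auto simp: dyadic_cube_iff)

text \<open>
  The open and closed boxes on either side of a half-open cube determine its volume, that of its
  interior, and its diameter.
\<close>

lemma dcube_between:
  fixes x :: "real ^ 'd" and n :: nat
  defines "a \<equiv> \<chi> j. real_of_int \<lfloor>2 ^ n * x $ j\<rfloor> / 2 ^ n"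
  shows "box a (a + (\<chi> j. 1 / 2 ^ n)) \<subseteq> dcube n x" "dcube n x \<subseteq> cbox a (a + (\<chi> j. 1 / 2 ^ n))"
  unfolding a_def dcube_eq_box
  by (auto simp: mem_box_cart less_imp_le add_divide_distrib)

lemma dcube_borel [measurable]: "dcube n x \<in> sets borel"
  unfolding dcube_def by measurable

lemma emeasure_cube_box:
  fixes a :: "real ^ 'd"
  shows "emeasure lborel (box a (a + (\<chi> j. 1 / 2 ^ n))) = ennreal ((1 / 2 ^ n) ^ CARD('d))"
    and "emeasure lborel (cbox a (a + (\<chi> j. 1 / 2 ^ n))) = ennreal ((1 / 2 ^ n) ^ CARD('d))"
proof -
  have B: "(\<chi> j. 1 / 2 ^ n) \<bullet> b = (1 / 2 ^ n :: real)" if "b \<in> Basis" for b :: "real ^ 'd"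
    using that by (auto simp: Basis_vec_def inner_axis)
  have *: "prod ((\<bullet>) (\<chi> j. (1 / 2 ^ n :: real))) (Basis :: (real ^ 'd) set) = ((1 / 2 ^ n :: real)) ^ CARD('d)"
  proof -
    have "prod ((\<bullet>) (\<chi> j. (1 / 2 ^ n :: real))) (Basis :: (real ^ 'd) set) = (\<Prod>b\<in>(Basis :: (real ^ 'd) set). (1 / 2 ^ n :: real))"
      by (intro prod.cong refl B)
    then show ?thesis by simp
  qed
  have **: "\<forall>b\<in>Basis. a \<bullet> b \<le> (a + (\<chi> j. 1 / 2 ^ n)) \<bullet> b"
    by (auto simp: B inner_add_left)
  show "emeasure lborel (box a (a + (\<chi> j. 1 / 2 ^ n))) = ennreal ((1 / 2 ^ n) ^ CARD('d))"
    using ** by (subst emeasure_lborel_box_eq) (simp add: *)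
  show "emeasure lborel (cbox a (a + (\<chi> j. 1 / 2 ^ n))) = ennreal ((1 / 2 ^ n) ^ CARD('d))"
    using ** by (subst emeasure_lborel_cbox_eq) (simp add: *)
qed

lemma emeasure_dcube:
  fixes x :: "real ^ 'd" and n :: nat
  shows "emeasure lborel (dcube n x) = ennreal ((1 / 2 ^ n) ^ CARD('d))"
    and "emeasure lborel (interior (dcube n x)) = ennreal ((1 / 2 ^ n) ^ CARD('d))"
proof -
  define a :: "real ^ 'd" where "a = (\<chi> j. real_of_int \<lfloor>2 ^ n * x $ j\<rfloor> / 2 ^ n)"
  let ?b = "a + (\<chi> j. (1 / 2 ^ n :: real))"
  note sub = dcube_between[of n x, folded a_def]
  have "box a ?b \<subseteq> interior (dcube n x)" 
    by (intro interior_maximal sub(1) open_box)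
  then have 1: "ennreal ((1 / 2 ^ n) ^ CARD('d)) \<le> emeasure lborel (interior (dcube n x))"
    using emeasure_mono[of "box a ?b" "interior (dcube n x)" lborel] by (simp add: emeasure_cube_box)
  have 2: "emeasure lborel (interior (dcube n x)) \<le> emeasure lborel (dcube n x)"
    by (intro emeasure_mono interior_subset) auto
  have 3: "emeasure lborel (dcube n x) \<le> ennreal ((1 / 2 ^ n) ^ CARD('d))"
    using emeasure_mono[OF sub(2), of lborel] by (simp add: emeasure_cube_box)
  show "emeasure lborel (dcube n x) = ennreal ((1 / 2 ^ n) ^ CARD('d))"
    using 1 2 3 by order
  show "emeasure lborel (interior (dcube n x)) = ennreal ((1 / 2 ^ n) ^ CARD('d))"
    using 1 2 3 by order
qed

lemma bounded_dcube: "bounded (dcube n x)"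
  using dcube_between(2)[of n x] bounded_cbox bounded_subset by blast

lemma diameter_dcube:
  fixes x :: "real ^ 'd"
  shows "diameter (dcube n x) = sqrt CARD('d) / 2 ^ n"
proof -
  define a :: "real ^ 'd" where "a = (\<chi> j. real_of_int \<lfloor>2 ^ n * x $ j\<rfloor> / 2 ^ n)"
  let ?b = "a + (\<chi> j. (1 / 2 ^ n :: real))"
  note sub = dcube_between[of n x, folded a_def]
  have "dist a ?b = norm (\<chi> j :: 'd. (1 / 2 ^ n :: real))"
    by (simp add: dist_norm norm_minus_commute)
  also have "\<dots> = sqrt CARD('d) / 2 ^ n"
    by (simp add: norm_vec_def L2_set_def real_sqrt_mult real_sqrt_divide power_divide)
  finally have d: "diameter (cbox a ?b) = sqrt CARD('d) / 2 ^ n"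
    by (subst diameter_cbox) (auto simp: inner_add_left Basis_vec_def inner_axis)
  have "box a ?b \<noteq> {}"
    by (auto simp: box_ne_empty inner_add_left Basis_vec_def inner_axis)
  then have "diameter (cbox a ?b) = diameter (box a ?b)"
    by (metis closure_box diameter_closure bounded_box)
  also have "\<dots> \<le> diameter (dcube n x)"
    by (intro diameter_subset sub(1) bounded_dcube)
  finally have "diameter (cbox a ?b) \<le> diameter (dcube n x)" .
  moreover have "diameter (dcube n x) \<le> diameter (cbox a ?b)"
    by (intro diameter_subset sub(2) bounded_cbox)
  ultimately show ?thesis using d by simp
qed

definition dlevel :: "nat \<Rightarrow> (real ^ 'd) set set" where
  "dlevel n = dcube n ` torus"

lemma finite_dlevel: "finite (dlevel n :: (real ^ 'd) set set)"
proof -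
  let ?K = "{k :: int ^ 'd. \<forall>j. k $ j \<in> {0..<2 ^ n}}"
  have "finite ?K"
  proof -
    have "finite ((UNIV :: 'd set) \<rightarrow>\<^sub>E {0..<(2::int) ^ n})"
      by (intro finite_PiE) auto
    moreover have "?K \<subseteq> (\<lambda>f. \<chi> j. f j) ` ((UNIV :: 'd set) \<rightarrow>\<^sub>E {0..<(2::int) ^ n})"
    proof
      fix k assume "k \<in> ?K"
      then show "k \<in> (\<lambda>f. \<chi> j. f j) ` ((UNIV :: 'd set) \<rightarrow>\<^sub>E {0..<(2::int) ^ n})"
        by (intro image_eqI[of _ _ "\<lambda>j. k $ j"]) auto
    qed
    ultimately show ?thesis by (meson finite_imageI finite_subset)
  qed
  moreover have "dlevel n \<subseteq> (\<lambda>k. {y. \<forall>j. \<lfloor>2 ^ n * y $ j\<rfloor> = k $ j}) ` ?K"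
  proof
    fix D :: "(real ^ 'd) set" assume "D \<in> dlevel n"
    then obtain x where x: "x \<in> torus" "D = dcube n x" by (auto simp: dlevel_def)
    have "(\<chi> j. \<lfloor>2 ^ n * x $ j\<rfloor>) \<in> ?K"
      using x(1) by (auto simp: torus_def floor_less_iff)
    then show "D \<in> (\<lambda>k. {y. \<forall>j. \<lfloor>2 ^ n * y $ j\<rfloor> = k $ j}) ` ?K"
      by (intro image_eqI[of _ _ "\<chi> j. \<lfloor>2 ^ n * x $ j\<rfloor>"]) (auto simp: x(2) dcube_def)
  qed
  ultimately show ?thesis by (meson finite_imageI finite_subset)
qed

lemma dyadic_cube_iff_dlevel: "dyadic_cube D \<longleftrightarrow> D \<in> (\<Union>n. dlevel n)"
  by (auto simp: dyadic_cube_iff dlevel_def)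

lemma countable_dyadic_cubes: "countable {D :: (real ^ 'd) set. dyadic_cube D}"
proof -
  have "{D :: (real ^ 'd) set. dyadic_cube D} = (\<Union>n. dlevel n)"
    using dyadic_cube_iff_dlevel by blast
  then show ?thesis by (simp add: countable_finite finite_dlevel)
qed

lemma dlevel_disjoint: "C \<in> dlevel n \<Longrightarrow> D \<in> dlevel n \<Longrightarrow> C \<inter> D \<noteq> {} \<Longrightarrow> C = D"
  unfolding dlevel_def using dcube_eq by blast

definition subcubes :: "nat \<Rightarrow> (real ^ 'd) set \<Rightarrow> (real ^ 'd) set set" where
  "subcubes n D = {C \<in> dlevel n. C \<subseteq> D}"

lemma measure_dcube:
  fixes x :: "real ^ 'd"
  shows "measure lborel (dcube n x) = (1 / 2 ^ n) ^ CARD('d)"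
  by (simp add: measure_def emeasure_dcube)

lemma subcubes_borel: "C \<in> subcubes n D \<Longrightarrow> C \<in> sets borel"
  by (auto simp: subcubes_def dlevel_def)

lemma finite_subcubes: "finite (subcubes n D)"
  unfolding subcubes_def by (rule finite_subset[OF _ finite_dlevel[of n]]) auto

text \<open>
  The subcubes are disjoint and have equal volume, so their number is bounded by comparing volumes.
\<close>

lemma card_subcubes_le:
  fixes x :: "real ^ 'd"
  shows "real (card (subcubes m (dcube n x))) * (1 / 2 ^ m) ^ CARD('d) \<le> (1 / 2 ^ n) ^ CARD('d)"
proof -
  let ?S = "subcubes m (dcube n x)"
  have "disjoint_family_on (\<lambda>C. C) ?S"
    unfolding disjoint_family_on_def subcubes_def using dlevel_disjoint by blast
  then have "(\<Sum>C\<in>?S. emeasure lborel C) = emeasure lborel (\<Union>C\<in>?S. C)"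
    using subcubes_borel by (intro sum_emeasure finite_subcubes) auto
  also have "\<dots> \<le> emeasure lborel (dcube n x)"
    by (intro emeasure_mono) (auto simp: subcubes_def)
  also have "(\<Sum>C\<in>?S. emeasure lborel C) = (\<Sum>C\<in>?S. ennreal ((1 / 2 ^ m) ^ CARD('d)))"
    by (intro sum.cong) (auto simp: subcubes_def dlevel_def emeasure_dcube)
  also have "\<dots> = ennreal (real (card ?S) * (1 / 2 ^ m) ^ CARD('d))"
    by (simp add: ennreal_of_nat_eq_real_of_nat ennreal_mult)
  finally show ?thesis unfolding emeasure_dcube by (subst (asm) ennreal_le_iff) auto
qed

section \<open>Dyadic contents of open sets and their intersections\<close>

text \<open>
  The cost of a family of cubes. As a measure on the set of cubes it can be split along countable
  partitions of a family without any summability conditions.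
\<close>

definition cweight :: "real \<Rightarrow> (real ^ 'd) set set \<Rightarrow> ennreal" where
  "cweight t F = emeasure (density (count_space UNIV) (\<lambda>C. ennreal (diameter C powr t))) F"

lemma cweight_eq_nn_integral:
  "cweight t F = (\<integral>\<^sup>+C. ennreal (diameter C powr t) \<partial>count_space F)"
  unfolding cweight_def by (subst emeasure_density) (auto simp: nn_integral_count_space_indicator)

lemma cweight_mono: "F \<subseteq> G \<Longrightarrow> cweight t F \<le> cweight t G"
  unfolding cweight_def by (intro emeasure_mono) auto

lemma cweight_singleton: "cweight t {C} = ennreal (diameter C powr t)"
  unfolding cweight_eq_nn_integral by (simp add: nn_integral_count_space_finite)

lemma cweight_Un: "F \<inter> G = {} \<Longrightarrow> cweight t (F \<union> G) = cweight t F + cweight t G"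
  unfolding cweight_def by (intro plus_emeasure[symmetric]) auto

lemma cweight_Un_le: "cweight t (F \<union> G) \<le> cweight t F + cweight t G"
  unfolding cweight_def by (intro emeasure_subadditive) auto

lemma cweight_UN:
  assumes "countable I" "disjoint_family_on B I"
  shows "cweight t (\<Union>i\<in>I. B i) = (\<integral>\<^sup>+i. cweight t (B i) \<partial>count_space I)"
  unfolding cweight_def using assms by (intro emeasure_UN_countable) auto

lemma infsum_eq_cweight:
  assumes "countable F"
  shows "(\<Sum>\<^sub>\<infinity>C\<in>F. ennreal (diameter C powr t)) = cweight t F"
proof -
  let ?f = "\<lambda>C. ennreal (diameter C powr t)"
  have fin: "sum ?f G = cweight t G" if "finite G" for G
    using that unfolding cweight_eq_nn_integral by (simp add: nn_integral_count_space_finite)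
  have eq: "infsum ?f F = (SUP G\<in>{G. finite G \<and> G \<subseteq> F}. sum ?f G)"
    by (rule nonneg_infsum_complete) simp
  have "infsum ?f F \<le> cweight t F"
    unfolding eq by (intro SUP_least) (auto simp: fin simp del: sum_ennreal intro!: cweight_mono)
  moreover have "cweight t F \<le> infsum ?f F"
  proof (cases "finite F")
    case True then show ?thesis by (simp add: fin del: sum_ennreal)
  next
    case False
    note bij = bij_betw_from_nat_into[OF assms False]
    have "cweight t F = (\<Sum>n. ?f (from_nat_into F n))"
      unfolding cweight_eq_nn_integral
      by (simp add: nn_integral_bij_count_space[symmetric, OF bij] nn_integral_count_space_nat)
    also have "\<dots> = (SUP n. \<Sum>i<n. ?f (from_nat_into F i))"
      by (rule suminf_eq_SUP)
    also have "\<dots> \<le> infsum ?f F"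
    proof (rule SUP_least)
      fix n :: nat
      have inj: "inj_on (from_nat_into F) {..<n}"
        using bij by (meson bij_betw_def inj_on_subset subset_UNIV)
      have "(\<Sum>i<n. ?f (from_nat_into F i)) = sum ?f (from_nat_into F ` {..<n})"
        using inj by (simp add: sum.reindex)
      also have "\<dots> \<le> infsum ?f F"
        unfolding eq using bij by (intro SUP_upper) (auto simp: bij_betw_def)
      finally show "(\<Sum>i<n. ?f (from_nat_into F i)) \<le> infsum ?f F" .
    qed
    finally show ?thesis .
  qed
  ultimately show ?thesis by (rule antisym)
qed

lemma cweight_dcube:
  fixes x :: "real ^ 'd"
  shows "cweight t {dcube n x} = ennreal ((sqrt CARD('d) / 2 ^ n) powr t)"
  by (simp add: cweight_singleton diameter_dcube)

lemma dyadic_cube_bounded: "dyadic_cube D \<Longrightarrow> bounded D"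
  by (auto simp: dyadic_cube_iff bounded_dcube)

lemma dyadic_cube_nonempty: "dyadic_cube D \<Longrightarrow> D \<noteq> {}"
  by (auto simp: dyadic_cube_iff) (metis dcube_self empty_iff)

lemma dyadic_cube_borel: "dyadic_cube D \<Longrightarrow> D \<in> sets borel"
  by (auto simp: dyadic_cube_iff)

lemma countable_dyadic_family: "F \<subseteq> Collect dyadic_cube \<Longrightarrow> countable F"
  using countable_dyadic_cubes by (rule countable_subset[rotated])

lemma cweight_cube_mono:
  assumes "C \<subseteq> D" "dyadic_cube D" "0 \<le> t"
  shows "cweight t {C} \<le> cweight t {D}"
  unfolding cweight_singleton
  using assms dyadic_cube_bounded[OF assms(2)] bounded_subset[OF dyadic_cube_bounded[OF assms(2)] assms(1)]
  by (intro ennreal_leI powr_mono2 diameter_subset) (auto intro!: diameter_ge_0)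

lemma cweight_superset:
  assumes "D \<subseteq> C" "C \<in> F" "F \<subseteq> Collect dyadic_cube" "0 \<le> t"
  shows "cweight t {D} \<le> cweight t F"
  using cweight_cube_mono[of D C t] cweight_mono[of "{C}" F t] assms by (auto intro: order_trans)

text \<open>
  Covers of \<open>W \<inter> interior D\<close> rather than of \<open>W \<inter> D\<close> are considered, because this is an open subset of
  \<open>real ^ 'd\<close> when \<open>W\<close> is open in the torus, and cubes constructed inside it have their closures in \<open>D\<close>.
  As there are only countably many dyadic cubes, every family of them is countable.
\<close>

definition content_ge :: "real \<Rightarrow> real \<Rightarrow> (real ^ 'd) set \<Rightarrow> bool" where
  "content_ge c t W \<longleftrightarrow> (\<forall>D F. dyadic_cube D \<longrightarrow> F \<subseteq> Collect dyadic_cube \<longrightarrow> W \<inter> interior D \<subseteq> \<Union>F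
      \<longrightarrow> ennreal c * cweight t {D} \<le> cweight t F)"

lemma content_geD:
  "content_ge c t W \<Longrightarrow> dyadic_cube D \<Longrightarrow> F \<subseteq> Collect dyadic_cube \<Longrightarrow> W \<inter> interior D \<subseteq> \<Union>F
      \<Longrightarrow> ennreal c * cweight t {D} \<le> cweight t F"
  by (auto simp: content_ge_def)

text \<open>
  Since \<open>t \<le> d\<close>, a smaller cube costs more per unit of volume.
\<close>

lemma cweight_volume_ratio:
  fixes x y :: "real ^ 'd" and t :: real
  assumes "t \<le> CARD('d)" "n \<le> l"
  shows "cweight t {dcube n x} * emeasure lborel (dcube l y)
       \<le> cweight t {dcube l y} * emeasure lborel (dcube n x)"
proof -
  define q where "q = (1 / 2 ^ (l - n) :: real)"
  define b where "b = (1 / 2 ^ n :: real)"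
  have a: "1 / 2 ^ l = q * b"
    using assms(2) by (simp add: q_def b_def flip: power_add)
  have q: "0 < q" "q \<le> 1" and b: "0 < b" by (auto simp: q_def b_def)
  have d: "0 < sqrt CARD('d)" by simp
  have "q ^ CARD('d) = q powr CARD('d)" using q by (simp add: powr_realpow)
  also have "\<dots> \<le> q powr t" using q assms(1) by (intro powr_mono') auto
  finally have "(sqrt CARD('d) * b) powr t * (q * b) ^ CARD('d)
      \<le> (sqrt CARD('d) * b) powr t * (q powr t * b ^ CARD('d))"
    using b by (intro mult_left_mono) (auto simp: power_mult_distrib)
  also have "\<dots> = (sqrt CARD('d) * (q * b)) powr t * b ^ CARD('d)"
    using q b by (simp add: powr_mult mult_ac)
  finally have "(sqrt CARD('d) / 2 ^ n) powr t * (1 / 2 ^ l) ^ CARD('d)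
      \<le> (sqrt CARD('d) / 2 ^ l) powr t * (1 / 2 ^ n) ^ CARD('d)"
    unfolding a[symmetric] by (simp add: b_def)
  then show ?thesis
    unfolding cweight_dcube emeasure_dcube by (simp flip: ennreal_mult)
qed

text \<open>
  Subdivide \<open>D\<close> into cubes that are \<open>2 ^ m\<close> times smaller, where \<open>m\<close> is so large that
  \<open>c * 2 ^ (m * (d - t)) \<ge> 1\<close>. Given a cover of \<open>W \<inter> interior D\<close>, each small cube either is contained in
  a member of the cover, or the members inside it already cover its part of \<open>W\<close> and hence cost at
  least \<open>c\<close> times its own cost. In both cases the cost per unit of volume is at least that of \<open>D\<close>,
  and the small cubes fill \<open>D\<close>. Comparing volumes replaces any counting of cubes.
\<close>

lemma content_ge_improve_constant:
  fixes W :: "(real ^ 'd) set"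
  assumes W: "content_ge c t W" and c: "0 < c" and t: "0 \<le> t" "t < CARD('d)"
  shows "content_ge 1 t W"
  unfolding content_ge_def
proof (intro allI impI)
  fix D :: "(real ^ 'd) set" and F
  assume D: "dyadic_cube D" and F: "F \<subseteq> Collect dyadic_cube" and cov: "W \<inter> interior D \<subseteq> \<Union>F"
  show "ennreal 1 * cweight t {D} \<le> cweight t F"
  proof (cases "\<exists>C\<in>F. D \<subseteq> C")
    case True
    then show ?thesis using cweight_superset[OF _ _ F t(1)] by auto
  next
    case False
    obtain n x where x: "x \<in> torus" and Dx: "D = dcube n x"
      using D by (auto simp: dyadic_cube_iff)
    obtain m where m: "1 / c < (2 powr (CARD('d) - t)) ^ m"
      using real_arch_pow[of "2 powr (CARD('d) - t)" "1 / c"] t by auto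
    define S where "S = {E \<in> dlevel (n + m). E \<subseteq> D \<and> \<not> (\<exists>C\<in>F. E \<subseteq> C)}"
    \<comment> \<open>\<open>S\<close>: small cubes not contained in a member of the cover; \<open>G\<close>: the members that contain the other small cubes\<close>
    define G where "G = {C \<in> F. C \<subseteq> D \<and> (\<exists>E\<in>dlevel (n + m). E \<subseteq> C)}"
    define B where "B E = {C \<in> F. C \<subseteq> E}" for E
    have finS: "finite S" unfolding S_def by (rule finite_subset[OF _ finite_dlevel[of "n + m"]]) auto
    have Sdy: "dyadic_cube E" if "E \<in> S" for E
      using that unfolding S_def dyadic_cube_iff_dlevel by blast
    have "G \<subseteq> (\<Union>l\<in>{..n + m}. dlevel l)"
    proof
      fix C assume C: "C \<in> G"
      then obtain l y where y: "y \<in> torus" "C = dcube l y"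
        using F unfolding G_def dyadic_cube_iff by blast
      from C obtain z where z: "z \<in> torus" "dcube (n + m) z \<subseteq> dcube l y"
        unfolding G_def dlevel_def y by blast
      show "C \<in> (\<Union>l\<in>{..n + m}. dlevel l)"
      proof (cases "l \<le> n + m")
        case True then show ?thesis using y by (auto simp: dlevel_def)
      next
        case False
        then have "dcube l y \<subseteq> dcube (n + m) z"
          using z dcube_self[of z "n + m"] by (intro dcube_nested) (blast, simp)
        then have "C = dcube (n + m) z" using z y by auto
        then show ?thesis using z by (auto simp: dlevel_def)
      qed
    qed
    then have finG: "finite G"
      by (rule finite_subset) (auto intro: finite_dlevel)
    have Gdy: "dyadic_cube C" if "C \<in> G" for C using that F by (auto simp: G_def)
    have disjG: "G \<inter> (\<Union>E\<in>S. B E) = {}"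
    proof (rule ccontr)
      assume "G \<inter> (\<Union>E\<in>S. B E) \<noteq> {}"
      then obtain C E E' where E: "E \<in> S" "C \<subseteq> E" "C \<in> F" "E' \<in> dlevel (n + m)" "E' \<subseteq> C"
        by (auto simp: G_def B_def)
      moreover have "dyadic_cube E'" using E(4) dyadic_cube_iff_dlevel by blast
      ultimately have "E' \<noteq> {}" by (intro dyadic_cube_nonempty)
      then have "E' = E" using E by (intro dlevel_disjoint[of _ "n + m"]) (auto simp: S_def)
      then show False using E by (auto simp: S_def)
    qed
    have disjB: "disjoint_family_on B S"
      unfolding disjoint_family_on_def
    proof (intro ballI impI)
      fix E E' assume E: "E \<in> S" "E' \<in> S" "E \<noteq> E'"
      then have "E \<inter> E' = {}" using dlevel_disjoint[of E "n + m" E'] by (auto simp: S_def)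
      then show "B E \<inter> B E' = {}"
        using F dyadic_cube_nonempty unfolding B_def by blast
    qed
    have volG: "cweight t {D} * emeasure lborel C \<le> cweight t {C} * emeasure lborel D" if C: "C \<in> G" for C
    proof -
      obtain l y where y: "C = dcube l y" using Gdy[OF C] unfolding dyadic_cube_iff by blast
      have "n \<le> l"
        using C False dcube_level_mono[of l y n x] unfolding Dx y G_def by force
      then show ?thesis unfolding Dx y using cweight_volume_ratio[of t n l x y] t by simp
    qed
    have volS: "cweight t {D} * emeasure lborel E \<le> cweight t (B E) * emeasure lborel D" if E: "E \<in> S" for E
    proof -
      obtain y where y: "E = dcube (n + m) y" using E by (auto simp: S_def dlevel_def)
      have "W \<inter> interior E \<subseteq> \<Union>(B E)"
      proof
        fix p assume p: "p \<in> W \<inter> interior E"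
        then have "p \<in> W \<inter> interior D" using E interior_mono[of E D] by (auto simp: S_def)
        then obtain C where C: "C \<in> F" "p \<in> C" using cov by auto
        have "C \<subseteq> E \<or> E \<subseteq> C"
          using C F p interior_subset[of E] Sdy[OF E] by (intro dyadic_cube_nested) auto
        then show "p \<in> \<Union>(B E)" using C E by (auto simp: B_def S_def)
      qed
      then have "ennreal c * cweight t {E} \<le> cweight t (B E)"
        using F Sdy[OF E] by (intro content_geD[OF W]) (auto simp: B_def)
      moreover have "cweight t {D} * emeasure lborel E \<le> (ennreal c * cweight t {E}) * emeasure lborel D"
      proof -
        define q where "q = (1 / 2 ^ m :: real)"
        define b where "b = (1 / 2 ^ n :: real)"
        have a: "1 / 2 ^ (n + m) = q * b"
          by (simp add: q_def b_def power_add)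
        have q: "0 < q" and b: "0 < b" by (auto simp: q_def b_def)
        have "(2 powr (CARD('d) - t)) ^ m = q powr (t - CARD('d))"
          by (simp add: q_def powr_divide powr_power powr_powr algebra_simps flip: powr_realpow powr_minus_divide)
        then have "1 \<le> c * q powr (t - CARD('d))" using m c by (simp add: field_simps)
        then have "1 * q powr CARD('d) \<le> c * q powr (t - CARD('d)) * q powr CARD('d)"
          by (intro mult_right_mono) auto
        also have "\<dots> = c * q powr t" by (simp flip: powr_add)
        finally have "q ^ CARD('d) \<le> c * q powr t" using q by (simp add: powr_realpow)
        then have "(sqrt CARD('d) * b) powr t * (q * b) ^ CARD('d)
            \<le> (sqrt CARD('d) * b) powr t * ((c * q powr t) * b ^ CARD('d))"
          using b by (intro mult_left_mono) (auto simp: power_mult_distrib)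
        also have "\<dots> = c * (sqrt CARD('d) * (q * b)) powr t * b ^ CARD('d)"
          using q b by (simp add: powr_mult mult_ac)
        finally have "(sqrt CARD('d) / 2 ^ n) powr t * (1 / 2 ^ (n + m)) ^ CARD('d)
            \<le> c * (sqrt CARD('d) / 2 ^ (n + m)) powr t * (1 / 2 ^ n) ^ CARD('d)"
          unfolding a[symmetric] by (simp add: b_def)
        then show ?thesis
          unfolding cweight_dcube emeasure_dcube Dx y using c by (simp flip: ennreal_mult)
      qed
      ultimately show ?thesis by (meson mult_right_mono order_trans zero_le)
    qed
    have "D \<subseteq> \<Union>G \<union> \<Union>S"
    proof
      fix p assume p: "p \<in> D"
      then have pt: "p \<in> torus" using D dyadic_cube_subset_torus by blast
      have sub: "dcube (n + m) p \<subseteq> D"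
        using p dcube_antimono[of n "n + m" p] dcube_eq[of p n x] by (simp add: Dx)
      show "p \<in> \<Union>G \<union> \<Union>S"
      proof (cases "\<exists>C\<in>F. dcube (n + m) p \<subseteq> C")
        case True
        then obtain C where C: "C \<in> F" "dcube (n + m) p \<subseteq> C" by blast
        then have pC: "p \<in> C" using dcube_self by blast
        then have "C \<subseteq> D" using dyadic_cube_nested[of C D] D F p False C by blast
        then have "C \<in> G" using C pt by (auto simp: G_def dlevel_def)
        then show ?thesis using pC by auto
      next
        case False
        then have "dcube (n + m) p \<in> S" using sub pt by (auto simp: S_def dlevel_def)
        then show ?thesis using dcube_self[of p "n + m"] by blast
      qed
    qed
    moreover have GB: "G \<subseteq> sets borel" and SB: "S \<subseteq> sets borel"
      using Gdy Sdy dyadic_cube_borel by blast+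
    ultimately have "emeasure lborel D \<le> emeasure lborel (\<Union>G \<union> \<Union>S)"
      using finG finS by (intro emeasure_mono) (auto intro!: sets.Un sets.finite_Union)
    also have "\<dots> \<le> emeasure lborel (\<Union>G) + emeasure lborel (\<Union>S)"
      using finG finS GB SB
      by (intro emeasure_subadditive) (auto intro!: sets.finite_Union)
    also have "\<dots> \<le> (\<Sum>C\<in>G. emeasure lborel C) + (\<Sum>E\<in>S. emeasure lborel E)"
      using emeasure_subadditive_finite[OF finG, of "\<lambda>C. C" lborel] emeasure_subadditive_finite[OF finS, of "\<lambda>C. C" lborel]
        GB SB by (intro add_mono) auto
    finally have "cweight t {D} * emeasure lborel D
        \<le> cweight t {D} * ((\<Sum>C\<in>G. emeasure lborel C) + (\<Sum>E\<in>S. emeasure lborel E))"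
      by (rule mult_left_mono) simp
    also have "\<dots> = (\<Sum>C\<in>G. cweight t {D} * emeasure lborel C) + (\<Sum>E\<in>S. cweight t {D} * emeasure lborel E)"
      by (simp add: distrib_left sum_distrib_left)
    also have "\<dots> \<le> (\<Sum>C\<in>G. cweight t {C} * emeasure lborel D) + (\<Sum>E\<in>S. cweight t (B E) * emeasure lborel D)"
      by (intro add_mono sum_mono volG volS)
    also have "\<dots> = ((\<Sum>C\<in>G. cweight t {C}) + (\<Sum>E\<in>S. cweight t (B E))) * emeasure lborel D"
      by (simp add: distrib_right sum_distrib_right)
    also have "(\<Sum>C\<in>G. cweight t {C}) = cweight t G"
      using finG by (simp add: cweight_singleton cweight_eq_nn_integral[of t G] nn_integral_count_space_finite)
    also have "(\<Sum>E\<in>S. cweight t (B E)) = cweight t (\<Union>E\<in>S. B E)"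
      using finS by (simp add: cweight_UN[OF countable_finite[OF finS] disjB] nn_integral_count_space_finite)
    also have "cweight t G + cweight t (\<Union>E\<in>S. B E) = cweight t (G \<union> (\<Union>E\<in>S. B E))"
      using disjG by (simp add: cweight_Un)
    also have "\<dots> \<le> cweight t F"
      by (intro cweight_mono) (auto simp: G_def B_def)
    finally have "cweight t {D} * emeasure lborel D \<le> cweight t F * emeasure lborel D"
      by (simp add: mult_right_mono)
    then show ?thesis
      unfolding Dx emeasure_dcube 
      by (simp add: mult.commute[of _ "ennreal ((1 / 2 ^ n) ^ CARD('d))"] ennreal_mult_le_mult_iff)
  qed
qed

text \<open>
  The property that is handed down along a nested sequence of cubes. The first clause is needed besides the
  comparison of costs because a single member of \<open>F\<close> that contains \<open>D\<close> would cover it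
  without contributing to the cost of the members inside \<open>D\<close>.
\<close>

definition undercovered :: "real \<Rightarrow> (real ^ 'd) set set \<Rightarrow> (real ^ 'd) set \<Rightarrow> bool" where
  "undercovered t F D \<longleftrightarrow> (\<forall>C\<in>F. \<not> D \<subseteq> C) \<and> cweight t {C \<in> F. C \<subseteq> D} < cweight t {D}"

lemma dcube_closure_in_open:
  fixes x :: "real ^ 'd"
  assumes "open A" "x \<in> A"
  shows "\<exists>n. closure (dcube n x) \<subseteq> A"
proof -
  obtain e where e: "0 < e" "cball x e \<subseteq> A"
    using assms open_contains_cball by blast
  obtain n where n: "sqrt CARD('d) / e < 2 ^ n"
    using real_arch_pow[of 2 "sqrt CARD('d) / e"] by auto
  have "dcube n x \<subseteq> cball x e"
  proof
    fix y assume "y \<in> dcube n x"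
    then have "dist x y \<le> sqrt CARD('d) / 2 ^ n"
      using diameter_bounded_bound[OF bounded_dcube, of x n x y] by (simp add: diameter_dcube)
    also have "\<dots> \<le> e" using n e by (simp add: field_simps)
    finally show "y \<in> cball x e" by simp
  qed
  then have "closure (dcube n x) \<subseteq> cball x e" by (simp add: closure_minimal)
  then show ?thesis using e by blast
qed

text \<open>
  Decompose \<open>W \<inter> interior D\<close> into the maximal dyadic cubes with closure inside it. If none of them
  were undercovered, replace all members of \<open>F\<close> lying inside a maximal cube by that cube, unless a member
  of \<open>F\<close> contains it. This would not raise the cost, and would produce a cover of \<open>W \<inter> interior D\<close> cheaper
  than \<open>D\<close>.
\<close>

lemma undercovered_subcube:
  fixes W :: "(real ^ 'd) set"
  assumes W: "content_ge 1 t W" and op: "open (W \<inter> interior D)"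
    and D: "dyadic_cube D" and F: "F \<subseteq> Collect dyadic_cube" and undercovered: "undercovered t F D"
  shows "\<exists>E. dyadic_cube E \<and> closure E \<subseteq> W \<inter> interior D \<and> undercovered t F E"
proof -
  define A where "A = W \<inter> interior D"
  define N where "N x = (LEAST n. closure (dcube n x) \<subseteq> A)" for x
  define K where "K = (\<lambda>x. dcube (N x) x) ` A"
  have AD: "A \<subseteq> D" using interior_subset[of D] by (auto simp: A_def)
  have clN: "closure (dcube (N x) x) \<subseteq> A" if "x \<in> A" for x
  proof -
    have "\<exists>n. closure (dcube n x) \<subseteq> A" using op that by (intro dcube_closure_in_open) (simp_all add: A_def)
    then show ?thesis unfolding N_def by (rule LeastI_ex)
  qed
  have Kdy: "dyadic_cube E" if "E \<in> K" for E
    using that AD dyadic_cube_subset_torus[OF D] by (auto simp: K_def)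
  have Kcl: "closure E \<subseteq> A" if "E \<in> K" for E using that clN by (auto simp: K_def)
  have Ksub: "E \<subseteq> A" if "E \<in> K" for E using Kcl[OF that] closure_subset[of E] by blast
  have Kcov: "A \<subseteq> \<Union>K" unfolding K_def using dcube_self by blast
  have half: "dcube (N x) x = dcube (N y) y"
    if "x \<in> A" "y \<in> A" "N x \<le> N y" "dcube (N x) x \<inter> dcube (N y) y \<noteq> {}" for x y
  proof -
    have "dcube (N y) y \<subseteq> dcube (N x) x" using that by (intro dcube_nested)
    then have eq: "dcube (N x) y = dcube (N x) x" using dcube_self by (intro dcube_eq) blast
    then have "N y \<le> N x" unfolding N_def[of y] using clN[OF that(1)] by (intro Least_le) simp
    then show ?thesis using that eq by simp
  qed
  have Kdisj: "E = E'" if "E \<in> K" "E' \<in> K" "E \<inter> E' \<noteq> {}" for E E'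
  proof -
    obtain x y where xy: "x \<in> A" "y \<in> A" "E = dcube (N x) x" "E' = dcube (N y) y"
      using \<open>E \<in> K\<close> \<open>E' \<in> K\<close> by (auto simp: K_def)
    then show ?thesis
      using half[of x y] half[of y x] \<open>E \<inter> E' \<noteq> {}\<close> by (cases "N x \<le> N y") (auto simp: Int_commute)
  qed
  have "\<exists>E\<in>K. undercovered t F E"
  proof (rule ccontr)
    assume no: "\<not> (\<exists>E\<in>K. undercovered t F E)"
    \<comment> \<open>\<open>K1\<close>: the maximal cubes kept in the new cover; \<open>G\<close>: the members of \<open>F\<close> that are kept instead of the others\<close>
    define K1 where "K1 = {E \<in> K. \<not> (\<exists>C\<in>F. E \<subseteq> C)}"
    define G where "G = {C \<in> F. C \<subseteq> D \<and> (\<exists>E\<in>K. E \<subseteq> C)}"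
    define B where "B E = {C \<in> F. C \<subseteq> E}" for E
    have cntK1: "countable K1" using Kdy by (intro countable_dyadic_family) (auto simp: K1_def)
    have heavy: "cweight t {E} \<le> cweight t (B E)" if "E \<in> K1" for E
      using no that by (auto simp: undercovered_def K1_def B_def)
    have disjB: "disjoint_family_on B K1"
      unfolding disjoint_family_on_def
    proof (intro ballI impI)
      fix E E' assume E: "E \<in> K1" "E' \<in> K1" "E \<noteq> E'"
      then have "E \<inter> E' = {}" using Kdisj by (auto simp: K1_def)
      then show "B E \<inter> B E' = {}"
        using F dyadic_cube_nonempty unfolding B_def by blast
    qed
    have disjG: "G \<inter> (\<Union>E\<in>K1. B E) = {}"
    proof (rule ccontr)
      assume "G \<inter> (\<Union>E\<in>K1. B E) \<noteq> {}"
      then obtain C E E' where E: "E \<in> K1" "C \<subseteq> E" "C \<in> F" "E' \<in> K" "E' \<subseteq> C"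
        by (auto simp: G_def B_def)
      moreover have "E' \<noteq> {}" using E(4) Kdy dyadic_cube_nonempty by blast
      ultimately have "E' = E" by (intro Kdisj) (auto simp: K1_def)
      then show False using E by (auto simp: K1_def)
    qed
    have "W \<inter> interior D \<subseteq> \<Union>(G \<union> K1)"
    proof
      fix p assume p: "p \<in> W \<inter> interior D"
      then obtain E where E: "E \<in> K" "p \<in> E" using Kcov by (auto simp: A_def)
      show "p \<in> \<Union>(G \<union> K1)"
      proof (cases "\<exists>C\<in>F. E \<subseteq> C")
        case True
        then obtain C where C: "C \<in> F" "E \<subseteq> C" by blast
        moreover have "p \<in> D" using p interior_subset[of D] by auto
        ultimately have "C \<subseteq> D"
          using dyadic_cube_nested[of C D] F D E undercovered by (auto simp: undercovered_def)
        then show ?thesis using C E by (auto simp: G_def)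
      next
        case False then show ?thesis using E by (auto simp: K1_def)
      qed
    qed
    then have "ennreal 1 * cweight t {D} \<le> cweight t (G \<union> K1)"
      using Kdy F by (intro content_geD[OF W D]) (auto simp: G_def K1_def)
    also have "\<dots> \<le> cweight t G + cweight t K1" by (rule cweight_Un_le)
    also have "cweight t K1 = (\<integral>\<^sup>+E. cweight t {E} \<partial>count_space K1)"
      by (simp add: cweight_eq_nn_integral[of t K1] cweight_singleton)
    also have "\<dots> \<le> (\<integral>\<^sup>+E. cweight t (B E) \<partial>count_space K1)"
      by (intro nn_integral_mono) (auto simp: heavy)
    also have "\<dots> = cweight t (\<Union>E\<in>K1. B E)"
      using cntK1 disjB by (simp add: cweight_UN)
    also have "cweight t G + \<dots> = cweight t (G \<union> (\<Union>E\<in>K1. B E))"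
      using disjG by (simp add: cweight_Un)
    also have "\<dots> \<le> cweight t {C \<in> F. C \<subseteq> D}"
      using Ksub AD by (intro cweight_mono) (auto simp: G_def B_def K1_def, blast)
    finally have "cweight t {D} \<le> cweight t {C \<in> F. C \<subseteq> D}" by simp
    then show False using undercovered unfolding undercovered_def by (meson leD)
  qed
  then show ?thesis using Kdy Kcl unfolding A_def by blast
qed

text \<open>
  Otherwise \<open>D\<close> is undercovered by \<open>F\<close>, and the previous lemma yields undercovered cubes
  \<open>D = E\<^sub>0, E\<^sub>1, \<dots>\<close> with \<open>closure E\<^sub>n\<^sub>+\<^sub>1 \<subseteq> W\<^sub>n \<inter> interior E\<^sub>n\<close>. By compactness the closures have a common
  point. It lies in all \<open>W\<^sub>n\<close> and, although dyadic cubes are not closed, in all \<open>E\<^sub>n\<close>. A member of \<open>F\<close>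
  containing it would contain \<open>E\<^sub>n\<close> once \<open>n\<close> exceeds its level, contrary to \<open>E\<^sub>n\<close> being undercovered.
\<close>

lemma content_Inter:
  fixes W :: "nat \<Rightarrow> (real ^ 'd) set"
  assumes W: "\<And>n. content_ge 1 t (W n)" and op: "\<And>n D. dyadic_cube D \<Longrightarrow> open (W n \<inter> interior D)"
    and t: "0 \<le> t"
    and D: "dyadic_cube D" and F: "F \<subseteq> Collect dyadic_cube" and cov: "(\<Inter>n. W n) \<inter> D \<subseteq> \<Union>F"
  shows "cweight t {D} \<le> cweight t F"
proof (rule ccontr)
  assume less: "\<not> cweight t {D} \<le> cweight t F"
  have "undercovered t F D"
    unfolding undercovered_def
  proof (intro conjI ballI notI)
    show "False" if "C \<in> F" "D \<subseteq> C" for C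
      using cweight_superset[OF that(2,1) F t] less by simp
    show "cweight t {C \<in> F. C \<subseteq> D} < cweight t {D}"
      using less cweight_mono[of "{C \<in> F. C \<subseteq> D}" F t] by (auto simp: not_le)
  qed
  define P where "P n E \<longleftrightarrow> dyadic_cube E \<and> undercovered t F E \<and> (n = 0 \<longrightarrow> E = D)" for n :: nat and E
  have "\<exists>E. \<forall>n. P n (E n) \<and> closure (E (Suc n)) \<subseteq> W n \<inter> interior (E n)"
  proof (rule dependent_nat_choice)
    show "\<exists>E. P 0 E" using D \<open>undercovered t F D\<close> by (auto simp: P_def)
    show "\<exists>E'. P (Suc n) E' \<and> closure E' \<subseteq> W n \<inter> interior E" if "P n E" for E n
      using undercovered_subcube[OF W op _ F, of E n] that by (auto simp: P_def)
  qed
  then obtain E where P: "\<And>n. P n (E n)" and cl: "\<And>n. closure (E (Suc n)) \<subseteq> W n \<inter> interior (E n)"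
    by blast
  have E0: "E 0 = D" using P[of 0] by (simp add: P_def)
  have dy: "dyadic_cube (E n)" and lt: "undercovered t F (E n)" for n using P[of n] by (auto simp: P_def)
  have "\<forall>n. \<exists>k z. E n = dcube k z" using dy unfolding dyadic_cube_iff by blast
  then obtain k z where kz: "\<And>n. E n = dcube (k n) (z n)" by metis
  have sub: "E (Suc n) \<subseteq> E n" for n
    using cl[of n] closure_subset[of "E (Suc n)"] interior_subset[of "E n"] by blast
  have "E (Suc n) \<noteq> E n" for n
  proof
    assume eq: "E (Suc n) = E n"
    have "open (E n)" "closed (E n)"
    proof -
      have "closure (E n) \<subseteq> interior (E n)" using cl[of n] by (simp add: eq)
      then have "interior (E n) = E n" "closure (E n) = E n"
        using closure_subset[of "E n"] interior_subset[of "E n"] by blast+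
      then show "open (E n)" "closed (E n)" by (simp_all flip: interior_eq closure_eq)
    qed
    then have "E n = UNIV" using clopen dyadic_cube_nonempty[OF dy] by blast
    then show False using dyadic_cube_bounded[OF dy[of n]] not_bounded_UNIV by simp
  qed
  then have "k n < k (Suc n)" for n
    using sub[of n] unfolding kz by (intro dcube_level_mono) auto
  then have kn: "n \<le> k n" for n
    by (induction n) (auto intro: Suc_leI le_less_trans)
  have "\<Inter>(range (\<lambda>n. closure (E n))) \<noteq> {}"
  proof (rule compact_nest)
    show "compact (closure (E n))" for n
      using dyadic_cube_bounded[OF dy] by (simp add: compact_closure)
    show "closure (E n) \<noteq> {}" for n using dyadic_cube_nonempty[OF dy] by simp
    show "closure (E n) \<subseteq> closure (E m)" if "m \<le> n" for m n
      using sub that by (intro closure_mono) (metis lift_Suc_antimono_le)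
  qed
  then obtain x where x: "\<And>n. x \<in> closure (E n)" by blast
  then have xW: "x \<in> W n" and xE: "x \<in> E n" for n
    using cl[of n] interior_subset[of "E n"] by blast+
  then have "x \<in> \<Union>F" using cov E0 by blast
  then obtain C where C: "C \<in> F" "x \<in> C" by blast
  then have "dyadic_cube C" using F by blast
  then obtain l y where y: "C = dcube l y" unfolding dyadic_cube_iff by blast
  have "E l \<subseteq> C"
    unfolding kz y using kn[of l] C xE[of l] by (intro dcube_nested) (auto simp: kz y)
  then show False using lt[of l] C by (auto simp: undercovered_def)
qed

text \<open>
  Cubes inside \<open>D\<close> have diameter at most \<open>|D|\<close>, so passing from \<open>t'\<close> down to \<open>t\<close> multiplies their cost by at
  least the factor by which it multiplies the cost of \<open>D\<close>. This reduces uncountably many exponents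
  to rational ones.
\<close>

lemma content_exponent_antimono:
  fixes A :: "(real ^ 'd) set"
  assumes A: "\<And>F. F \<subseteq> Collect dyadic_cube \<Longrightarrow> A \<inter> D \<subseteq> \<Union>F \<Longrightarrow> cweight t' {D} \<le> cweight t' F"
    and t: "0 \<le> t" "t \<le> t'"
    and D: "dyadic_cube D" and F: "F \<subseteq> Collect dyadic_cube" and cov: "A \<inter> D \<subseteq> \<Union>F"
  shows "cweight t {D} \<le> cweight t F"
proof (cases "\<exists>C\<in>F. D \<subseteq> C")
  case True
  then show ?thesis using cweight_superset[OF _ _ F t(1)] by auto
next
  case False
  define G where "G = {C \<in> F. C \<subseteq> D}"
  have "A \<inter> D \<subseteq> \<Union>G"
  proof
    fix p assume "p \<in> A \<inter> D"
    then obtain C where "C \<in> F" "p \<in> C" "p \<in> D" using cov by auto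
    then show "p \<in> \<Union>G" using dyadic_cube_nested[of C D] F D False by (auto simp: G_def)
  qed
  then have le: "cweight t' {D} \<le> cweight t' G" using F by (intro A) (auto simp: G_def)
  have pos: "0 < diameter C" if "dyadic_cube C" for C :: "(real ^ 'd) set"
    using that by (auto simp: dyadic_cube_iff diameter_dcube)
  let ?c = "ennreal (diameter D powr (t - t'))"
  have "cweight t {D} = ?c * cweight t' {D}"
    using pos[OF D] by (simp add: cweight_singleton flip: ennreal_mult powr_add)
  also have "\<dots> \<le> ?c * cweight t' G" by (intro mult_left_mono le) simp
  also have "\<dots> = (\<integral>\<^sup>+C. ?c * ennreal (diameter C powr t') \<partial>count_space G)"
    unfolding cweight_eq_nn_integral by (simp add: nn_integral_cmult)
  also have "\<dots> \<le> (\<integral>\<^sup>+C. ennreal (diameter C powr t) \<partial>count_space G)"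
  proof (rule nn_integral_mono)
    fix C assume "C \<in> space (count_space G)"
    then have C: "dyadic_cube C" "C \<subseteq> D" using F by (auto simp: G_def)
    have "diameter D powr (t - t') \<le> diameter C powr (t - t')"
      using t pos[OF C(1)] diameter_subset[OF C(2) dyadic_cube_bounded[OF D]] by (intro powr_mono2') auto
    then have "diameter D powr (t - t') * diameter C powr t' \<le> diameter C powr (t - t') * diameter C powr t'"
      by (intro mult_right_mono) auto
    also have "\<dots> = diameter C powr t" by (simp flip: powr_add)
    finally show "?c * ennreal (diameter C powr t') \<le> ennreal (diameter C powr t)"
      by (simp flip: ennreal_mult)
  qed
  also have "\<dots> = cweight t G" by (simp add: cweight_eq_nn_integral)
  also have "\<dots> \<le> cweight t F" by (intro cweight_mono) (auto simp: G_def)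
  finally show ?thesis .
qed

text \<open>
  Since \<open>D\<close> covers itself, the cost of \<open>D\<close> lies between the two contents.
\<close>

lemma net_content_eqI:
  fixes A :: "(real ^ 'd) set"
  assumes A: "\<And>F. F \<subseteq> Collect dyadic_cube \<Longrightarrow> A \<inter> D \<subseteq> \<Union>F \<Longrightarrow> cweight t {D} \<le> cweight t F"
    and D: "dyadic_cube D"
  shows "net_content t (A \<inter> D) = net_content t D"
proof (rule antisym)
  show "net_content t (A \<inter> D) \<le> net_content t D"
    unfolding net_content_def by (intro INF_superset_mono) auto
  have "net_content t D \<le> cweight t {D}"
    unfolding net_content_def using D by (intro INF_lower2[of "{D}"]) (auto simp: cweight_singleton)
  also have "\<dots> \<le> net_content t (A \<inter> D)"
    unfolding net_content_def
    by (intro INF_greatest) (auto simp: infsum_eq_cweight intro!: A)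
  finally show "net_content t D \<le> net_content t (A \<inter> D)" .
qed

section \<open>Singular value decomposition\<close>

text \<open>
  A maximiser \<open>v\<close> of the quadratic form \<open>x \<bullet> f x\<close> on the unit sphere of \<open>S\<close> is an eigenvector: with
  \<open>l\<close> the maximum, \<open>l * (x \<bullet> x) - x \<bullet> f x\<close> is nonnegative on \<open>S\<close> and vanishes at \<open>v\<close>, hence its
  derivative at \<open>v\<close> in the direction \<open>l *\<^sub>R v - f v\<close> is zero.
\<close>

lemma symmetric_operator_eigenvector:
  fixes f :: "'a :: euclidean_space \<Rightarrow> 'a"
  assumes f: "linear f" and sym: "\<And>x y. f x \<bullet> y = x \<bullet> f y"
    and S: "subspace S" and inv: "\<And>x. x \<in> S \<Longrightarrow> f x \<in> S" and ne: "x0 \<in> S" "x0 \<noteq> 0"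
  shows "\<exists>v\<in>S. norm v = 1 \<and> (\<exists>l. f v = l *\<^sub>R v)"
proof -
  interpret linear f by (rule f)
  define K where "K = S \<inter> sphere 0 1"
  have "compact K" unfolding K_def using S by (simp add: closed_Int_compact closed_subspace)
  moreover have "x0 /\<^sub>R norm x0 \<in> K" using S ne by (simp add: K_def subspace_scale)
  moreover have "continuous_on K (\<lambda>x. x \<bullet> f x)"
    by (intro continuous_intros linear_continuous_on) (simp add: f linear_conv_bounded_linear[symmetric])
  ultimately obtain v where v: "v \<in> K" and max: "\<And>x. x \<in> K \<Longrightarrow> x \<bullet> f x \<le> v \<bullet> f v"
    using continuous_attains_sup[of K "\<lambda>x. x \<bullet> f x"] by blast
  define l where "l = v \<bullet> f v"
  have vS: "v \<in> S" and v1: "v \<bullet> v = 1" using v by (auto simp: K_def norm_eq_1)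
  have nonneg: "0 \<le> l * (w \<bullet> w) - w \<bullet> f w" if w: "w \<in> S" for w
  proof (cases "w = 0")
    case True then show ?thesis by simp
  next
    case False
    then have "w /\<^sub>R norm w \<in> K" using S w by (simp add: K_def subspace_scale)
    from max[OF this] have "(w \<bullet> f w) / (norm w)^2 \<le> l"
      by (simp add: scaleR l_def power2_eq_square divide_inverse mult_ac)
    then show ?thesis using False by (simp add: divide_le_eq power2_norm_eq_inner mult_ac)
  qed
  \<comment> \<open>expand the nonnegative form along the line through \<open>v\<close> in this direction\<close>
  define w where "w = l *\<^sub>R v - f v"
  have wS: "w \<in> S" unfolding w_def using S vS inv by (simp add: subspace_diff subspace_scale)
  define b where "b = w \<bullet> w"
  define c where "c = l * (w \<bullet> w) - w \<bullet> f w"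
  have c: "0 \<le> c" unfolding c_def by (rule nonneg[OF wS])
  have quad: "0 \<le> 2 * e * b + e\<^sup>2 * c" for e
  proof -
    have "v + e *\<^sub>R w \<in> S" using S vS wS by (simp add: subspace_add subspace_scale)
    then have "0 \<le> l * ((v + e *\<^sub>R w) \<bullet> (v + e *\<^sub>R w)) - (v + e *\<^sub>R w) \<bullet> f (v + e *\<^sub>R w)"
      by (rule nonneg)
    also have "\<dots> = 2 * e * (l * (v \<bullet> w) - f v \<bullet> w) + e\<^sup>2 * c"
      using sym[of v w] by (simp add: add scaleR inner_add_left inner_add_right c_def v1 l_def[symmetric]
          inner_commute power2_eq_square algebra_simps)
    also have "l * (v \<bullet> w) - f v \<bullet> w = b" by (simp add: b_def w_def inner_diff_left)
    finally show ?thesis .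
  qed
  \<comment> \<open>a step at which the linear term would outweigh the quadratic one\<close>
  have "0 \<le> 2 * (- b / (c + 1)) * b + (- b / (c + 1))\<^sup>2 * c" by (rule quad)
  also have "\<dots> = - b\<^sup>2 * ((c + 2) / (c + 1)\<^sup>2)"
  proof -
    define r where "r = c + 1"
    have "r \<noteq> 0" using c by (simp add: r_def)
    moreover have "c = r - 1" by (simp add: r_def)
    ultimately show ?thesis by (simp add: divide_simps power2_eq_square) (simp add: algebra_simps)
  qed
  finally have "b\<^sup>2 * ((c + 2) / (c + 1)\<^sup>2) \<le> 0" by simp
  moreover have "0 < (c + 2) / (c + 1)\<^sup>2" using c by simp
  ultimately have "b = 0" by (simp add: mult_le_0_iff del: times_divide_eq_right)
  then have "f v = l *\<^sub>R v" by (simp add: b_def w_def)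
  then show ?thesis using v vS by (auto simp: K_def)
qed

text \<open>
  The orthogonal complement of an eigenvector is invariant, which allows induction on the dimension.
\<close>

lemma symmetric_operator_orthonormal_eigenbasis:
  fixes f :: "'a :: euclidean_space \<Rightarrow> 'a"
  assumes f: "linear f" and sym: "\<And>x y. f x \<bullet> y = x \<bullet> f y"
    and "subspace S" and "\<And>x. x \<in> S \<Longrightarrow> f x \<in> S"
  shows "\<exists>B\<subseteq>S. S \<subseteq> span B \<and> pairwise orthogonal B \<and> (\<forall>b\<in>B. norm b = 1 \<and> (\<exists>l. f b = l *\<^sub>R b))"
  using assms(3,4)
proof (induction "dim S" arbitrary: S rule: less_induct)
  case less
  show ?case
  proof (cases "\<exists>x\<in>S. x \<noteq> 0")
    case False
    then show ?thesis by (intro exI[of _ "{}"]) auto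
  next
    case True
    then obtain v l where v: "v \<in> S" "norm v = 1" "f v = l *\<^sub>R v"
      using symmetric_operator_eigenvector[OF f sym less.prems] by blast
    define T where "T = {x \<in> S. x \<bullet> v = 0}"
    have T: "subspace T" using less.prems(1)
      unfolding T_def subspace_def by (auto simp: inner_add_left)
    have invT: "f x \<in> T" if "x \<in> T" for x
      using that less.prems(2) by (auto simp: T_def sym v(3))
    have "v \<notin> T" using v(2) by (auto simp: T_def norm_eq_1)
    then have "T \<subset> S" using v(1) unfolding T_def by blast
    then have "dim T < dim S"
      using T less.prems(1) by (intro dim_psubset) (simp add: span_eq_iff[THEN iffD2])
    from less.hyps[OF this T invT] obtain B where B: "B \<subseteq> T" "T \<subseteq> span B" "pairwise orthogonal B"
      "\<And>b. b \<in> B \<Longrightarrow> norm b = 1 \<and> (\<exists>l. f b = l *\<^sub>R b)" by blast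
    have "S \<subseteq> span (insert v B)"
    proof
      fix x assume x: "x \<in> S"
      have "x - (x \<bullet> v) *\<^sub>R v \<in> T"
        using x v less.prems(1) by (simp add: T_def subspace_diff subspace_scale inner_diff_left norm_eq_1)
      then show "x \<in> span (insert v B)" using B(2) by (auto simp: span_insert)
    qed
    moreover have "pairwise orthogonal (insert v B)"
      using B(1,3) by (auto simp: pairwise_insert orthogonal_def T_def inner_commute)
    ultimately show ?thesis
      using B v \<open>T \<subset> S\<close> by (intro exI[of _ "insert v B"]) auto
  qed
qed

lemma symmetric_matrix_orthonormal_eigenbasis:
  fixes A :: "real ^ 'd ^ 'd"
  assumes "transpose A = A"
  shows "\<exists>(e :: 'd \<Rightarrow> real ^ 'd) l. (\<forall>i j. e i \<bullet> e j = (if i = j then 1 else 0)) \<and> (\<forall>i. A *v e i = l i *\<^sub>R e i)"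
proof -
  have "(A *v x) \<bullet> y = x \<bullet> (A *v y)" for x y
    using dot_lmul_matrix[of x A y] assms by (metis inner_commute matrix_transpose_mul transpose_matrix_vector transpose_transpose)
  then obtain B where B: "UNIV \<subseteq> span B" "pairwise orthogonal B"
    and eig: "\<And>b. b \<in> B \<Longrightarrow> norm b = 1 \<and> (\<exists>l. A *v b = l *\<^sub>R b)"
    using symmetric_operator_orthonormal_eigenbasis[of "\<lambda>x. A *v x" UNIV] by auto
  have "0 \<notin> B" using eig by force
  then have ind: "independent B" using B(2) pairwise_orthogonal_independent by blast
  then have "card B = CARD('d)"
    using B(1) basis_card_eq_dim[of B UNIV] by simp
  moreover have "finite B" using ind by (rule independent_imp_finite)
  ultimately obtain e where e: "bij_betw e (UNIV :: 'd set) B"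
    by (metis finite_class.finite_UNIV bij_betw_iff_card)
  then have eB: "e i \<in> B" for i by (auto simp: bij_betw_def)
  have "e i \<bullet> e j = (if i = j then 1 else 0)" for i j
  proof (cases "i = j")
    case True then show ?thesis using eig[OF eB[of i]] by (simp add: norm_eq_1)
  next
    case False
    then have "e i \<noteq> e j" using e by (metis bij_betw_inv_into_left UNIV_I)
    then show ?thesis using B(2) eB False by (auto simp: pairwise_def orthogonal_def)
  qed
  moreover have "\<forall>i. \<exists>l. A *v e i = l *\<^sub>R e i" using eig eB by blast
  then obtain l where "\<And>i. A *v e i = l i *\<^sub>R e i" by metis
  ultimately show ?thesis by blast
qed

lemma const_poly_sum: "[:sum f S:] = (\<Sum>x\<in>S. [:f x:])"
proof (induction S rule: infinite_finite_induct)
  case (insert x F)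
  then show ?case by (simp flip: insert.IH)
qed auto

lemma orthonormal_matrix:
  fixes e :: "'d \<Rightarrow> real ^ 'd"
  assumes "\<And>i j. e i \<bullet> e j = (if i = j then 1 else 0)"
  shows "orthogonal_matrix (\<chi> i j. e j $ i)"
proof -
  have "transpose (\<chi> i j. e j $ i) ** (\<chi> i j. e j $ i) = mat 1"
    using assms by (simp add: vec_eq_iff matrix_matrix_mult_def transpose_def mat_def inner_vec_def)
  then show ?thesis by (simp add: orthogonal_matrix)
qed

text \<open>
  If \<open>P\<close> has the eigenvectors as columns, then \<open>X - A\<close> and \<open>X - diag l\<close> are intertwined by the constant
  matrix \<open>P\<close>, whose determinant is a unit; take determinants over the polynomial ring.
\<close>

lemma charpoly_eigenbasis:
  fixes A :: "real ^ 'd ^ 'd" and e :: "'d \<Rightarrow> real ^ 'd"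
  assumes e: "\<And>i j. e i \<bullet> e j = (if i = j then 1 else 0)" and A: "\<And>i. A *v e i = l i *\<^sub>R e i"
  shows "charpoly A = (\<Prod>i\<in>UNIV. [:- l i, 1:])"
proof -
  define P :: "real ^ 'd ^ 'd" where "P = (\<chi> i j. e j $ i)"
  define cp :: "real ^ 'd ^ 'd \<Rightarrow> real poly ^ 'd ^ 'd" where "cp M = (\<chi> i j. [:M $ i $ j:])" for M
  define X :: "real poly ^ 'd ^ 'd" where "X = (\<chi> i j. (if i = j then [:0, 1:] else 0) - [:A $ i $ j:])"
  define D :: "real poly ^ 'd ^ 'd" where "D = (\<chi> i j. if i = j then [:- l i, 1:] else 0)"
  have "X ** cp P = cp P ** D"
  proof -
    have "(X ** cp P) $ i $ j = (cp P ** D) $ i $ j" for i j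
    proof -
      have "(X ** cp P) $ i $ j = (\<Sum>k\<in>UNIV. (if i = k then [:0, 1:] * [:e j $ k:] else 0)) - (\<Sum>k\<in>UNIV. [:A $ i $ k * e j $ k:])"
        unfolding matrix_matrix_mult_def sum_subtractf[symmetric]
        by (auto simp: X_def cp_def P_def left_diff_distrib intro!: sum.cong)
      also have "\<dots> = [:0, 1:] * [:e j $ i:] - [:(A *v e j) $ i:]"
        by (simp add: matrix_vector_mult_def flip: const_poly_sum)
      also have "\<dots> = [:e j $ i:] * [:- l j, 1:]"
        by (simp add: A)
      also have "\<dots> = (\<Sum>k\<in>UNIV. if k = j then [:e k $ i:] * [:- l k, 1:] else 0)"
        by simp
      also have "\<dots> = (cp P ** D) $ i $ j"
        unfolding matrix_matrix_mult_def D_def cp_def P_def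
        by (simp add: if_distrib[of "\<lambda>x. _ * x"] cong: if_cong)
      finally show ?thesis .
    qed
    then show ?thesis by (simp add: vec_eq_iff)
  qed
  then have "det X * det (cp P) = det (cp P) * det D" by (metis det_mul)
  moreover have "det (cp P) \<noteq> 0"
  proof -
    have "cp (transpose P) ** cp P = cp (transpose P ** P)"
      by (simp add: cp_def vec_eq_iff matrix_matrix_mult_def const_poly_sum mult.commute)
    also have "\<dots> = mat 1"
      using orthonormal_matrix[OF e] unfolding orthogonal_matrix P_def[symmetric]
      by (simp add: cp_def vec_eq_iff mat_def one_pCons)
    finally show ?thesis by (metis det_I det_mul mult_zero_right zero_neq_one)
  qed
  moreover have "det D = (\<Prod>i\<in>UNIV. [:- l i, 1:])"
    by (subst det_diagonal) (auto simp: D_def)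
  ultimately show ?thesis by (simp add: charpoly_def X_def)
qed

lemma orthonormal_expansion:
  fixes e :: "'d \<Rightarrow> real ^ 'd"
  assumes e: "\<And>i j. e i \<bullet> e j = (if i = j then 1 else 0)"
  shows "x = (\<Sum>i\<in>UNIV. (e i \<bullet> x) *\<^sub>R e i)"
proof -
  define P :: "real ^ 'd ^ 'd" where "P = (\<chi> i j. e j $ i)"
  have "x = P *v (transpose P *v x)"
    using orthonormal_matrix[OF e] by (simp add: P_def[symmetric] orthogonal_matrix_def matrix_vector_mul_assoc del: transpose_matrix_vector)
  also have "\<dots> = (\<Sum>i\<in>UNIV. (e i \<bullet> x) *\<^sub>R e i)"
    by (simp add: vec_eq_iff P_def matrix_vector_mult_def transpose_def inner_vec_def mult.commute del: transpose_matrix_vector)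
  finally show ?thesis .
qed

text \<open>
  The orthonormal eigenvectors \<open>e i\<close> of \<open>transpose A ** A\<close> are the right singular vectors of \<open>A\<close>. The
  bijection \<open>p\<close> matches them with the positions in the sorted list \<open>singular_values A\<close>, so that products
  over the list become products over the directions.
\<close>

lemma singular_value_decomposition:
  fixes A :: "real ^ 'd ^ 'd"
  obtains e :: "'d \<Rightarrow> real ^ 'd" and \<sigma> :: "'d \<Rightarrow> real" and p :: "nat \<Rightarrow> 'd"
  where "\<And>i j. e i \<bullet> e j = (if i = j then 1 else 0)" "\<And>i. 0 \<le> \<sigma> i"
    "\<And>x. (norm (A *v x))\<^sup>2 = (\<Sum>i\<in>UNIV. (\<sigma> i * (e i \<bullet> x))\<^sup>2)"
    "bij_betw p {1..CARD('d)} UNIV"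
    "\<And>k. k \<in> {1..CARD('d)} \<Longrightarrow> singular_values A ! (k - 1) = \<sigma> (p k)"
proof -
  define M where "M = transpose A ** A"
  have "transpose M = M" by (simp add: M_def matrix_transpose_mul)
  then obtain e :: "'d \<Rightarrow> real ^ 'd" and l where e: "\<And>i j. e i \<bullet> e j = (if i = j then 1 else 0)"
    and l: "\<And>i. M *v e i = l i *\<^sub>R e i"
    using symmetric_matrix_orthonormal_eigenbasis by blast
  have Mdot: "(M *v x) \<bullet> y = (A *v x) \<bullet> (A *v y)" for x y
    unfolding M_def by (simp add: dot_lmul_matrix flip: matrix_vector_mul_assoc)
  have "l i = (A *v e i) \<bullet> (A *v e i)" for i
    using Mdot[of "e i" "e i"] by (simp add: l e)
  then have l0: "0 \<le> l i" for i by simp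
  define \<sigma> where "\<sigma> i = sqrt (l i)" for i
  have norm: "(norm (A *v x))\<^sup>2 = (\<Sum>i\<in>UNIV. (\<sigma> i * (e i \<bullet> x))\<^sup>2)" for x
  proof -
    have "(norm (A *v x))\<^sup>2 = (M *v x) \<bullet> x" by (simp add: Mdot power2_norm_eq_inner)
    also have "M *v x = (\<Sum>i\<in>UNIV. (e i \<bullet> x) *\<^sub>R (M *v e i))"
      by (subst orthonormal_expansion[OF e, of x])
         (simp add: linear_sum[OF matrix_vector_mul_linear] linear_cmul[OF matrix_vector_mul_linear] o_def)
    also have "\<dots> \<bullet> x = (\<Sum>i\<in>UNIV. (\<sigma> i * (e i \<bullet> x))\<^sup>2)"
      by (simp add: l inner_sum_left \<sigma>_def power_mult_distrib l0) (simp add: power2_eq_square mult_ac)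
    finally show ?thesis .
  qed
  obtain xs0 :: "'d list" where "set xs0 = UNIV" "distinct xs0"
    using finite_distinct_list[of "UNIV :: 'd set"] by auto
  define xs where "xs = rev (sort_key \<sigma> xs0)"
  have xs: "set xs = UNIV" "distinct xs" using \<open>set xs0 = UNIV\<close> \<open>distinct xs0\<close> by (auto simp: xs_def)
  have ms: "mset_set UNIV = mset xs" using xs mset_set_set by metis
  have len: "length xs = CARD('d)" using xs distinct_card by metis
  have "proots (charpoly M) = (\<Sum>i\<in>UNIV. {#l i#})"
    by (simp add: charpoly_eigenbasis[OF e l] proots_prod)
  also have "\<dots> = image_mset l (mset_set UNIV)"
    by (simp add: sum_unfold_sum_mset)
  finally have "image_mset sqrt (proots (charpoly M)) = mset (map \<sigma> xs)"
    unfolding ms by (simp add: multiset.map_comp o_def) (intro image_mset_cong, simp add: \<sigma>_def)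
  then have "singular_values A = rev (sort (map \<sigma> xs))"
    by (simp only: singular_values_def M_def[symmetric] sorted_list_of_multiset_mset)
  also have "sort (map \<sigma> xs) = sort (map \<sigma> (rev xs))"
    by (rule properties_for_sort) (auto simp: xs_def)
  also have "\<dots> = map \<sigma> (rev xs)" by (intro sort_key_id_if_sorted) (simp add: xs_def)
  finally have sv: "singular_values A = map \<sigma> xs" by (simp add: rev_map)
  define p where "p k = xs ! (k - 1)" for k :: nat
  have "bij_betw p {1..CARD('d)} UNIV"
  proof -
    have "bij_betw (\<lambda>k :: nat. k - 1) {1..CARD('d)} {..<CARD('d)}"
      by (rule bij_betwI[of _ _ _ Suc]) auto
    moreover have "bij_betw (\<lambda>i. xs ! i) {..<CARD('d)} UNIV"
      using bij_betw_nth[OF xs(2), of "{..<CARD('d)}" UNIV] len xs by simp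
    ultimately show ?thesis unfolding p_def using bij_betw_trans by (fastforce simp: o_def)
  qed
  moreover have "singular_values A ! (k - 1) = \<sigma> (p k)" if "k \<in> {1..CARD('d)}" for k
    using that len by (auto simp: sv p_def)
  moreover have "0 \<le> \<sigma> i" for i by (simp add: \<sigma>_def l0)
  ultimately show ?thesis using that[of e \<sigma> p] e norm by blast
qed

section \<open>Mass that an affine image of a cube leaves in a dyadic cube\<close>

lemma torus_proj_measurable [measurable]: "torus_proj \<in> borel_measurable borel"
proof (subst borel_measurable_euclidean_space, intro ballI)
  fix b :: "real ^ 'd" assume "b \<in> Basis"
  then obtain j where b: "b = axis j 1" by (auto simp: Basis_vec_def)
  have "(\<lambda>x :: real ^ 'd. x $ j - of_int \<lfloor>x $ j\<rfloor>) \<in> borel_measurable borel" by measurable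
  then show "(\<lambda>x. torus_proj x \<bullet> b) \<in> borel_measurable borel"
    by (simp add: b inner_axis torus_proj_def frac_def)
qed

text \<open>
  The image of \<open>\<kappa>\<close> under \<open>T\<close>, translated by \<open>u\<close> and wrapped onto the torus, evaluated at \<open>C\<close>.
\<close>

definition shifted_mass :: "(real ^ 'd) measure \<Rightarrow> (real ^ 'd \<Rightarrow> real ^ 'd) \<Rightarrow> (real ^ 'd) set \<Rightarrow> real ^ 'd \<Rightarrow> real" where
  "shifted_mass \<kappa> T C u = measure \<kappa> {y \<in> space \<kappa>. torus_proj (T y + u) \<in> C}"

text \<open>
  Precompose \<open>L\<close> with the rotation that sends the coordinate axes to the right singular vectors.
  Then \<open>T\<close> stretches the j-th coordinate direction by \<open>\<sigma> j\<close> and maps the coordinate axes to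
  orthogonal directions, so volumes can be computed from coordinate boxes; the ball is chosen
  because it is invariant under the rotation.
\<close>

lemma adapted_parametrization:
  fixes L :: "real ^ 'd \<Rightarrow> real ^ 'd"
  assumes "affine_transformation L"
  obtains T :: "real ^ 'd \<Rightarrow> real ^ 'd" and \<sigma> :: "'d \<Rightarrow> real" and p :: "nat \<Rightarrow> 'd"
  where "\<And>x y. (norm (T x - T y))\<^sup>2 = (\<Sum>j\<in>UNIV. (\<sigma> j * (x $ j - y $ j))\<^sup>2)"
    "\<And>y r. norm y < r \<Longrightarrow> T y \<in> L ` ball z r"
    "bij_betw p {1..CARD('d)} UNIV" "\<And>k. k \<in> {1..CARD('d)} \<Longrightarrow> singular_value k L = \<sigma> (p k)"
proof -
  define A where "A = linear_part L"
  have lin: "linear (\<lambda>x. L x - L 0)" using assms by (simp add: affine_transformation_def)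
  have A: "L x = A *v x + L 0" for x
    using matrix_works[OF lin[folded linear_matrix_vector_mul_eq], of x] by (simp add: A_def linear_part_def)
  obtain e :: "'d \<Rightarrow> real ^ 'd" and \<sigma> p where e: "\<And>i j. e i \<bullet> e j = (if i = j then 1 else 0)"
    and "\<And>i. 0 \<le> \<sigma> i"
    and norm: "\<And>x. (norm (A *v x))\<^sup>2 = (\<Sum>i\<in>UNIV. (\<sigma> i * (e i \<bullet> x))\<^sup>2)"
    and p: "bij_betw p {1..CARD('d)} UNIV"
    and sv: "\<And>k. k \<in> {1..CARD('d)} \<Longrightarrow> singular_values A ! (k - 1) = \<sigma> (p k)"
    by (rule singular_value_decomposition[of A]) (rule that)
  define R where "R y = (\<Sum>i\<in>UNIV. y $ i *\<^sub>R e i)" for y :: "real ^ 'd"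
  have Re: "e i \<bullet> R y = y $ i" for i y
    by (simp add: R_def inner_sum_right e if_distrib[of "\<lambda>x. _ * x"] cong: if_cong)
  have Rn: "norm (R y) = norm y" for y
  proof -
    have "R y \<bullet> R y = (\<Sum>i\<in>UNIV. y $ i * (e i \<bullet> R y))"
      by (subst (1) R_def) (simp add: inner_sum_left)
    also have "\<dots> = y \<bullet> y" unfolding Re by (simp add: inner_vec_def)
    finally show ?thesis by (simp add: norm_eq_sqrt_inner)
  qed
  define T where "T y = L (z + R y)" for y
  show ?thesis
  proof (rule that[of T \<sigma> p])
    fix x y :: "real ^ 'd"
    have "T x - T y = A *v (R x - R y)"
      by (simp add: T_def A[of "z + _"] matrix_vector_right_distrib matrix_vector_mult_diff_distrib)
    then show "(norm (T x - T y))\<^sup>2 = (\<Sum>j\<in>UNIV. (\<sigma> j * (x $ j - y $ j))\<^sup>2)"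
      by (simp add: norm inner_diff_right Re)
  next
    fix y :: "real ^ 'd" and r :: real
    assume "norm y < r"
    then have "z + R y \<in> ball z r" by (simp add: dist_norm Rn)
    then show "T y \<in> L ` ball z r" by (simp add: T_def)
  next
    fix k assume "k \<in> {1..CARD('d)}"
    then show "singular_value k L = \<sigma> (p k)" 
      unfolding singular_value_def A_def[symmetric] by (rule sv)
  qed (rule p)
qed

text \<open>
  Two points whose projections share a small cube differ by an integer vector up to the size of the
  cube; if they are closer than \<open>1 / 2\<close>, the integer vector is zero.
\<close>

lemma same_cube_lift_close:
  fixes p q :: "real ^ 'd"
  assumes p: "torus_proj p \<in> dcube n c" and q: "torus_proj q \<in> dcube n c"
    and n: "2 \<le> n" and close: "norm (p - q) < 1 / 2"
  shows "norm (p - q) \<le> sqrt CARD('d) / 2 ^ n"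
proof -
  have comp: "\<bar>p $ j - q $ j\<bar> \<le> 1 / 2 ^ n" for j
  proof -
    define f where "f = frac (p $ j) - frac (q $ j)"
    have "\<lfloor>2 ^ n * frac (p $ j)\<rfloor> = \<lfloor>2 ^ n * frac (q $ j)\<rfloor>"
      using p q by (simp add: dcube_def torus_proj_def)
    then have "\<bar>2 ^ n * frac (p $ j) - 2 ^ n * frac (q $ j)\<bar> < 1" by linarith
    then have "\<bar>2 ^ n * f\<bar> < 1" by (simp add: f_def right_diff_distrib)
    then have f: "\<bar>f\<bar> < 1 / 2 ^ n" by (simp add: abs_mult field_simps)
    have "(1 / 2 :: real) ^ n \<le> (1 / 2) ^ 2" using n by (intro power_decreasing) auto
    then have "1 / 2 ^ n \<le> (1 / 4 :: real)" by (simp add: power_divide)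
    then have f4: "\<bar>f\<bar> < 1 / 4" using f by linarith
    have "\<bar>p $ j - q $ j\<bar> < 1 / 2"
      using component_le_norm_cart[of "p - q" j] close by simp
    moreover have pq: "p $ j - q $ j = f + real_of_int (\<lfloor>p $ j\<rfloor> - \<lfloor>q $ j\<rfloor>)"
      by (simp add: f_def frac_def)
    ultimately have "\<bar>real_of_int (\<lfloor>p $ j\<rfloor> - \<lfloor>q $ j\<rfloor>)\<bar> < 1" using f4 by linarith
    then have "\<lfloor>p $ j\<rfloor> - \<lfloor>q $ j\<rfloor> = 0" by linarith
    then show ?thesis using pq f by simp
  qed
  have "(norm (p - q))\<^sup>2 = (\<Sum>j\<in>UNIV. (p $ j - q $ j)\<^sup>2)"
    by (simp add: norm_vec_def L2_set_def sum_nonneg)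
  also have "\<dots> \<le> (\<Sum>j\<in>(UNIV :: 'd set). (1 / 2 ^ n)\<^sup>2)"
    using comp by (intro sum_mono) (metis power2_abs power_mono abs_ge_zero)
  also have "\<dots> = (sqrt CARD('d) / 2 ^ n)\<^sup>2"
    by (simp add: power_divide)
  finally show ?thesis by (rule power2_le_imp_le) simp
qed

lemma emeasure_cbox_cart:
  fixes a h :: "real ^ 'd"
  assumes "\<And>j. 0 \<le> h $ j"
  shows "emeasure lborel (cbox (a - h) (a + h)) = ennreal (\<Prod>j\<in>UNIV. 2 * h $ j)"
proof -
  have "a \<in> cbox (a - h) (a + h)" using assms by (simp add: mem_box_cart)
  then have "measure lborel (cbox (a - h) (a + h)) = (\<Prod>j\<in>UNIV. 2 * h $ j)"
    by (subst content_cbox_cart) auto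
  then show ?thesis
    using emeasure_lborel_cbox_finite[of "a - h" "a + h"]
    by (simp add: emeasure_eq_ennreal_measure less_top[symmetric])
qed

definition sym_cube :: "real \<Rightarrow> (real ^ 'd) set" where
  "sym_cube r = cbox (0 - (\<chi> j. r)) (0 + (\<chi> j. r))"

lemma emeasure_sym_cube:
  "0 \<le> r \<Longrightarrow> emeasure lborel (sym_cube r :: (real ^ 'd) set) = ennreal ((2 * r) ^ CARD('d))"
  unfolding sym_cube_def by (subst emeasure_cbox_cart) auto

lemma norm_sym_cube_le:
  fixes y :: "real ^ 'd"
  assumes "y \<in> sym_cube r" "0 \<le> r"
  shows "norm y \<le> sqrt CARD('d) * r"
proof -
  have "\<bar>y $ j\<bar> \<le> r" for j using assms by (auto simp: sym_cube_def mem_box_cart abs_le_iff) (smt (verit))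
  then have "(norm y)\<^sup>2 \<le> (\<Sum>j\<in>(UNIV :: 'd set). r\<^sup>2)"
    unfolding norm_vec_def L2_set_def
    by (simp add: sum_nonneg del: sum_constant) (intro sum_mono, metis power2_abs power_mono abs_ge_zero)
  also have "\<dots> = (sqrt CARD('d) * r)\<^sup>2" by (simp add: power_mult_distrib)
  finally show ?thesis by (rule power2_le_imp_le) (use assms(2) in simp)
qed

lemma contraction_dist_le:
  fixes T :: "real ^ 'd \<Rightarrow> real ^ 'd"
  assumes T: "\<And>x y. (norm (T x - T y))\<^sup>2 = (\<Sum>j\<in>UNIV. (\<sigma> j * (x $ j - y $ j))\<^sup>2)"
    and \<sigma>: "\<And>j. 0 < \<sigma> j \<and> \<sigma> j < 1"
  shows "dist (T y) (T x) \<le> dist y x"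
proof -
  have "(\<sigma> j * (y $ j - x $ j))\<^sup>2 \<le> (y $ j - x $ j)\<^sup>2" for j
    using \<sigma>[of j] by (simp add: power_mult_distrib mult_left_le_one_le power_le_one)
  then have "(norm (T y - T x))\<^sup>2 \<le> (norm (y - x))\<^sup>2" unfolding T
    by (auto simp: norm_vec_def L2_set_def sum_nonneg intro!: sum_mono)
  then show ?thesis by (simp add: dist_norm abs_le_square_iff[symmetric])
qed

lemma contraction_borel:
  fixes T :: "real ^ 'd \<Rightarrow> real ^ 'd"
  assumes T: "\<And>x y. (norm (T x - T y))\<^sup>2 = (\<Sum>j\<in>UNIV. (\<sigma> j * (x $ j - y $ j))\<^sup>2)"
    and \<sigma>: "\<And>j. 0 < \<sigma> j \<and> \<sigma> j < 1"
  shows "T \<in> borel_measurable borel"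
proof (rule borel_measurable_continuous_onI, rule continuous_onI)
  fix x and \<epsilon> :: real
  assume "0 < \<epsilon>"
  then show "\<exists>d>0. \<forall>x'\<in>UNIV. dist x' x < d \<longrightarrow> dist (T x') (T x) \<le> \<epsilon>"
    using le_less_trans[OF contraction_dist_le[OF T \<sigma>]] by (intro exI[of _ \<epsilon>]) (auto intro: less_imp_le)
qed

text \<open>
  Any two points of the preimage have images within the diameter \<open>sqrt d / 2 ^ n\<close>, so their j-th coordinates
  differ by at most \<open>sqrt d / (2 ^ n * \<sigma> j)\<close>, and by at most 1 because the domain is small. The preimage therefore lies in a
  coordinate box around any one of its points. Smallness of the domain, together with
  \<open>2 \<le> n\<close>, prevents different integer translates of the cube from being hit.
\<close>

lemma preimage_of_cube_volume:
  fixes T :: "real ^ 'd \<Rightarrow> real ^ 'd"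
  assumes T: "\<And>x y. (norm (T x - T y))\<^sup>2 = (\<Sum>j\<in>UNIV. (\<sigma> j * (x $ j - y $ j))\<^sup>2)"
    and \<sigma>: "\<And>j. 0 < \<sigma> j \<and> \<sigma> j < 1" and r: "0 < r" "sqrt CARD('d) * r < 1 / 4" and n: "2 \<le> n"
  shows "emeasure lborel {y \<in> sym_cube r. torus_proj (T y + u) \<in> dcube n c}
     \<le> ennreal (\<Prod>j\<in>UNIV. 2 * (sqrt CARD('d) * min 1 (1 / 2 ^ n / \<sigma> j)))"
proof (cases "{y \<in> sym_cube r. torus_proj (T y + u) \<in> dcube n c} = {}")
  case True
  then show ?thesis by (simp only: emeasure_empty zero_le)
next
  case False
  then obtain x where x: "x \<in> sym_cube r" "torus_proj (T x + u) \<in> dcube n c" by auto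
  define h :: "real ^ 'd" where "h = (\<chi> j. sqrt CARD('d) * min 1 (1 / 2 ^ n / \<sigma> j))"
  have h0: "0 \<le> h $ j" for j using \<sigma>[of j] by (simp add: h_def)
  have "{y \<in> sym_cube r. torus_proj (T y + u) \<in> dcube n c} \<subseteq> cbox (x - h) (x + h)"
  proof
    fix y assume y: "y \<in> {y \<in> sym_cube r. torus_proj (T y + u) \<in> dcube n c}"
    have xy: "norm (y - x) < 1 / 2"
      using norm_sym_cube_le[of y r] norm_sym_cube_le[of x r] norm_triangle_ineq4[of y x] x y r by auto
    have "norm (T y - T x) < 1 / 2"
      using contraction_dist_le[OF T \<sigma>, of y x] xy by (simp add: dist_norm)
    then have "norm ((T y + u) - (T x + u)) \<le> sqrt CARD('d) / 2 ^ n"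
      using x y n by (intro same_cube_lift_close) auto
    then have Txy: "norm (T y - T x) \<le> sqrt CARD('d) / 2 ^ n" by simp
    have "\<bar>y $ j - x $ j\<bar> \<le> h $ j" for j
    proof -
      have "(\<sigma> j * (y $ j - x $ j))\<^sup>2 \<le> (norm (T y - T x))\<^sup>2"
        unfolding T by (intro member_le_sum) auto
      then have "\<bar>\<sigma> j * (y $ j - x $ j)\<bar> \<le> sqrt CARD('d) / 2 ^ n"
        using Txy by (simp add: abs_le_square_iff[symmetric])
      then have "\<bar>y $ j - x $ j\<bar> \<le> sqrt CARD('d) / 2 ^ n / \<sigma> j"
        unfolding abs_mult using \<sigma>[of j] by (simp add: pos_le_divide_eq mult_ac)
      then have 1: "\<bar>y $ j - x $ j\<bar> \<le> sqrt CARD('d) * (1 / 2 ^ n / \<sigma> j)" by simp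
      have "\<bar>y $ j - x $ j\<bar> \<le> norm (y - x)" using component_le_norm_cart[of "y - x" j] by simp
      also have "\<dots> \<le> 1" using xy by simp
      also have "\<dots> \<le> sqrt CARD('d) * 1" by simp
      finally show ?thesis using 1 by (simp add: h_def min_def)
    qed
    then show "y \<in> cbox (x - h) (x + h)"
      by (auto simp: mem_box_cart abs_le_iff) (smt (verit))+
  qed
  then have "emeasure lborel {y \<in> sym_cube r. torus_proj (T y + u) \<in> dcube n c}
      \<le> emeasure lborel (cbox (x - h) (x + h))"
    by (intro emeasure_mono) auto
  also have "\<dots> = ennreal (\<Prod>j\<in>UNIV. 2 * h $ j)" using h0 by (rule emeasure_cbox_cart)
  finally show ?thesis by (simp add: h_def)
qed

text \<open>
  For the last claim, let \<open>m - 1 < \<tau> \<le> m\<close> and estimate \<open>min 1 a\<close> by \<open>a\<close> in the first \<open>m - 1\<close> factors, by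
  \<open>a powr (\<tau> - m + 1)\<close> in the m-th, and by 1 in the others. The exponents add up to \<open>\<tau>\<close>.
\<close>

lemma singular_value_function_bounds:
  fixes L :: "real ^ 'd \<Rightarrow> real ^ 'd" and \<tau> :: real
  assumes p: "bij_betw p {1..CARD('d)} (UNIV :: 'd set)" "\<And>k. k \<in> {1..CARD('d)} \<Longrightarrow> singular_value k L = \<sigma> (p k)"
    and \<sigma>: "\<And>j. 0 < \<sigma> j \<and> \<sigma> j < 1" and \<tau>: "0 < \<tau>" "\<tau> \<le> CARD('d)"
  shows "0 < singular_value_function \<tau> L" "singular_value_function \<tau> L \<le> 1"
    "0 < \<delta> \<Longrightarrow> (\<Prod>j\<in>UNIV. min 1 (\<delta> / \<sigma> j)) \<le> \<delta> powr \<tau> / singular_value_function \<tau> L"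
proof -
  define m where "m = nat \<lceil>\<tau>\<rceil>"
  define \<theta> where "\<theta> = \<tau> - real m + 1"
  define a where "a k = \<sigma> (p k)" for k
  have m: "1 \<le> m" "m \<le> CARD('d)" using \<tau> unfolding m_def by linarith+
  have rm: "real m = of_int \<lceil>\<tau>\<rceil>" using \<tau>(1) by (simp add: m_def)
  have \<theta>: "0 < \<theta>" "\<theta> \<le> 1" unfolding \<theta>_def rm by linarith+
  have a: "0 < a k" "a k < 1" for k using \<sigma> by (auto simp: a_def)
  have sv: "singular_value k L = a k" if "1 \<le> k" "k \<le> m" for k
    using p(2)[of k] that m by (simp add: a_def)
  have eq: "singular_value_function \<tau> L = (\<Prod>k = 1..m - 1. a k) * a m powr \<theta>"
    using m by (auto simp: singular_value_function_def Let_def m_def[symmetric] \<theta>_def sv intro!: prod.cong)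
  have P: "0 < (\<Prod>k = 1..m - 1. a k)" using a by (intro prod_pos) auto
  show "0 < singular_value_function \<tau> L" unfolding eq using P a[of m] by simp
  have "(\<Prod>k = 1..m - 1. a k) \<le> 1" using a by (intro prod_le_1) (auto intro: less_imp_le)
  moreover have "a m powr \<theta> \<le> 1" using a[of m] \<theta> by (intro powr_le1) auto
  ultimately show "singular_value_function \<tau> L \<le> 1"
    unfolding eq using P by (intro mult_le_one) auto
  assume \<delta>: "0 < \<delta>"
  define f where "f k = min 1 (\<delta> / a k)" for k
  have f: "0 < f k" "f k \<le> 1" "f k \<le> \<delta> / a k" for k using \<delta> a[of k] by (auto simp: f_def)
  have "(\<Prod>j\<in>UNIV. min 1 (\<delta> / \<sigma> j)) = (\<Prod>k\<in>{1..CARD('d)}. f k)"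
    using prod.reindex_bij_betw[OF p(1), of "\<lambda>j. min 1 (\<delta> / \<sigma> j)"] by (simp add: f_def a_def)
  also have "\<dots> \<le> (\<Prod>k\<in>{1..m}. f k)"
  proof -
    have "{1..CARD('d)} = {1..m} \<union> {m + 1..CARD('d)}" using m by auto
    then have "(\<Prod>k\<in>{1..CARD('d)}. f k) = (\<Prod>k\<in>{1..m}. f k) * (\<Prod>k\<in>{m + 1..CARD('d)}. f k)"
      by (simp add: prod.union_disjoint)
    also have "\<dots> \<le> (\<Prod>k\<in>{1..m}. f k) * 1"
      using f by (intro mult_left_mono prod_le_1 prod_nonneg) (auto intro: less_imp_le)
    finally show ?thesis by simp
  qed
  also have "\<dots> = (\<Prod>k\<in>{1..m - 1}. f k) * f m"
    using m(1) by (cases m) (auto simp: mult.commute)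
  also have "\<dots> \<le> (\<Prod>k\<in>{1..m - 1}. \<delta> / a k) * (\<delta> / a m) powr \<theta>"
  proof (intro mult_mono prod_mono conjI)
    have "f m = f m powr 1" using f[of m] by simp
    also have "\<dots> \<le> f m powr \<theta>" using f[of m] \<theta> by (intro powr_mono') auto
    also have "\<dots> \<le> (\<delta> / a m) powr \<theta>" using f[of m] \<theta> by (intro powr_mono2) auto
    finally show "f m \<le> (\<delta> / a m) powr \<theta>" .
  qed (use f a \<delta> in \<open>auto intro!: prod_nonneg intro: less_imp_le\<close>)
  also have "\<dots> = \<delta> ^ (m - 1) * \<delta> powr \<theta> / singular_value_function \<tau> L"
    unfolding eq using \<delta> a[of m] by (simp add: prod_dividef powr_divide)
  also have "\<delta> ^ (m - 1) * \<delta> powr \<theta> = \<delta> powr \<tau>"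
    using \<delta> m(1) by (simp add: \<theta>_def of_nat_diff flip: powr_realpow powr_add)
  finally show "(\<Prod>j\<in>UNIV. min 1 (\<delta> / \<sigma> j)) \<le> \<delta> powr \<tau> / singular_value_function \<tau> L" .
qed

text \<open>
  The Frostman condition behind the whole argument: the volume bound for preimages, combined with the
  interpolation \<open>\<delta> powr \<tau> / \<Phi>\<^sup>\<tau>\<close>. The constant does not depend on \<open>L\<close> or on the translation \<open>u\<close>. The term \<open>4 ^ d\<close> in it
  takes care of the levels 0 and 1, where the mass is bounded by 1.
\<close>

lemma cube_mass_le:
  fixes L :: "real ^ 'd \<Rightarrow> real ^ 'd" and r \<tau> :: real
  assumes T: "\<And>x y. (norm (T x - T y))\<^sup>2 = (\<Sum>j\<in>UNIV. (\<sigma> j * (x $ j - y $ j))\<^sup>2)"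
    and p: "bij_betw p {1..CARD('d)} (UNIV :: 'd set)" "\<And>k. k \<in> {1..CARD('d)} \<Longrightarrow> singular_value k L = \<sigma> (p k)"
    and \<sigma>: "\<And>j. 0 < \<sigma> j \<and> \<sigma> j < 1" and r: "0 < r" "sqrt CARD('d) * r < 1 / 4"
    and \<tau>: "0 < \<tau>" "\<tau> \<le> CARD('d)"
  shows "singular_value_function \<tau> L * shifted_mass (uniform_measure lborel (sym_cube r)) T (dcube n c) u
     \<le> max (4 ^ CARD('d)) ((2 * sqrt CARD('d)) ^ CARD('d) / (2 * r) ^ CARD('d)) * (1 / 2 ^ n) powr \<tau>"
proof -
  define K where "K = max (4 ^ CARD('d)) ((2 * sqrt CARD('d)) ^ CARD('d) / (2 * r) ^ CARD('d))"
  define \<Phi> where "\<Phi> = singular_value_function \<tau> L"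
  define g where "g = shifted_mass (uniform_measure lborel (sym_cube r)) T (dcube n c) u"
  note \<Phi> = singular_value_function_bounds[OF p \<sigma> \<tau>, folded \<Phi>_def]
  note [measurable] = contraction_borel[OF T \<sigma>]
  have [measurable]: "sym_cube r \<in> sets borel" by (simp add: sym_cube_def)
  have Q: "emeasure lborel (sym_cube r :: (real ^ 'd) set) = ennreal ((2 * r) ^ CARD('d))"
    using r by (simp add: emeasure_sym_cube)
  interpret prob_space "uniform_measure lborel (sym_cube r :: (real ^ 'd) set)"
    using Q r by (intro prob_space_uniform_measure) auto
  have g1: "g \<le> 1" unfolding g_def shifted_mass_def by (rule prob_le_1)
  have K: "4 ^ CARD('d) \<le> K" "(2 * sqrt CARD('d)) ^ CARD('d) / (2 * r) ^ CARD('d) \<le> K" by (auto simp: K_def)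
  have K0: "0 \<le> K" using order_trans[OF _ K(1), of 0] by simp
  have "\<Phi> * g \<le> K * (1 / 2 ^ n) powr \<tau>"
  proof (cases "2 \<le> n")
    case False
    then have "(1 / 2) powr (CARD('d)) \<le> (1 / 2 ^ n :: real) powr \<tau>"
    proof -
      have "(1 / 2 :: real) powr (CARD('d)) \<le> (1 / 2) powr \<tau>" using \<tau> by (intro powr_mono') auto
      also have "(1 / 2 :: real) ^ 1 \<le> (1 / 2) ^ n" using False by (intro power_decreasing) auto
      then have "(1 / 2 :: real) powr \<tau> \<le> (1 / 2 ^ n) powr \<tau>"
        using \<tau> by (intro powr_mono2) (auto simp: power_divide)
      finally show ?thesis .
    qed
    then have "4 ^ CARD('d) * (1 / 2) ^ CARD('d) \<le> K * (1 / 2 ^ n) powr \<tau>"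
      using K K0 by (intro mult_mono) (auto simp: powr_realpow)
    moreover have "(1 :: real) \<le> 4 ^ CARD('d) * (1 / 2) ^ CARD('d)"
      by (simp flip: power_mult_distrib)
    moreover have "\<Phi> * g \<le> 1"
      using \<Phi> g1 by (intro mult_le_one) (auto simp: g_def shifted_mass_def)
    ultimately show ?thesis by linarith
  next
    case True
    have P0: "0 \<le> (\<Prod>j\<in>UNIV. min 1 (1 / 2 ^ n / \<sigma> j))"
      using \<sigma> by (intro prod_nonneg) (simp add: less_imp_le)
    have "ennreal g = emeasure (uniform_measure lborel (sym_cube r)) {y. torus_proj (T y + u) \<in> dcube n c}"
      by (simp add: g_def shifted_mass_def emeasure_eq_measure)
    also have "\<dots> = emeasure lborel {y \<in> sym_cube r. torus_proj (T y + u) \<in> dcube n c} / ennreal ((2 * r) ^ CARD('d))"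
      by (subst emeasure_uniform_measure) (auto simp: Q Int_def)
    also have "\<dots> \<le> ennreal (\<Prod>j\<in>UNIV. 2 * (sqrt CARD('d) * min 1 (1 / 2 ^ n / \<sigma> j))) / ennreal ((2 * r) ^ CARD('d))"
      by (intro divide_right_mono_ennreal preimage_of_cube_volume[OF T \<sigma> r True])
    also have "(\<Prod>j\<in>UNIV. 2 * (sqrt CARD('d) * min 1 (1 / 2 ^ n / \<sigma> j)))
        = (2 * sqrt CARD('d)) ^ CARD('d) * (\<Prod>j\<in>UNIV. min 1 (1 / 2 ^ n / \<sigma> j))"
      by (simp add: prod.distrib power_mult_distrib mult_ac)
    also have "ennreal \<dots> / ennreal ((2 * r) ^ CARD('d))
        = ennreal ((2 * sqrt CARD('d)) ^ CARD('d) * (\<Prod>j\<in>UNIV. min 1 (1 / 2 ^ n / \<sigma> j)) / (2 * r) ^ CARD('d))"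
      using r P0 by (intro divide_ennreal) auto
    also have "\<dots> = ennreal ((2 * sqrt CARD('d)) ^ CARD('d) / (2 * r) ^ CARD('d) * (\<Prod>j\<in>UNIV. min 1 (1 / 2 ^ n / \<sigma> j)))"
      by simp
    finally have "g \<le> (2 * sqrt CARD('d)) ^ CARD('d) / (2 * r) ^ CARD('d) * (\<Prod>j\<in>UNIV. min 1 (1 / 2 ^ n / \<sigma> j))"
      using r P0 by (subst (asm) ennreal_le_iff) auto
    also have "\<dots> \<le> K * ((1 / 2 ^ n) powr \<tau> / \<Phi>)"
      using K K0 \<sigma> by (intro mult_mono \<Phi>(3) prod_nonneg) (auto intro: less_imp_le)
    finally show ?thesis using \<Phi>(1) by (simp add: field_simps)
  qed
  then show ?thesis by (simp add: \<Phi>_def g_def K_def)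
qed

section \<open>Averaging over a uniform translation of the torus\<close>

text \<open>
  The integer translates of the fundamental domain tile the space. Cut the domain according to which
  integer vector brings \<open>y + u\<close> back into it; the pieces, translated by \<open>y\<close> and these vectors, make up \<open>C\<close>.
\<close>

lemma emeasure_torus_shift:
  fixes C :: "(real ^ 'd) set"
  assumes C [measurable]: "C \<in> sets borel" and sub: "C \<subseteq> torus"
  shows "emeasure torus_measure {u \<in> torus. torus_proj (y + u) \<in> C} = emeasure lborel C"
proof -
  \<comment> \<open>the integer lattice\<close>
  define Z where "Z = range (\<lambda>k :: int ^ 'd. (\<chi> j. real_of_int (k $ j)) :: real ^ 'd)"
  have [simp]: "countable Z" unfolding Z_def by (intro countable_image) auto
  note [measurable] = torus_in_borel
  have Z: "k \<in> Z \<longleftrightarrow> (\<forall>j. k $ j \<in> \<int>)" for k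
  proof
    assume "\<forall>j. k $ j \<in> \<int>"
    then have "k = (\<chi> j. real_of_int ((\<chi> j. \<lfloor>k $ j\<rfloor>) $ j))" by (simp add: vec_eq_iff)
    then show "k \<in> Z" unfolding Z_def by blast
  qed (auto simp: Z_def)
  have uniq: "k = l" if "x + k \<in> torus" "x + l \<in> torus" "k \<in> Z" "l \<in> Z" for x k l :: "real ^ 'd"
  proof -
    have "torus_proj (x + k) = torus_proj (x + l)"
      using that by (auto simp: torus_proj_eq_iff Z)
    then show ?thesis using that by (simp add: torus_proj_id)
  qed
  define S where "S k = {u \<in> torus. y + u + k \<in> C}" for k
  have proj: "torus_proj x = x + (torus_proj x - x)" "torus_proj x - x \<in> Z" for x
    by (auto simp: Z torus_proj_def frac_def)
  have "{u \<in> torus. torus_proj (y + u) \<in> C} = (\<Union>k\<in>Z. S k)"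
  proof (intro set_eqI iffI)
    fix u assume "u \<in> {u \<in> torus. torus_proj (y + u) \<in> C}"
    then have "u \<in> S (torus_proj (y + u) - (y + u))" by (simp add: S_def)
    then show "u \<in> (\<Union>k\<in>Z. S k)" using proj(2) by blast
  next
    fix u assume "u \<in> (\<Union>k\<in>Z. S k)"
    then obtain k where k: "k \<in> Z" "u \<in> torus" "y + u + k \<in> C" by (auto simp: S_def)
    then have "torus_proj (y + u) = torus_proj (y + u + k)" by (auto simp: torus_proj_eq_iff Z)
    also have "\<dots> = y + u + k" using k sub by (intro torus_proj_id) auto
    finally show "u \<in> {u \<in> torus. torus_proj (y + u) \<in> C}" using k by simp
  qed
  moreover have Sm: "S k \<in> sets borel" for k unfolding S_def by measurable
  moreover have "disjoint_family_on S Z"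
    using sub uniq by (fastforce simp: disjoint_family_on_def S_def)
  ultimately have "emeasure lborel {u \<in> torus. torus_proj (y + u) \<in> C} = (\<integral>\<^sup>+k. emeasure lborel (S k) \<partial>count_space Z)"
    by (simp add: emeasure_UN_countable)
  also have "\<dots> = (\<integral>\<^sup>+k. emeasure lborel {x \<in> C. x - (y + k) \<in> torus} \<partial>count_space Z)"
  proof (intro nn_integral_cong)
    fix k :: "real ^ 'd"
    have "emeasure lborel {x \<in> C. x - (y + k) \<in> torus} = emeasure (distr lborel borel ((+) (y + k))) {x \<in> C. x - (y + k) \<in> torus}"
      by (simp add: lborel_distr_plus)
    also have "\<dots> = emeasure lborel (S k)"
      by (subst emeasure_distr) (auto simp: S_def algebra_simps intro!: arg_cong2[of _ _ _ _ emeasure])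
    finally show "emeasure lborel (S k) = emeasure lborel {x \<in> C. x - (y + k) \<in> torus}" by simp
  qed
  also have "\<dots> = emeasure lborel (\<Union>k\<in>Z. {x \<in> C. x - (y + k) \<in> torus})"
  proof (rule emeasure_UN_countable[symmetric])
    show "disjoint_family_on (\<lambda>k. {x \<in> C. x - (y + k) \<in> torus}) Z"
    proof (unfold disjoint_family_on_def, intro ballI impI, rule ccontr)
      fix k l assume kl: "k \<in> Z" "l \<in> Z" "k \<noteq> l"
        "{x \<in> C. x - (y + k) \<in> torus} \<inter> {x \<in> C. x - (y + l) \<in> torus} \<noteq> {}"
      then obtain x where "x - (y + k) \<in> torus" "x - (y + l) \<in> torus" by auto
      then have "- k = - l" using kl by (intro uniq[of "x - y"]) (auto simp: algebra_simps Z)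
      then show False using kl by simp
    qed
  qed auto
  also have "(\<Union>k\<in>Z. {x \<in> C. x - (y + k) \<in> torus}) = C"
  proof -
    have "x - (y + (x - y - torus_proj (x - y))) = torus_proj (x - y)" for x by simp
    then have "x - (y + (x - y - torus_proj (x - y))) \<in> torus" for x by simp
    moreover have "x - y - torus_proj (x - y) \<in> Z" for x
      by (auto simp: Z torus_proj_def frac_def)
    ultimately show ?thesis by blast
  qed
  finally show ?thesis
    unfolding torus_measure_def by (subst emeasure_restrict_space) (auto simp: torus_in_borel)
qed

lemma shifted_mass_measurable [measurable]:
  assumes "sets \<kappa> = sets borel" "prob_space \<kappa>" and [measurable]: "T \<in> borel_measurable borel" "C \<in> sets borel"
  shows "shifted_mass \<kappa> T C \<in> borel_measurable borel"
proof -
  interpret prob_space \<kappa> by fact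
  note [measurable_cong] = assms(1)
  have sp: "space \<kappa> = UNIV" using sets_eq_imp_space_eq[OF assms(1)] by simp
  define Q where "Q = {z \<in> space (borel \<Otimes>\<^sub>M \<kappa>). torus_proj (T (snd z) + fst z) \<in> C}"
  have "Q \<in> sets (borel \<Otimes>\<^sub>M \<kappa>)" unfolding Q_def by measurable
  then have "(\<lambda>u. emeasure \<kappa> (Pair u -` Q)) \<in> borel_measurable borel"
    by (rule measurable_emeasure_Pair)
  then have "(\<lambda>u. enn2real (emeasure \<kappa> (Pair u -` Q))) \<in> borel_measurable borel" by measurable
  moreover have "Pair u -` Q = {y \<in> space \<kappa>. torus_proj (T y + u) \<in> C}" for u
    by (auto simp: Q_def space_pair_measure sp)
  ultimately show ?thesis by (simp add: shifted_mass_def[abs_def] measure_def)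
qed

text \<open>
  By Fubini, the mean over \<open>u\<close> is taken first for a fixed point \<open>y\<close>, where it is the volume of \<open>C\<close>.
\<close>

lemma shifted_mass_mean:
  fixes C :: "(real ^ 'd) set"
  assumes "sets \<kappa> = sets borel" "prob_space \<kappa>" and [measurable]: "T \<in> borel_measurable borel"
    and C [measurable]: "C \<in> sets borel" and sub: "C \<subseteq> torus"
  shows "(\<integral>u. shifted_mass \<kappa> T C u \<partial>torus_measure) = measure lborel C"
proof -
  interpret K: prob_space \<kappa> by fact
  interpret S: prob_space "torus_measure :: (real ^ 'd) measure" by (rule prob_space_torus_measure)
  interpret pair_sigma_finite "torus_measure :: (real ^ 'd) measure" \<kappa> ..
  note [measurable_cong] = assms(1)
  have spT: "space torus_measure = torus" by (simp add: torus_measure_def space_restrict_space)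
  have spK: "space \<kappa> = UNIV" using sets_eq_imp_space_eq[OF assms(1)] by simp
  have id: "(\<lambda>u. u) \<in> torus_measure \<rightarrow>\<^sub>M borel"
    unfolding torus_measure_def by (intro measurable_restrict_space1) auto
  have "(\<integral>u. shifted_mass \<kappa> T C u \<partial>torus_measure) = enn2real (\<integral>\<^sup>+u. ennreal (shifted_mass \<kappa> T C u) \<partial>torus_measure)"
  proof (rule integral_eq_nn_integral)
    show "shifted_mass \<kappa> T C \<in> borel_measurable torus_measure"
      using measurable_compose[OF id shifted_mass_measurable[OF assms(1-4)]] by simp
  qed (simp add: shifted_mass_def)
  also have "(\<integral>\<^sup>+u. ennreal (shifted_mass \<kappa> T C u) \<partial>torus_measure)
     = (\<integral>\<^sup>+u. \<integral>\<^sup>+y. indicator C (torus_proj (T y + u)) \<partial>\<kappa> \<partial>torus_measure)"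
  proof (rule nn_integral_cong)
    fix u
    have "{y \<in> space \<kappa>. torus_proj (T y + u) \<in> C} \<in> sets \<kappa>" by measurable
    then have "ennreal (shifted_mass \<kappa> T C u) = (\<integral>\<^sup>+y. indicator {y \<in> space \<kappa>. torus_proj (T y + u) \<in> C} y \<partial>\<kappa>)"
      by (simp add: shifted_mass_def K.emeasure_eq_measure)
    also have "\<dots> = (\<integral>\<^sup>+y. indicator C (torus_proj (T y + u)) \<partial>\<kappa>)"
      by (intro nn_integral_cong) (auto split: split_indicator)
    finally show "ennreal (shifted_mass \<kappa> T C u) = (\<integral>\<^sup>+y. indicator C (torus_proj (T y + u)) \<partial>\<kappa>)" .
  qed
  also have "\<dots> = (\<integral>\<^sup>+y. \<integral>\<^sup>+u. indicator C (torus_proj (T y + u)) \<partial>torus_measure \<partial>\<kappa>)"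
  proof (rule Fubini'[symmetric])
    have [measurable]: "fst \<in> torus_measure \<Otimes>\<^sub>M \<kappa> \<rightarrow>\<^sub>M borel"
      by (rule measurable_compose[OF measurable_fst id])
    have "(\<lambda>z. indicator C (torus_proj (T (snd z) + fst z))) \<in> borel_measurable (torus_measure \<Otimes>\<^sub>M \<kappa>)"
      by measurable
    then show "(\<lambda>(u, y). indicator C (torus_proj (T y + u))) \<in> borel_measurable (torus_measure \<Otimes>\<^sub>M \<kappa>)"
      by (simp add: case_prod_beta)
  qed
  also have "\<dots> = (\<integral>\<^sup>+y. emeasure lborel C \<partial>\<kappa>)"
  proof (rule nn_integral_cong)
    fix y
    have "{u. torus_proj (T y + u) \<in> C} \<in> sets borel" by measurable
    from measurable_sets[OF id this]
    have "{u \<in> space torus_measure. torus_proj (T y + u) \<in> C} \<in> sets torus_measure"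
      by (simp add: vimage_def Int_def conj_commute)
    moreover have "(\<integral>\<^sup>+u. indicator C (torus_proj (T y + u)) \<partial>torus_measure)
        = (\<integral>\<^sup>+u. indicator {u \<in> space torus_measure. torus_proj (T y + u) \<in> C} u \<partial>torus_measure)"
      by (intro nn_integral_cong) (auto split: split_indicator)
    ultimately have "(\<integral>\<^sup>+u. indicator C (torus_proj (T y + u)) \<partial>torus_measure)
        = emeasure torus_measure {u \<in> space torus_measure. torus_proj (T y + u) \<in> C}"
      by simp
    also have "\<dots> = emeasure lborel C"
      using emeasure_torus_shift[OF C sub, of "T y"] by (simp add: spT)
    finally show "(\<integral>\<^sup>+u. indicator C (torus_proj (T y + u)) \<partial>torus_measure) = emeasure lborel C"
      .
  qed
  also have "\<dots> = emeasure lborel C" by (simp add: K.emeasure_space_1)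
  finally show ?thesis by (simp add: measure_def)
qed

section \<open>Energy of random translates\<close>

text \<open>
  Independence makes the off-diagonal terms factor into the square of the mean; on the diagonal,
  \<open>b\<close> bounds one of the two factors \<open>w i * Y i\<close> and the other is averaged.
\<close>

lemma (in prob_space) second_moment_weighted_sum_le:
  fixes Y :: "'i \<Rightarrow> 'a \<Rightarrow> real"
  assumes I: "finite I" and ind: "indep_vars (\<lambda>_. borel) Y I"
    and Y: "\<And>i \<omega>. i \<in> I \<Longrightarrow> 0 \<le> Y i \<omega> \<and> Y i \<omega> \<le> 1"
    and p: "\<And>i. i \<in> I \<Longrightarrow> expectation (Y i) = p"
    and w: "\<And>i. i \<in> I \<Longrightarrow> 0 \<le> w i" and b: "\<And>i \<omega>. i \<in> I \<Longrightarrow> w i * Y i \<omega> \<le> b"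
  shows "expectation (\<lambda>\<omega>. (\<Sum>i\<in>I. w i * Y i \<omega>)\<^sup>2) \<le> (sum w I * p)\<^sup>2 + b * (sum w I * p)"
proof -
  have meas: "Y i \<in> borel_measurable M" if "i \<in> I" for i
    using ind that by (auto simp: indep_vars_def)
  have int: "integrable M (Y i)" if "i \<in> I" for i
    using Y[OF that] meas[OF that] by (intro integrable_const_bound[of _ 1]) auto
  have YY: "0 \<le> Y i \<omega> * Y j \<omega> \<and> Y i \<omega> * Y j \<omega> \<le> 1" if "i \<in> I" "j \<in> I" for i j \<omega>
    using Y[of i \<omega>] Y[of j \<omega>] that by (auto intro: mult_le_one)
  have intYY: "integrable M (\<lambda>\<omega>. Y i \<omega> * Y j \<omega>)" if "i \<in> I" "j \<in> I" for i j
    using YY[OF that] meas that by (intro integrable_const_bound[of _ 1]) auto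
  have p0: "0 \<le> p" if "i \<in> I" for i
    unfolding p[OF that, symmetric] using Y that by (intro integral_nonneg_AE) auto
  have pair: "w i * w j * expectation (\<lambda>\<omega>. Y i \<omega> * Y j \<omega>) \<le> w i * w j * p\<^sup>2 + (if i = j then b * w i * p else 0)"
    if ij: "i \<in> I" "j \<in> I" for i j
  proof (cases "i = j")
    case True
    have "w i * expectation (\<lambda>\<omega>. Y i \<omega> * Y i \<omega>) = expectation (\<lambda>\<omega>. (w i * Y i \<omega>) * Y i \<omega>)"
      by (subst integral_mult_right_zero[symmetric]) (simp add: mult_ac)
    also have "\<dots> \<le> expectation (\<lambda>\<omega>. b * Y i \<omega>)"
    proof (intro integral_mono)
      show "integrable M (\<lambda>\<omega>. w i * Y i \<omega> * Y i \<omega>)"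
        using integrable_mult_right[OF intYY[OF ij(1) ij(1)], of "w i"] by (simp add: mult_ac)
      show "w i * Y i \<omega> * Y i \<omega> \<le> b * Y i \<omega>" for \<omega>
        using b[OF ij(1)] Y[OF ij(1)] by (intro mult_right_mono) auto
    qed (use int ij in auto)
    also have "\<dots> = b * p" using p ij by simp
    finally have "w i * (w i * expectation (\<lambda>\<omega>. Y i \<omega> * Y i \<omega>)) \<le> w i * (b * p)"
      using w ij by (intro mult_left_mono) auto
    moreover have "0 \<le> w i * w i * p\<^sup>2" by simp
    ultimately show ?thesis using True by (simp add: mult_ac)
  next
    case False
    have "indep_vars (\<lambda>_. borel) Y {i, j}" using ind ij by (intro indep_vars_subset[OF ind]) auto
    then have "expectation (\<lambda>\<omega>. \<Prod>k\<in>{i, j}. Y k \<omega>) = (\<Prod>k\<in>{i, j}. expectation (Y k))"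
      using int ij by (intro indep_vars_lebesgue_integral) auto
    then show ?thesis using False p ij by (simp add: power2_eq_square)
  qed
  have "expectation (\<lambda>\<omega>. (\<Sum>i\<in>I. w i * Y i \<omega>)\<^sup>2)
      = expectation (\<lambda>\<omega>. \<Sum>i\<in>I. \<Sum>j\<in>I. w i * w j * (Y i \<omega> * Y j \<omega>))"
    by (simp add: power2_eq_square sum_product mult_ac)
  also have "\<dots> = (\<Sum>i\<in>I. \<Sum>j\<in>I. w i * w j * expectation (\<lambda>\<omega>. Y i \<omega> * Y j \<omega>))"
    using intYY by (simp add: Bochner_Integration.integral_sum)
  also have "\<dots> \<le> (\<Sum>i\<in>I. \<Sum>j\<in>I. w i * w j * p\<^sup>2 + (if i = j then b * w i * p else 0))"
    by (intro sum_mono pair)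
  also have "\<dots> = (sum w I * p)\<^sup>2 + b * (sum w I * p)"
    using I by (simp add: sum.distrib power2_eq_square sum_product sum_distrib_left sum_distrib_right mult_ac)
  finally show ?thesis .
qed

lemma nn_integral_count_space_UN_le:
  fixes f :: "'a \<Rightarrow> ennreal" and A :: "nat \<Rightarrow> 'a set"
  assumes "B \<subseteq> (\<Union>k. A k)"
  shows "(\<integral>\<^sup>+x. f x \<partial>count_space B) \<le> (\<Sum>k. \<integral>\<^sup>+x. f x \<partial>count_space (A k))"
proof -
  have "(\<integral>\<^sup>+x. f x \<partial>count_space B) = (\<integral>\<^sup>+x. f x * indicator B x \<partial>count_space UNIV)"
    by (simp add: nn_integral_count_space_indicator)
  also have "\<dots> \<le> (\<integral>\<^sup>+x. (\<Sum>k. f x * indicator (A k) x) \<partial>count_space UNIV)"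
  proof (rule nn_integral_mono)
    fix x
    show "f x * indicator B x \<le> (\<Sum>k. f x * indicator (A k) x)"
    proof (cases "x \<in> B")
      case True
      then obtain k where "x \<in> A k" using assms by auto
      then have "f x * indicator B x \<le> f x * indicator (A k) x" using True by simp
      also have "\<dots> \<le> (\<Sum>k. f x * indicator (A k) x)"
      proof -
        have "g k \<le> suminf g" for g :: "nat \<Rightarrow> ennreal"
          using sum_le_suminf[of g "{k}"] by simp
        then show ?thesis .
      qed
      finally show ?thesis .
    qed simp
  qed
  also have "\<dots> = (\<Sum>k. \<integral>\<^sup>+x. f x * indicator (A k) x \<partial>count_space UNIV)"
    by (intro nn_integral_suminf) auto
  also have "\<dots> = (\<Sum>k. \<integral>\<^sup>+x. f x \<partial>count_space (A k))"
    by (simp add: nn_integral_count_space_indicator)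
  finally show ?thesis .
qed

lemma emeasure_le_count_space_cover:
  assumes "countable F" "\<And>C. C \<in> F \<Longrightarrow> X C \<in> sets N" "A \<in> sets N" "A \<subseteq> (\<Union>C\<in>F. X C)"
  shows "emeasure N A \<le> (\<integral>\<^sup>+C. emeasure N (X C) \<partial>count_space F)"
proof -
  have "emeasure N A = (\<integral>\<^sup>+x. indicator A x \<partial>N)" using assms by simp
  also have "\<dots> \<le> (\<integral>\<^sup>+x. \<integral>\<^sup>+C. indicator (X C) x \<partial>count_space F \<partial>N)"
  proof (rule nn_integral_mono)
    fix x
    show "indicator A x \<le> (\<integral>\<^sup>+C. indicator (X C) x \<partial>count_space F)"
    proof (cases "x \<in> A")
      case True
      then obtain C where "C \<in> F" "x \<in> X C" using assms by auto
      then show ?thesis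
        using nn_integral_ge_point[of C F "\<lambda>C. indicator (X C) x"] True by simp
    qed simp
  qed
  also have "\<dots> = (\<integral>\<^sup>+C. \<integral>\<^sup>+x. indicator (X C) x \<partial>N \<partial>count_space F)"
    using assms by (intro nn_integral_count_space_nn_integral) auto
  also have "\<dots> = (\<integral>\<^sup>+C. emeasure N (X C) \<partial>count_space F)"
    using assms by (intro nn_integral_cong) auto
  finally show ?thesis .
qed

text \<open>
  By the zero-one law it suffices that infinitely many events do not almost surely fail to occur; the limsup has
  probability at least \<open>c\<close>.
\<close>

lemma (in prob_space) independent_events_occur_infinitely_often:
  assumes ind: "indep_events (\<lambda>b. {\<omega> \<in> space M. P b \<omega>}) (UNIV :: nat set)"
    and c: "0 < c" "\<And>b. c \<le> prob {\<omega> \<in> space M. P b \<omega>}"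
  shows "AE \<omega> in M. infinite {b. P b \<omega>}"
proof -
  define E where "E b = {\<omega> \<in> space M. P b \<omega>}" for b
  have [measurable]: "E b \<in> sets M" for b using ind by (auto simp: indep_events_def E_def)
  define A where "A m = (\<Union>b\<in>{m..}. E b)" for m
  have "(\<lambda>m. prob (A m)) \<longlonglongrightarrow> prob (\<Inter>m. A m)"
  proof (rule finite_Lim_measure_decseq)
    show "decseq A" unfolding decseq_def A_def by (intro allI impI UN_mono) auto
  qed (auto simp: A_def)
  moreover have "c \<le> prob (A m)" for m
  proof -
    have "prob (E m) \<le> prob (A m)" by (intro finite_measure_mono) (auto simp: A_def)
    then show ?thesis using c(2)[of m] by (simp add: E_def)
  qed
  ultimately have "c \<le> prob (\<Inter>m. A m)" by (intro LIMSEQ_le_const) auto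
  then have pos: "0 < prob (\<Inter>m. A m)" using c(1) by simp
  have "\<not> (AE \<omega> in M. finite {b. P b \<omega>})"
  proof
    assume "AE \<omega> in M. finite {b. P b \<omega>}"
    then have "AE \<omega> in M. \<omega> \<notin> (\<Inter>m. A m)"
    proof eventually_elim
      case (elim \<omega>)
      then obtain m where "\<And>b. P b \<omega> \<Longrightarrow> b < m"
        by (metis finite_nat_set_iff_bounded mem_Collect_eq)
      then have "\<omega> \<notin> A m" by (auto simp: A_def E_def not_le[symmetric])
      then show ?case by blast
    qed
    then have "prob (\<Inter>m. A m) = 0" by (subst prob_eq_0) (auto simp: A_def)
    then show False using pos by simp
  qed
  then show ?thesis using borel_0_1_law_AE[OF ind] by blast
qed

text \<open>
  The weights \<open>w i\<close> will be \<open>\<Phi>\<^sup>\<tau>(L i)\<close>, and \<open>cube_mass_le\<close> will supply the bound on the weighted masses.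
\<close>

locale random_translates = prob_space M for M :: "'w measure" +
  fixes v :: "nat \<Rightarrow> 'w \<Rightarrow> real ^ 'd" and \<kappa> :: "(real ^ 'd) measure"
    and T :: "nat \<Rightarrow> real ^ 'd \<Rightarrow> real ^ 'd" and w :: "nat \<Rightarrow> real" and K \<tau> :: real
  assumes indep_v: "indep_vars (\<lambda>_. torus_measure) v UNIV"
    and unif_v: "\<And>i. distr M torus_measure (v i) = torus_measure"
    and sets_\<kappa>: "sets \<kappa> = sets borel" and prob_\<kappa>: "prob_space \<kappa>"
    and T_borel: "\<And>i. T i \<in> borel_measurable borel"
    and w: "\<And>i. 0 \<le> w i" "\<And>i. w i \<le> 1" and K: "0 \<le> K"
    and mass_bound: "\<And>i n c u. w i * shifted_mass \<kappa> (T i) (dcube n c) u \<le> K * (1 / 2 ^ n) powr \<tau>"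
begin

definition total_mass :: "nat set \<Rightarrow> (real ^ 'd) set \<Rightarrow> (nat \<Rightarrow> real ^ 'd) \<Rightarrow> real" where
  "total_mass I C u = (\<Sum>i\<in>I. w i * shifted_mass \<kappa> (T i) C (u i))"

lemma shifted_mass_01: "0 \<le> shifted_mass \<kappa> f C u" "shifted_mass \<kappa> f C u \<le> 1"
  unfolding shifted_mass_def using prob_space.prob_le_1[OF prob_\<kappa>] by auto

lemma total_mass_nonneg: "0 \<le> total_mass I C u"
  unfolding total_mass_def by (intro sum_nonneg mult_nonneg_nonneg w shifted_mass_01)

lemma measurable_id_torus: "(\<lambda>u. u) \<in> torus_measure \<rightarrow>\<^sub>M borel"
  unfolding torus_measure_def by (intro measurable_restrict_space1) auto

lemma measurable_shifted_mass_torus: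
  "C \<in> sets borel \<Longrightarrow> shifted_mass \<kappa> (T i) C \<in> borel_measurable torus_measure"
  using measurable_compose[OF measurable_id_torus shifted_mass_measurable[OF sets_\<kappa> prob_\<kappa> T_borel]] by simp

lemma measurable_v: "v i \<in> M \<rightarrow>\<^sub>M torus_measure"
  using indep_v by (auto simp: indep_vars_def)

lemma expectation_shifted_mass:
  assumes "C \<in> sets borel" "C \<subseteq> torus"
  shows "expectation (\<lambda>\<omega>. shifted_mass \<kappa> (T i) C (v i \<omega>)) = measure lborel C"
proof -
  have "expectation (\<lambda>\<omega>. shifted_mass \<kappa> (T i) C (v i \<omega>)) = (\<integral>u. shifted_mass \<kappa> (T i) C u \<partial>distr M torus_measure (v i))"
    by (intro integral_distr[symmetric] measurable_v measurable_shifted_mass_torus assms)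
  then show ?thesis
    unfolding unif_v using shifted_mass_mean[OF sets_\<kappa> prob_\<kappa> T_borel assms] by simp
qed

lemma second_moment_total_mass:
  assumes I: "finite I" and C: "C \<in> sets borel" "C \<subseteq> torus"
    and b: "\<And>i u. w i * shifted_mass \<kappa> (T i) C u \<le> b"
  shows "expectation (\<lambda>\<omega>. (total_mass I C (\<lambda>i. v i \<omega>))\<^sup>2)
     \<le> (sum w I * measure lborel C)\<^sup>2 + b * (sum w I * measure lborel C)"
  unfolding total_mass_def
proof (rule second_moment_weighted_sum_le[OF I])
  have "indep_vars (\<lambda>_. torus_measure) v I" by (rule indep_vars_subset[OF indep_v]) simp
  then show "indep_vars (\<lambda>_. borel) (\<lambda>i \<omega>. shifted_mass \<kappa> (T i) C (v i \<omega>)) I"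
    by (rule indep_vars_compose2) (rule measurable_shifted_mass_torus[OF C(1)])
qed (use expectation_shifted_mass[OF C] shifted_mass_01 w b in auto)

lemma measurable_total_mass:
  assumes "C \<in> sets borel"
  shows "total_mass I C \<in> borel_measurable (PiM I (\<lambda>_. torus_measure))"
  unfolding total_mass_def
proof (intro borel_measurable_sum borel_measurable_times borel_measurable_const)
  show "(\<lambda>u. shifted_mass \<kappa> (T i) C (u i)) \<in> borel_measurable (PiM I (\<lambda>_. torus_measure))" if "i \<in> I" for i
    using that by (rule measurable_compose[OF measurable_component_singleton[of i I "\<lambda>_. torus_measure"] measurable_shifted_mass_torus[OF assms]])
qed

lemma measurable_total_mass_v:
  assumes "C \<in> sets borel"
  shows "(\<lambda>\<omega>. total_mass I C (\<lambda>i. v i \<omega>)) \<in> borel_measurable M"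
  unfolding total_mass_def
  by (intro borel_measurable_sum borel_measurable_times borel_measurable_const
      measurable_compose[OF measurable_v measurable_shifted_mass_torus[OF assms]])

lemma total_mass_le: "total_mass I C u \<le> sum w I"
  unfolding total_mass_def using shifted_mass_01 w by (intro sum_mono) (auto intro: mult_left_le)

lemma integrable_total_mass_power:
  assumes "C \<in> sets borel"
  shows "integrable M (\<lambda>\<omega>. (total_mass I C (\<lambda>i. v i \<omega>)) ^ k)"
proof (rule integrable_const_bound)
  show "AE \<omega> in M. norm (total_mass I C (\<lambda>i. v i \<omega>) ^ k) \<le> (sum w I) ^ k"
    using total_mass_nonneg total_mass_le by (auto simp: abs_of_nonneg intro!: power_mono)
qed (use measurable_total_mass_v[OF assms] in auto)

lemma expectation_total_mass:
  assumes "C \<in> sets borel" "C \<subseteq> torus"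
  shows "expectation (\<lambda>\<omega>. total_mass I C (\<lambda>i. v i \<omega>)) = sum w I * measure lborel C"
proof -
  have "integrable M (\<lambda>\<omega>. shifted_mass \<kappa> (T i) C (v i \<omega>))" for i
    using shifted_mass_01 measurable_compose[OF measurable_v measurable_shifted_mass_torus[OF assms(1)]]
    by (intro integrable_const_bound[of _ 1]) auto
  then show ?thesis
    unfolding total_mass_def using expectation_shifted_mass[OF assms]
    by (simp add: Bochner_Integration.integral_sum sum_distrib_right)
qed

text \<open>
  As \<open>w i\<close> and the masses are at most 1, the variance is at most the mean, and Chebyshev's inequality applies.
\<close>

lemma total_mass_concentration:
  assumes I: "finite I" and C: "C \<in> sets borel" "C \<subseteq> torus" and pos: "0 < sum w I * measure lborel C"
  shows "prob {\<omega> \<in> space M. total_mass I C (\<lambda>i. v i \<omega>) < sum w I * measure lborel C / 2}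
     \<le> 4 / (sum w I * measure lborel C)"
proof -
  define a where "a = sum w I * measure lborel C"
  define X where "X \<omega> = total_mass I C (\<lambda>i. v i \<omega>)" for \<omega>
  have [measurable]: "X \<in> borel_measurable M" unfolding X_def using measurable_total_mass_v[OF C(1)] .
  have int1: "integrable M X" and int2: "integrable M (\<lambda>\<omega>. (X \<omega>)\<^sup>2)"
    using integrable_total_mass_power[OF C(1), of I 1] integrable_total_mass_power[OF C(1), of I 2] by (simp_all add: X_def[abs_def])
  have EX: "expectation X = a" unfolding X_def a_def by (rule expectation_total_mass[OF C])
  have "variance X = expectation (\<lambda>\<omega>. (X \<omega>)\<^sup>2) - a\<^sup>2"
    using variance_eq[OF int1 int2] by (simp only: EX)
  also have "\<dots> \<le> a"
  proof -
    have "w i * shifted_mass \<kappa> (T i) C u \<le> 1" for i u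
      using w shifted_mass_01 by (intro mult_le_one) auto
    from second_moment_total_mass[OF I C this] show ?thesis by (simp add: X_def a_def)
  qed
  finally have var: "variance X \<le> a" .
  have a: "0 < a" using pos by (simp add: a_def)
  have "prob {\<omega> \<in> space M. X \<omega> < a / 2} \<le> prob {\<omega> \<in> space M. a / 2 \<le> \<bar>X \<omega> - expectation X\<bar>}"
    using a by (intro finite_measure_mono) (auto simp: EX)
  also have "\<dots> \<le> variance X / (a / 2)\<^sup>2"
    using a int2 by (intro Chebyshev_inequality) auto
  also have "\<dots> \<le> a / (a / 2)\<^sup>2" by (intro divide_right_mono var) auto
  also have "\<dots> = 4 / a" using a by (simp add: field_simps power2_eq_square)
  finally show ?thesis by (simp add: X_def a_def)
qed

text \<open>
  The dyadic form of the \<open>t\<close>-energy \<open>\<integral>\<integral> |x - y| powr (-t)\<close> of the measure restricted to \<open>D\<close>, a cube of level \<open>n\<close>. Summing over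
  all levels makes the energy dominate the contribution of an arbitrary family of cubes, even if the cubes overlap.
\<close>

definition energy :: "real \<Rightarrow> nat \<Rightarrow> (real ^ 'd) set \<Rightarrow> nat set \<Rightarrow> (nat \<Rightarrow> real ^ 'd) \<Rightarrow> ennreal" where
  "energy t n D I u = (\<Sum>k. \<Sum>C\<in>subcubes (n + k) D. ennreal ((2 ^ (n + k)) powr t * (total_mass I C u)\<^sup>2))"

lemma measurable_energy: "energy t n D I \<in> borel_measurable (PiM I (\<lambda>_. torus_measure))"
  unfolding energy_def
  by (intro borel_measurable_suminf_order borel_measurable_sum measurable_compose[OF _ measurable_ennreal]
      borel_measurable_times borel_measurable_power measurable_total_mass subcubes_borel) auto

lemma measurable_energy_v: "(\<lambda>\<omega>. energy t n D I (\<lambda>i. v i \<omega>)) \<in> borel_measurable M"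
  unfolding energy_def
  by (intro borel_measurable_suminf_order borel_measurable_sum measurable_compose[OF _ measurable_ennreal]
      borel_measurable_times borel_measurable_power measurable_total_mass_v subcubes_borel) auto

text \<open>
  At level \<open>m\<close>, a cube has mean square mass at most \<open>(S * \<mu>)\<^sup>2 + K * 2 powr (-m * \<tau>) * S * \<mu>\<close> with \<open>\<mu>\<close> its volume. After
  multiplication by \<open>2 powr (m * t)\<close> and summation over the cubes in \<open>D\<close>, the two parts decay geometrically in
  \<open>m\<close> with ratios \<open>q\<close> and \<open>q'\<close>, since \<open>t < d\<close> and \<open>t < \<tau>\<close>. Only the first part is quadratic in \<open>S\<close>.
\<close>

lemma expected_energy_le:
  fixes x :: "real ^ 'd" and n :: nat
  assumes I: "finite I" and x: "x \<in> torus" and t: "t < \<tau>" "t < CARD('d)"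
  defines "q \<equiv> 2 powr (t - CARD('d))" and "q' \<equiv> 2 powr (t - \<tau>)" and "S \<equiv> sum w I"
    and "l \<equiv> (1 / 2 ^ n) ^ CARD('d)"
  shows "(\<integral>\<^sup>+\<omega>. energy t n (dcube n x) I (\<lambda>i. v i \<omega>) \<partial>M)
      \<le> ennreal (S\<^sup>2 * l * q ^ n / (1 - q) + K * S * l / (1 - q'))"
proof -
  let ?D = "dcube n x"
  have q: "0 < q" "q < 1" "0 < q'" "q' < 1" using t by (auto simp: q_def q'_def powr_less_one)
  have S: "0 \<le> S" unfolding S_def by (intro sum_nonneg w)
  have l: "0 \<le> l" by (simp add: l_def)
  have "(\<integral>\<^sup>+\<omega>. energy t n ?D I (\<lambda>i. v i \<omega>) \<partial>M)
      = (\<Sum>k. \<Sum>C\<in>subcubes (n + k) ?D. \<integral>\<^sup>+\<omega>. ennreal ((2 ^ (n + k)) powr t * (total_mass I C (\<lambda>i. v i \<omega>))\<^sup>2) \<partial>M)"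
    unfolding energy_def
    by (subst nn_integral_suminf, intro borel_measurable_sum measurable_compose[OF _ measurable_ennreal]
      borel_measurable_times borel_measurable_power measurable_total_mass_v subcubes_borel borel_measurable_const, assumption)
       (intro suminf_cong nn_integral_sum measurable_compose[OF _ measurable_ennreal]
      borel_measurable_times borel_measurable_power measurable_total_mass_v subcubes_borel borel_measurable_const)
  also have "\<dots> \<le> (\<Sum>k. ennreal (S\<^sup>2 * l * q ^ n * q ^ k + K * S * l * q' ^ k))"
  proof (intro suminf_le)
    fix k
    define m where "m = n + k"
    have term_le: "(\<integral>\<^sup>+\<omega>. ennreal ((2 ^ m) powr t * (total_mass I C (\<lambda>i. v i \<omega>))\<^sup>2) \<partial>M)
        \<le> ennreal ((S\<^sup>2 * q ^ m + K * S * q' ^ m) * (1 / 2 ^ m) ^ CARD('d))" if C: "C \<in> subcubes m ?D" for C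
    proof -
      obtain c where c: "C = dcube m c" using C by (auto simp: subcubes_def dlevel_def)
      have CB: "C \<in> sets borel" "C \<subseteq> torus"
        using C dcube_subset_torus[OF x] by (auto simp: subcubes_def c)
      define \<mu> where "\<mu> = (1 / 2 ^ m :: real) ^ CARD('d)"
      have "(\<integral>\<^sup>+\<omega>. ennreal ((2 ^ m) powr t * (total_mass I C (\<lambda>i. v i \<omega>))\<^sup>2) \<partial>M)
          = ennreal (expectation (\<lambda>\<omega>. (2 ^ m) powr t * (total_mass I C (\<lambda>i. v i \<omega>))\<^sup>2))"
        using integrable_total_mass_power[OF CB(1), of I 2] by (intro nn_integral_eq_integral) auto
      also have "\<dots> = ennreal ((2 ^ m) powr t * expectation (\<lambda>\<omega>. (total_mass I C (\<lambda>i. v i \<omega>))\<^sup>2))"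
        by simp
      also have "\<dots> \<le> ennreal ((2 ^ m) powr t * ((S * \<mu>)\<^sup>2 + K * (1 / 2 ^ m) powr \<tau> * (S * \<mu>)))"
        using second_moment_total_mass[OF I CB, unfolded c, OF mass_bound]
        by (intro ennreal_leI mult_left_mono) (auto simp: c measure_dcube S_def \<mu>_def)
      also have "(2 ^ m) powr t * ((S * \<mu>)\<^sup>2 + K * (1 / 2 ^ m) powr \<tau> * (S * \<mu>))
          = (S\<^sup>2 * ((2 ^ m) powr t * \<mu>) + K * S * ((2 ^ m) powr t * (1 / 2 ^ m) powr \<tau>)) * \<mu>"
        by (simp add: power2_eq_square algebra_simps)
      also have "(2 ^ m) powr t * \<mu> = q ^ m"
        by (simp add: \<mu>_def q_def powr_power powr_diff power_divide algebra_simps flip: powr_realpow)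
           (simp add: powr_powr mult.commute flip: powr_realpow)
      also have "(2 ^ m) powr t * (1 / 2 ^ m) powr \<tau> = q' ^ m"
        by (simp add: q'_def powr_power powr_diff powr_divide algebra_simps powr_powr flip: powr_realpow)
      finally show ?thesis by (simp add: \<mu>_def)
    qed
    have "(\<Sum>C\<in>subcubes m ?D. \<integral>\<^sup>+\<omega>. ennreal ((2 ^ m) powr t * (total_mass I C (\<lambda>i. v i \<omega>))\<^sup>2) \<partial>M)
        \<le> (\<Sum>C\<in>subcubes m ?D. ennreal ((S\<^sup>2 * q ^ m + K * S * q' ^ m) * (1 / 2 ^ m) ^ CARD('d)))"
      by (intro sum_mono term_le)
    also have "\<dots> = ennreal ((S\<^sup>2 * q ^ m + K * S * q' ^ m) * (real (card (subcubes m ?D)) * (1 / 2 ^ m) ^ CARD('d)))"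
      using S K q by (simp add: ennreal_of_nat_eq_real_of_nat mult_ac flip: ennreal_mult')
    also have "\<dots> \<le> ennreal ((S\<^sup>2 * q ^ m + K * S * q' ^ m) * l)"
      using S K q card_subcubes_le[of m n x] unfolding l_def by (intro ennreal_leI mult_left_mono) auto
    also have "\<dots> \<le> ennreal (S\<^sup>2 * l * q ^ n * q ^ k + K * S * l * q' ^ k)"
    proof (intro ennreal_leI)
      have "q' ^ m \<le> q' ^ k" using q by (intro power_decreasing) (auto simp: m_def)
      then have "K * S * l * q' ^ m \<le> K * S * l * q' ^ k" using K S l by (intro mult_left_mono) auto
      then show "(S\<^sup>2 * q ^ m + K * S * q' ^ m) * l \<le> S\<^sup>2 * l * q ^ n * q ^ k + K * S * l * q' ^ k"
        by (simp add: m_def power_add algebra_simps)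
    qed
    finally show "(\<Sum>C\<in>subcubes (n + k) ?D. \<integral>\<^sup>+\<omega>. ennreal ((2 ^ (n + k)) powr t * (total_mass I C (\<lambda>i. v i \<omega>))\<^sup>2) \<partial>M)
        \<le> ennreal (S\<^sup>2 * l * q ^ n * q ^ k + K * S * l * q' ^ k)" by (simp add: m_def)
  qed auto
  also have "\<dots> = ennreal (S\<^sup>2 * l * q ^ n / (1 - q) + K * S * l / (1 - q'))"
  proof (rule suminf_ennreal_eq)
    show "0 \<le> S\<^sup>2 * l * q ^ n * q ^ k + K * S * l * q' ^ k" for k using S K l q by simp
    have "(\<lambda>k. S\<^sup>2 * l * q ^ n * q ^ k + K * S * l * q' ^ k) sums
        (S\<^sup>2 * l * q ^ n * (1 / (1 - q)) + K * S * l * (1 / (1 - q')))"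
      using q by (intro sums_add sums_mult geometric_sums) auto
    then show "(\<lambda>k. S\<^sup>2 * l * q ^ n * q ^ k + K * S * l * q' ^ k) sums
        (S\<^sup>2 * l * q ^ n / (1 - q) + K * S * l / (1 - q'))" by simp
  qed
  finally show ?thesis .
qed

text \<open>
  The measure is carried by \<open>W\<close>, so its mass on \<open>interior D\<close> is at most the sum of the masses \<open>z\<close> of the covering
  cubes. Each is split by \<open>z \<le> a / p + p * z\<^sup>2 / (4 * a)\<close>, where \<open>p\<close> is the inverse \<open>t\<close>-th power of the side: the first
  terms add up to the cost of the cover and the second ones to at most the energy.
\<close>

lemma total_mass_cover_le:
  fixes x :: "real ^ 'd"
  assumes I: "finite I" and x: "x \<in> torus" and a: "0 < a" and t: "0 \<le> t"
    and W: "\<And>i. i \<in> I \<Longrightarrow> AE y in \<kappa>. torus_proj (T i y + u i) \<in> W"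
    and F: "F \<subseteq> Collect dyadic_cube" and cov: "W \<inter> interior (dcube n x) \<subseteq> \<Union>F"
    and no: "\<And>C. C \<in> F \<Longrightarrow> \<not> dcube n x \<subseteq> C"
  shows "ennreal (total_mass I (interior (dcube n x)) u)
     \<le> ennreal (a / sqrt CARD('d) powr t) * cweight t F + ennreal (1 / (4 * a)) * energy t n (dcube n x) I u"
proof -
  interpret \<kappa>: prob_space \<kappa> by (rule prob_\<kappa>)
  note [measurable_cong] = sets_\<kappa>
  note [measurable] = T_borel
  have sp: "space \<kappa> = UNIV" using sets_eq_imp_space_eq[OF sets_\<kappa>] by simp
  let ?D = "dcube n x"
  define G where "G = {C \<in> F. C \<subseteq> ?D}"
  have Gdy: "dyadic_cube C" if "C \<in> G" for C using that F by (auto simp: G_def)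
  have cntG: "countable G" using Gdy by (intro countable_dyadic_family) auto
  define X where "X i C = {y. torus_proj (T i y + u i) \<in> C}" for i C
  have Xm: "X i C \<in> sets \<kappa>" if [measurable]: "C \<in> sets borel" for i C
    unfolding X_def by measurable
  have mass: "ennreal (shifted_mass \<kappa> (T i) C (u i)) = emeasure \<kappa> (X i C)" for i C
    by (simp add: shifted_mass_def X_def sp \<kappa>.emeasure_eq_measure)
  have Gcov: "p \<in> \<Union>G" if p: "p \<in> W" "p \<in> interior ?D" for p
  proof -
    obtain C where C: "C \<in> F" "p \<in> C" using p cov by blast
    then have "C \<subseteq> ?D"
      using dyadic_cube_nested[of C ?D] F x no[of C] p interior_subset[of ?D] by blast
    then show ?thesis using C by (auto simp: G_def)
  qed
  have one: "emeasure \<kappa> (X i (interior ?D)) \<le> (\<integral>\<^sup>+C. emeasure \<kappa> (X i C) \<partial>count_space G)" if i: "i \<in> I" for i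
  proof -
    have GX: "X i C \<in> sets \<kappa>" if "C \<in> G" for C using Xm dyadic_cube_borel[OF Gdy[OF that]] .
    have UX: "(\<Union>C\<in>G. X i C) \<in> sets \<kappa>" using cntG GX by (intro sets.countable_UN') auto
    have "emeasure \<kappa> (X i (interior ?D)) \<le> emeasure \<kappa> (\<Union>C\<in>G. X i C)"
    proof (rule emeasure_mono_AE[OF _ UX])
      show "AE y in \<kappa>. y \<in> X i (interior ?D) \<longrightarrow> y \<in> (\<Union>C\<in>G. X i C)"
        using W[OF i]
      proof eventually_elim
        case (elim y)
        then show ?case using Gcov by (auto simp: X_def)
      qed
    qed
    also have "\<dots> \<le> (\<integral>\<^sup>+C. emeasure \<kappa> (X i C) \<partial>count_space G)"
      by (rule emeasure_le_count_space_cover[OF cntG GX UX]) auto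
    finally show ?thesis .
  qed
  have tm: "ennreal (total_mass I C u) = (\<Sum>i\<in>I. ennreal (w i) * emeasure \<kappa> (X i C))" for C
    unfolding total_mass_def using w shifted_mass_01
    by (simp add: mass[symmetric] ennreal_mult flip: sum_ennreal)
  have "ennreal (total_mass I (interior ?D) u) \<le> (\<Sum>i\<in>I. ennreal (w i) * (\<integral>\<^sup>+C. emeasure \<kappa> (X i C) \<partial>count_space G))"
    unfolding tm by (intro sum_mono mult_left_mono one) auto
  also have "\<dots> = (\<integral>\<^sup>+C. ennreal (total_mass I C u) \<partial>count_space G)"
    unfolding tm by (simp add: nn_integral_sum nn_integral_cmult)
  also have "\<dots> \<le> (\<integral>\<^sup>+C. ennreal (a / sqrt CARD('d) powr t) * ennreal (diameter C powr t)
      + ennreal (1 / (4 * a)) * ennreal ((sqrt CARD('d) / diameter C) powr t * (total_mass I C u)\<^sup>2) \<partial>count_space G)"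
  proof (rule nn_integral_mono)
    fix C assume "C \<in> space (count_space G)"
    then have "C \<in> G" by simp
    then obtain m c where c: "C = dcube m c" using Gdy unfolding dyadic_cube_iff by blast
    define p where "p = (2 ^ m :: real) powr t"
    define z where "z = total_mass I C u"
    have p: "0 < p" by (simp add: p_def)
    have "0 \<le> (2 * a - p * z)\<^sup>2 / (4 * a * p)" using a p by simp
    also have "\<dots> = a / p + p * z\<^sup>2 / (4 * a) - z"
      using a p by (simp add: field_simps power2_eq_square)
    finally have "z \<le> a / p + 1 / (4 * a) * (p * z\<^sup>2)" by simp
    moreover have "ennreal (a / sqrt CARD('d) powr t) * ennreal (diameter C powr t) = ennreal (a / p)"
      using a by (simp add: c diameter_dcube powr_divide p_def flip: ennreal_mult)
    moreover have "ennreal (1 / (4 * a)) * ennreal ((sqrt CARD('d) / diameter C) powr t * z\<^sup>2)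
        = ennreal (1 / (4 * a) * (p * z\<^sup>2))"
      using a by (simp add: c diameter_dcube p_def flip: ennreal_mult)
    ultimately show "ennreal z \<le> ennreal (a / sqrt CARD('d) powr t) * ennreal (diameter C powr t)
      + ennreal (1 / (4 * a)) * ennreal ((sqrt CARD('d) / diameter C) powr t * z\<^sup>2)"
      using a p by (simp flip: ennreal_plus)
  qed
  also have "\<dots> = ennreal (a / sqrt CARD('d) powr t) * cweight t G
      + ennreal (1 / (4 * a)) * (\<integral>\<^sup>+C. ennreal ((sqrt CARD('d) / diameter C) powr t * (total_mass I C u)\<^sup>2) \<partial>count_space G)"
    by (simp add: nn_integral_add nn_integral_cmult cweight_eq_nn_integral)
  also have "(\<integral>\<^sup>+C. ennreal ((sqrt CARD('d) / diameter C) powr t * (total_mass I C u)\<^sup>2) \<partial>count_space G)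
      \<le> (\<Sum>k. \<integral>\<^sup>+C. ennreal ((sqrt CARD('d) / diameter C) powr t * (total_mass I C u)\<^sup>2) \<partial>count_space (subcubes (n + k) ?D))"
  proof (rule nn_integral_count_space_UN_le, rule subsetI)
    fix C assume C: "C \<in> G"
    then obtain m c where c: "c \<in> torus" "C = dcube m c" using Gdy unfolding dyadic_cube_iff by blast
    show "C \<in> (\<Union>k. subcubes (n + k) ?D)"
    proof (cases "C = ?D")
      case True
      then have "C \<in> subcubes (n + 0) ?D" using x by (auto simp: subcubes_def dlevel_def)
      then show ?thesis by blast
    next
      case False
      then have "n < m" using C dcube_level_mono[of m c n x] by (auto simp: G_def c)
      then have "C \<in> subcubes (n + (m - n)) ?D" using C c by (auto simp: subcubes_def dlevel_def G_def)
      then show ?thesis by blast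
    qed
  qed
  also have "\<dots> = energy t n ?D I u"
    unfolding energy_def
  proof (intro suminf_cong)
    fix k
    have "(\<integral>\<^sup>+C. ennreal ((sqrt CARD('d) / diameter C) powr t * (total_mass I C u)\<^sup>2) \<partial>count_space (subcubes (n + k) ?D))
        = (\<Sum>C\<in>subcubes (n + k) ?D. ennreal ((sqrt CARD('d) / diameter C) powr t * (total_mass I C u)\<^sup>2))"
      by (intro nn_integral_count_space_finite finite_subcubes)
    also have "\<dots> = (\<Sum>C\<in>subcubes (n + k) ?D. ennreal ((2 ^ (n + k)) powr t * (total_mass I C u)\<^sup>2))"
      by (intro sum.cong refl) (auto simp: subcubes_def dlevel_def diameter_dcube)
    finally show "(\<integral>\<^sup>+C. ennreal ((sqrt CARD('d) / diameter C) powr t * (total_mass I C u)\<^sup>2) \<partial>count_space (subcubes (n + k) ?D))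
        = (\<Sum>C\<in>subcubes (n + k) ?D. ennreal ((2 ^ (n + k)) powr t * (total_mass I C u)\<^sup>2))" .
  qed
  also have "cweight t G \<le> cweight t F" by (intro cweight_mono) (auto simp: G_def)
  finally show ?thesis by (simp add: add_mono mult_left_mono)
qed

text \<open>
  The mass on \<open>interior D\<close> is at least half its mean, and the energy is at most four times the bound for its mean that holds for
  large \<open>S\<close>.
\<close>

definition well_spread :: "real \<Rightarrow> nat \<Rightarrow> real ^ 'd \<Rightarrow> nat set \<Rightarrow> (nat \<Rightarrow> real ^ 'd) \<Rightarrow> bool" where
  "well_spread t n x I u \<longleftrightarrow> (let l = (1 / 2 ^ n) ^ CARD('d); q = 2 powr (t - CARD('d)); S = sum w I in
     S * l / 2 \<le> total_mass I (interior (dcube n x)) u \<and>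
     energy t n (dcube n x) I u \<le> ennreal (8 * S\<^sup>2 * l * q ^ n / (1 - q)))"

text \<open>
  Choosing \<open>a = J / (S * l)\<close> in the preceding lemma, with \<open>J\<close> the energy bound, lets the energy term take half of
  the mass \<open>S * l / 2\<close>; the rest must be paid for by the cover. \<open>S\<close> cancels, and the
  remaining constant is the same for all \<open>D\<close>.
\<close>

lemma well_spread_content:
  fixes x :: "real ^ 'd"
  assumes well_spread: "well_spread t n x I u" and S: "0 < sum w I"
    and I: "finite I" and x: "x \<in> torus" and t: "0 \<le> t" "t < CARD('d)"
    and W: "\<And>i. i \<in> I \<Longrightarrow> AE y in \<kappa>. torus_proj (T i y + u i) \<in> W"
    and F: "F \<subseteq> Collect dyadic_cube" and cov: "W \<inter> interior (dcube n x) \<subseteq> \<Union>F"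
  shows "ennreal ((1 - 2 powr (t - CARD('d))) / 32) * cweight t {dcube n x} \<le> cweight t F"
proof (cases "\<exists>C\<in>F. dcube n x \<subseteq> C")
  case True
  then have "cweight t {dcube n x} \<le> cweight t F" using cweight_superset[OF _ _ F t(1)] by auto
  moreover have "ennreal ((1 - 2 powr (t - CARD('d))) / 32) \<le> 1"
    by (simp add: ennreal_le_1) (smt (verit) powr_ge_zero)
  ultimately show ?thesis using mult_mono[of _ 1 "cweight t {dcube n x}" "cweight t F"] by simp
next
  case False
  show ?thesis
  proof (cases "cweight t F = \<infinity>")
    case True then show ?thesis by simp
  next
    case fin: False
    then obtain c where c: "cweight t F = ennreal c" "0 \<le> c" by (cases "cweight t F") auto
    define S where "S = sum w I"
    define l where "l = (1 / 2 ^ n :: real) ^ CARD('d)"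
    define q where "q = 2 powr (t - CARD('d))"
    \<comment> \<open>notation as in the definition of \<open>well_spread\<close>\<close>
    define J where "J = 8 * S\<^sup>2 * l * q ^ n / (1 - q)"
    define s where "s = sqrt CARD('d) powr t"
    define a where "a = J / (S * l)"
    have q: "0 < q" "q < 1" using t by (auto simp: q_def powr_less_one)
    have pos: "0 < S" "0 < l" "0 < s" using S by (auto simp: S_def l_def s_def)
    then have J: "0 < J" and a: "0 < a" using q by (auto simp: J_def a_def)
    have "S * l / 2 \<le> total_mass I (interior (dcube n x)) u" and
      en: "energy t n (dcube n x) I u \<le> ennreal J"
      using well_spread by (auto simp: well_spread_def Let_def S_def l_def q_def J_def)
    then have "ennreal (S * l / 2) \<le> ennreal (total_mass I (interior (dcube n x)) u)"
      by (intro ennreal_leI)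
    also have "\<dots> \<le> ennreal (a / s) * cweight t F + ennreal (1 / (4 * a)) * energy t n (dcube n x) I u"
      unfolding s_def using False by (intro total_mass_cover_le[OF I x a t(1) W F cov]) auto
    also have "\<dots> \<le> ennreal (a / s) * ennreal c + ennreal (1 / (4 * a)) * ennreal J"
      unfolding c using en by (intro add_left_mono mult_left_mono) auto
    also have "\<dots> = ennreal (a / s * c + 1 / (4 * a) * J)"
      using a pos c J by (simp flip: ennreal_mult ennreal_plus)
    finally have "S * l / 2 \<le> a / s * c + 1 / (4 * a) * J"
      using a pos c J by (subst (asm) ennreal_le_iff) auto
    also have "1 / (4 * a) * J = S * l / 4" using J pos by (simp add: a_def)
    finally have "S * l / 4 \<le> a / s * c" by linarith
    then have "s * (S * l) / (4 * a) \<le> c" using a pos by (simp add: field_simps)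
    also have "s * (S * l) / (4 * a) = (1 - q) / 32 * (s * (l / q ^ n))"
      using q pos by (simp add: a_def J_def field_simps power2_eq_square)
    also have "l / q ^ n = (1 / 2 ^ n) powr t"
      by (simp add: l_def q_def powr_power powr_diff powr_divide power_divide algebra_simps flip: powr_realpow)
         (simp add: powr_powr mult.commute flip: powr_realpow)
    also have "s * (1 / 2 ^ n) powr t = (sqrt CARD('d) / 2 ^ n) powr t"
      by (simp add: s_def powr_divide)
    finally have "ennreal ((1 - q) / 32 * (sqrt CARD('d) / 2 ^ n) powr t) \<le> ennreal c" by (rule ennreal_leI)
    then show ?thesis
      using q by (simp add: c cweight_dcube q_def flip: ennreal_mult)
  qed
qed

text \<open>
  The threshold \<open>B\<close> makes each of the two exceptional events have probability at most \<open>1 / 4\<close>: its first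
  entry does so for Chebyshev's inequality, its second one lets the quadratic part dominate the energy.
\<close>

lemma prob_well_spread:
  fixes x :: "real ^ 'd" and n :: nat
  assumes x: "x \<in> torus" and t: "t < \<tau>" "t < CARD('d)"
  shows "\<exists>B>0. \<forall>I. finite I \<longrightarrow> B \<le> sum w I \<longrightarrow> 1 / 2 \<le> prob {\<omega> \<in> space M. well_spread t n x I (\<lambda>i. v i \<omega>)}"
proof -
  define l where "l = (1 / 2 ^ n :: real) ^ CARD('d)"
  define q where "q = 2 powr (t - CARD('d))"
  define q' where "q' = 2 powr (t - \<tau>)"
  have q: "0 < q" "q < 1" "0 < q'" "q' < 1" using t by (auto simp: q_def q'_def powr_less_one)
  have l: "0 < l" by (simp add: l_def)
  define B where "B = max (16 / l) (K * (1 - q) / ((1 - q') * q ^ n))"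
  have B: "0 < B" using l by (auto simp: B_def less_max_iff_disj)
  show ?thesis
  proof (intro exI[of _ B] conjI allI impI B)
    fix I :: "nat set" assume I: "finite I" and BS: "B \<le> sum w I"
    define S where "S = sum w I"
    have S: "0 < S" "16 / l \<le> S" "K * (1 - q) / ((1 - q') * q ^ n) \<le> S"
      using BS B by (auto simp: S_def B_def)
    define J1 where "J1 = S\<^sup>2 * l * q ^ n / (1 - q)"
    have J1: "0 < J1" using q l S by (simp add: J1_def)
    have "K * S * l / (1 - q') \<le> J1"
    proof -
      have "K * (1 - q) / ((1 - q') * q ^ n) * (S * l * q ^ n / (1 - q)) \<le> S * (S * l * q ^ n / (1 - q))"
        using S q l by (intro mult_right_mono) auto
      then show ?thesis using q by (simp add: J1_def power2_eq_square mult_ac)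
    qed
    then have "ennreal (S\<^sup>2 * l * q ^ n / (1 - q) + K * S * l / (1 - q')) \<le> ennreal (2 * J1)"
      unfolding J1_def[symmetric] by (intro ennreal_leI) simp
    then have EJ: "(\<integral>\<^sup>+\<omega>. energy t n (dcube n x) I (\<lambda>i. v i \<omega>) \<partial>M) \<le> ennreal (2 * J1)"
      using expected_energy_le[OF I x t, of n] unfolding l_def[symmetric] q_def[symmetric] q'_def[symmetric] S_def[symmetric]
      by (rule order_trans[rotated])
    define A1 where "A1 = {\<omega> \<in> space M. total_mass I (interior (dcube n x)) (\<lambda>i. v i \<omega>) < S * l / 2}"
    define A2 where "A2 = {\<omega> \<in> space M. 1 \<le> ennreal (1 / (8 * J1)) * energy t n (dcube n x) I (\<lambda>i. v i \<omega>)}"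
    have intB: "interior (dcube n x) \<in> sets borel" "interior (dcube n x) \<subseteq> torus"
      using dcube_subset_torus[OF x, of n] interior_subset[of "dcube n x"] by auto
    have ml: "measure lborel (interior (dcube n x)) = l"
      by (simp add: measure_def emeasure_dcube l_def)
    note [measurable] = measurable_energy_v measurable_total_mass_v[OF intB(1)]
    have A [measurable]: "A1 \<in> sets M" "A2 \<in> sets M" unfolding A1_def A2_def by measurable
    have "prob A1 \<le> 4 / (S * l)"
      using total_mass_concentration[OF I intB] S l unfolding A1_def ml S_def[symmetric] by simp
    also have "\<dots> \<le> 1 / 4" using S l by (simp add: field_simps)
    finally have p1: "prob A1 \<le> 1 / 4" .
    have "emeasure M A2 \<le> ennreal (1 / (8 * J1)) * (\<integral>\<^sup>+\<omega>. energy t n (dcube n x) I (\<lambda>i. v i \<omega>) * indicator (space M) \<omega> \<partial>M)"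
      using nn_integral_Markov_inequality[of "\<lambda>\<omega>. energy t n (dcube n x) I (\<lambda>i. v i \<omega>)" "space M" M "ennreal (1 / (8 * J1))"]
      by (simp add: A2_def)
    also have "(\<integral>\<^sup>+\<omega>. energy t n (dcube n x) I (\<lambda>i. v i \<omega>) * indicator (space M) \<omega> \<partial>M)
        = (\<integral>\<^sup>+\<omega>. energy t n (dcube n x) I (\<lambda>i. v i \<omega>) \<partial>M)"
      by (intro nn_integral_cong) simp
    also have "ennreal (1 / (8 * J1)) * \<dots> \<le> ennreal (1 / (8 * J1)) * ennreal (2 * J1)"
      by (intro mult_left_mono EJ) simp
    also have "\<dots> = ennreal (1 / 4)" using J1 by (simp flip: ennreal_mult)
    finally have p2: "prob A2 \<le> 1 / 4" by (simp add: emeasure_eq_measure)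
    have sub: "space M - (A1 \<union> A2) \<subseteq> {\<omega> \<in> space M. well_spread t n x I (\<lambda>i. v i \<omega>)}"
    proof
      fix \<omega> assume \<omega>: "\<omega> \<in> space M - (A1 \<union> A2)"
      define e where "e = energy t n (dcube n x) I (\<lambda>i. v i \<omega>)"
      have "ennreal (1 / (8 * J1)) * e < 1" using \<omega> by (auto simp: A2_def e_def not_le)
      then have "ennreal (8 * J1) * (ennreal (1 / (8 * J1)) * e) \<le> ennreal (8 * J1) * 1"
        by (intro mult_left_mono) auto
      also have "ennreal (8 * J1) * (ennreal (1 / (8 * J1)) * e) = e"
        using J1 by (simp add: mult.assoc[symmetric] flip: ennreal_mult)
      finally have "e \<le> ennreal (8 * S\<^sup>2 * l * q ^ n / (1 - q))" by (simp add: J1_def mult_ac)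
      then show "\<omega> \<in> {\<omega> \<in> space M. well_spread t n x I (\<lambda>i. v i \<omega>)}"
        using \<omega> by (auto simp: well_spread_def Let_def A1_def not_less S_def l_def q_def e_def)
    qed
    have gm: "{\<omega> \<in> space M. well_spread t n x I (\<lambda>i. v i \<omega>)} \<in> sets M"
      unfolding well_spread_def Let_def by measurable
    have "prob (A1 \<union> A2) \<le> 1 / 2"
      using measure_Un_le[OF A] p1 p2 by simp
    then have "1 / 2 \<le> prob (space M - (A1 \<union> A2))"
      by (subst prob_compl) auto
    also have "\<dots> \<le> prob {\<omega> \<in> space M. well_spread t n x I (\<lambda>i. v i \<omega>)}"
      by (rule finite_measure_mono[OF sub gm])
    finally show "1 / 2 \<le> prob {\<omega> \<in> space M. well_spread t n x I (\<lambda>i. v i \<omega>)}" .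
  qed
qed

text \<open>
  Divergence of the weights allows to cut the indices from \<open>N\<close> on into disjoint finite blocks of weight at least \<open>B\<close>. Their
  events are independent with probability at least \<open>1 / 2\<close>, and one of them suffices.
\<close>

lemma AE_content:
  fixes x :: "real ^ 'd"
  assumes div: "\<And>n B. \<exists>N. B \<le> sum w {n..<N}"
    and x: "x \<in> torus" and t: "0 \<le> t" "t < \<tau>" "t < CARD('d)"
    and W: "\<And>i \<omega>. N \<le> i \<Longrightarrow> AE y in \<kappa>. torus_proj (T i y + v i \<omega>) \<in> W \<omega>"
  shows "AE \<omega> in M. \<forall>F. F \<subseteq> Collect dyadic_cube \<longrightarrow> W \<omega> \<inter> interior (dcube n x) \<subseteq> \<Union>F \<longrightarrow>
     ennreal ((1 - 2 powr (t - CARD('d))) / 32) * cweight t {dcube n x} \<le> cweight t F"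
proof -
  obtain B where B: "0 < B" and
    half: "\<And>I. finite I \<Longrightarrow> B \<le> sum w I \<Longrightarrow> 1 / 2 \<le> prob {\<omega> \<in> space M. well_spread t n x I (\<lambda>i. v i \<omega>)}"
    using prob_well_spread[OF x t(2,3), of n] by blast
  obtain h where h: "\<And>m. B \<le> sum w {m..<h m}" using div[of B] by metis
  have hm: "m < h m" for m using h[of m] B by (cases "m < h m") auto
  define a where "a b = (h ^^ b) N" for b
  have a_Suc: "a (Suc b) = h (a b)" for b by (simp add: a_def)
  have "strict_mono a" using hm by (simp add: strict_mono_Suc_iff a_Suc)
  then have a_mono: "a b \<le> a b'" if "b \<le> b'" for b b' using that by (simp add: strict_mono_less_eq)
  define I where "I b = {a b..<a (Suc b)}" for b
  have Ifin: "finite (I b)" and IB: "B \<le> sum w (I b)" for b using h by (auto simp: I_def a_Suc)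
  have IN: "N \<le> i" if "i \<in> I b" for i b
    using that a_mono[of 0 b] by (auto simp: I_def a_def)
  have disj: "disjoint_family_on I UNIV"
    unfolding disjoint_family_on_def
  proof (intro ballI impI)
    fix b b' :: nat assume "b \<noteq> b'"
    then show "I b \<inter> I b' = {}"
      using a_mono[of "Suc b" b'] a_mono[of "Suc b'" b] by (cases "b < b'") (auto simp: I_def)
  qed
  have restr: "well_spread t n x (I b) (restrict u (I b)) = well_spread t n x (I b) u" for b u
    by (simp add: well_spread_def energy_def total_mass_def cong: sum.cong)
  have intB: "interior (dcube n x) \<in> sets borel" by simp
  have "indep_events (\<lambda>b. {\<omega> \<in> space M. well_spread t n x (I b) (restrict (\<lambda>i. v i \<omega>) (I b))}) UNIV"
  proof (rule indep_eventsI_indep_vars[OF indep_vars_restrict[OF indep_v _ disj]])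
    fix b
    note [measurable] = measurable_energy measurable_total_mass[OF intB]
    show "{u \<in> space (PiM (I b) (\<lambda>_. torus_measure)). well_spread t n x (I b) u} \<in> sets (PiM (I b) (\<lambda>_. torus_measure))"
      unfolding well_spread_def Let_def by measurable
  qed auto
  then have "AE \<omega> in M. infinite {b. well_spread t n x (I b) (\<lambda>i. v i \<omega>)}"
    unfolding restr using half[OF Ifin IB] by (intro independent_events_occur_infinitely_often[of _ "1 / 2"]) auto
  then show ?thesis
  proof eventually_elim
    case (elim \<omega>)
    then have "{b. well_spread t n x (I b) (\<lambda>i. v i \<omega>)} \<noteq> {}" by (metis finite.emptyI)
    then obtain b where b: "well_spread t n x (I b) (\<lambda>i. v i \<omega>)" by blast
    have S: "0 < sum w (I b)" using IB[of b] B by simp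
    show ?case
    proof (intro allI impI)
      fix F :: "(real ^ 'd) set set"
      assume F: "F \<subseteq> Collect dyadic_cube" "W \<omega> \<inter> interior (dcube n x) \<subseteq> \<Union>F"
      show "ennreal ((1 - 2 powr (t - CARD('d))) / 32) * cweight t {dcube n x} \<le> cweight t F"
        by (rule well_spread_content[OF b S Ifin x t(1,3) W[OF IN] F])
    qed
  qed
qed

end

section \<open>The limsup set\<close>

lemma torus_proj_add: "torus_proj (torus_proj x + y) = torus_proj (x + y)"
  unfolding torus_proj_eq_iff by (simp add: torus_proj_def frac_def)

lemma openin_torus_translate:
  assumes "openin torus_topology U"
  shows "openin torus_topology (torus_translate a U)"
proof -
  have U: "U \<subseteq> torus" "open (torus_proj -` U)" using assms by (auto simp: openin_torus_topology)
  have "torus_proj -` torus_translate a U = (\<lambda>x. x - a) -` (torus_proj -` U)"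
  proof (intro set_eqI iffI)
    fix x assume "x \<in> torus_proj -` torus_translate a U"
    then obtain u where u: "u \<in> U" "torus_proj x = torus_proj (u + a)"
      by (auto simp: torus_translate_def)
    then have "torus_proj (x - a) = torus_proj u"
      by (simp add: torus_proj_eq_iff algebra_simps)
    also have "\<dots> = u" using u U by (intro torus_proj_id) auto
    finally show "x \<in> (\<lambda>x. x - a) -` (torus_proj -` U)" using u by simp
  next
    fix x assume "x \<in> (\<lambda>x. x - a) -` (torus_proj -` U)"
    then have "torus_proj (torus_proj (x - a) + a) \<in> torus_translate a U"
      by (auto simp: torus_translate_def)
    then show "x \<in> torus_proj -` torus_translate a U" by (simp add: torus_proj_add)
  qed
  moreover have "open ((\<lambda>x. x - a) -` (torus_proj -` U))"
    by (rule open_vimage[OF U(2)]) (intro continuous_intros)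
  ultimately show ?thesis by (auto simp: openin_torus_topology torus_translate_def)
qed

text \<open>
  The torus carries the quotient topology, in which neighbourhoods of a boundary point of \<open>[0,1)^d\<close>
  wrap around; in the interior it agrees with the Euclidean topology.
\<close>

lemma open_torus_open_Int_interior:
  assumes W: "openin torus_topology W" and D: "dyadic_cube D"
  shows "open (W \<inter> interior D)"
proof -
  have "interior D \<subseteq> torus" using dyadic_cube_subset_torus[OF D] interior_subset[of D] by blast
  then have "W \<inter> interior D = (torus_proj -` W) \<inter> interior D"
    by (auto simp: torus_proj_id subset_iff)
  then show ?thesis using W by (simp add: openin_torus_topology open_Int)
qed

lemma nondegenerate_cube_contains_ball:
  fixes Q :: "(real ^ 'd) set"
  assumes "nondegenerate_cube Q"
  obtains z r where "0 < r" "ball z r \<subseteq> Q"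
proof -
  obtain a :: "real ^ 'd" and f :: "real ^ 'd \<Rightarrow> real ^ 'd" and J r where f: "orthogonal_transformation f" and r: "0 < r"
    and J: "\<forall>j. {0<..<r} \<subseteq> J j \<and> J j \<subseteq> {0..r}" and Q: "Q = (\<lambda>x. a + f x) ` {x. \<forall>j. x $ j \<in> J j}"
    using assms unfolding nondegenerate_cube_def by blast
  define m :: "real ^ 'd" where "m = (\<chi> j. r / 2)"
  have "ball (a + f m) (r / 2) \<subseteq> Q"
  proof
    fix y assume y: "y \<in> ball (a + f m) (r / 2)"
    obtain x where x: "f x = y - a" using orthogonal_transformation_surj[OF f] by (metis surjD)
    have "norm (x - m) = norm (f (x - m))" using f by (simp add: orthogonal_transformation_norm)
    also have "f (x - m) = f x - f m"
      using f by (simp add: linear_diff orthogonal_transformation_linear)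
    finally have "norm (x - m) < r / 2" using y by (simp add: x dist_norm norm_minus_commute algebra_simps)
    then have "\<bar>x $ j - r / 2\<bar> < r / 2" for j
      using component_le_norm_cart[of "x - m" j] by (simp add: m_def)
    then have "x $ j \<in> {0<..<r}" for j by (auto simp: abs_less_iff) (smt (verit) field_sum_of_halves)+
    then have "x $ j \<in> J j" for j using J by blast
    then show "y \<in> Q" unfolding Q using x by (auto intro!: image_eqI[of _ _ x])
  qed
  then show ?thesis using r by (intro that[of "r / 2" "a + f m"]) auto
qed

theorem corollary3:
  fixes U :: "nat \<Rightarrow> (real ^ 'd) set"
    and Q :: "(real ^ 'd) set"
    and L :: "nat \<Rightarrow> real ^ 'd \<Rightarrow> real ^ 'd"
    and M :: "'w measure"
    and v :: "nat \<Rightarrow> 'w \<Rightarrow> real ^ 'd"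
    and s :: real
  assumes "\<And>i. openin torus_topology (U i)"
    and "nondegenerate_cube Q"
    and "\<And>i. affine_transformation (L i)"
    and "\<And>i k. k \<in> {1..CARD('d)} \<Longrightarrow> 0 < singular_value k (L i) \<and> singular_value k (L i) < 1"
    and "\<And>i. torus_proj ` (L i ` Q) \<subseteq> U i"
    and "prob_space M"
    and "prob_space.indep_vars M (\<lambda>_. torus_measure) v UNIV"
    and "\<And>i. distr M torus_measure (v i) = torus_measure"
    and "s = Inf {t. 0 < t \<and> t \<le> real CARD('d) \<and>
                     (summable (\<lambda>i. singular_value_function t (L i)) \<or> t = real CARD('d))}"
  shows "AE \<omega> in M. (\<Inter>n. \<Union>i\<in>{n..}. torus_translate (v i \<omega>) (U i)) \<in> large_intersection_class s"
proof -
  define W where "W N \<omega> = (\<Union>i\<in>{N..}. torus_translate (v i \<omega>) (U i))" for N :: nat and \<omega>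
  obtain z \<epsilon> where \<epsilon>: "0 < \<epsilon>" "ball z \<epsilon> \<subseteq> Q"
    using nondegenerate_cube_contains_ball[OF assms(2)] by blast
  \<comment> \<open>small enough that the cube lies in the ball and its images have diameter less than \<open>1 / 2\<close>\<close>
  define r where "r = min (1 / 4) \<epsilon> / (2 * sqrt CARD('d))"
  have d0: "0 < sqrt CARD('d)" by simp
  have r: "0 < r" using \<epsilon> d0 by (simp add: r_def)
  have "sqrt CARD('d) * r = min (1 / 4) \<epsilon> / 2" using d0 by (simp add: r_def)
  then have r4: "sqrt CARD('d) * r < 1 / 4" and r\<epsilon>: "sqrt CARD('d) * r < \<epsilon>" using \<epsilon> by auto
  define P where "P i T \<sigma> p \<longleftrightarrow> (\<forall>x y. (norm (T x - T y))\<^sup>2 = (\<Sum>j\<in>UNIV. (\<sigma> j * (x $ j - y $ j))\<^sup>2))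
      \<and> (\<forall>y. norm y < \<epsilon> \<longrightarrow> T y \<in> L i ` ball z \<epsilon>) \<and> bij_betw p {1..CARD('d)} (UNIV :: 'd set)
      \<and> (\<forall>k\<in>{1..CARD('d)}. singular_value k (L i) = \<sigma> (p k))" for i T \<sigma> p
  have "\<exists>T \<sigma> p. P i T \<sigma> p" for i
    by (rule adapted_parametrization[OF assms(3)[of i], of z]) (unfold P_def, blast)
  then obtain T where "\<And>i. \<exists>\<sigma> p. P i (T i) \<sigma> p" by metis
  then obtain \<sigma> where "\<And>i. \<exists>p. P i (T i) (\<sigma> i) p" by metis
  then obtain p where P: "\<And>i. P i (T i) (\<sigma> i) (p i)" by metis
  have T: "(norm (T i x - T i y))\<^sup>2 = (\<Sum>j\<in>UNIV. (\<sigma> i j * (x $ j - y $ j))\<^sup>2)"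
    and Tball: "norm y < \<epsilon> \<Longrightarrow> T i y \<in> L i ` ball z \<epsilon>"
    and p: "bij_betw (p i) {1..CARD('d)} (UNIV :: 'd set)"
    and sv: "k \<in> {1..CARD('d)} \<Longrightarrow> singular_value k (L i) = \<sigma> i (p i k)" for i x y k
    using P[of i] unfolding P_def by blast+
  have \<sigma>: "0 < \<sigma> i j \<and> \<sigma> i j < 1" for i j
  proof -
    have "j \<in> p i ` {1..CARD('d)}" using p[of i] by (simp add: bij_betw_def)
    then obtain k where "k \<in> {1..CARD('d)}" "j = p i k" by blast
    then show ?thesis using assms(4)[of k i] sv[of k i] by simp
  qed
  define \<kappa> where "\<kappa> = uniform_measure lborel (sym_cube r :: (real ^ 'd) set)"
  have Q: "emeasure lborel (sym_cube r :: (real ^ 'd) set) = ennreal ((2 * r) ^ CARD('d))"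
    using r by (simp add: emeasure_sym_cube)
  have \<kappa>: "prob_space \<kappa>" "sets \<kappa> = sets borel"
    unfolding \<kappa>_def using Q r by (auto intro!: prob_space_uniform_measure)
  have hit: "AE y in \<kappa>. torus_proj (T i y + v i \<omega>) \<in> W N \<omega>" if "N \<le> i" for N i \<omega>
    unfolding \<kappa>_def
  proof (rule AE_uniform_measureI)
    show "AE y in lborel. y \<in> sym_cube r \<longrightarrow> torus_proj (T i y + v i \<omega>) \<in> W N \<omega>"
    proof (intro AE_I2 impI)
      fix y :: "real ^ 'd" assume "y \<in> sym_cube r"
      then have "norm y < \<epsilon>" using norm_sym_cube_le[of y r] r r\<epsilon> by simp
      then have "T i y \<in> L i ` Q" using Tball \<epsilon> by blast
      then have "torus_proj (T i y) \<in> U i" using assms(5) by blast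
      then have "torus_proj (torus_proj (T i y) + v i \<omega>) \<in> torus_translate (v i \<omega>) (U i)"
        by (simp add: torus_translate_def)
      then show "torus_proj (T i y + v i \<omega>) \<in> W N \<omega>"
        using that by (auto simp: W_def torus_proj_add)
    qed
  qed (simp add: sym_cube_def)
  define X where "X = {t. 0 < t \<and> t \<le> real CARD('d) \<and>
     (summable (\<lambda>i. singular_value_function t (L i)) \<or> t = real CARD('d))}"
  have bdd: "bdd_below X" by (auto simp: X_def intro!: bdd_belowI[of _ 0])
  have sX: "s \<le> t" if "t \<in> X" for t
    using cInf_lower[OF that bdd] assms(9) by (simp add: X_def)
  have sd: "s \<le> real CARD('d)" by (intro sX) (simp add: X_def)
  have content: "AE \<omega> in M. content_ge 1 t (W N \<omega>)" if t: "0 < t" "t < s" for t N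
  proof -
    \<comment> \<open>the gap between \<open>t\<close> and \<open>\<tau>\<close> makes the diagonal part of the energy summable over all levels\<close>
    define \<tau> where "\<tau> = (t + s) / 2"
    have \<tau>: "t < \<tau>" "\<tau> < s" using t by (auto simp: \<tau>_def field_simps)
    then have \<tau>0: "0 < \<tau>" "\<tau> \<le> real CARD('d)" and td: "t < real CARD('d)" using t sd by auto
    define w where "w i = singular_value_function \<tau> (L i)" for i
    have w: "0 < w i" "w i \<le> 1" for i
      using singular_value_function_bounds(1,2)[OF p sv \<sigma> \<tau>0] by (auto simp: w_def)
    have "\<not> summable w"
      using sX[of \<tau>] \<tau> \<tau>0 unfolding X_def w_def[abs_def] by auto
    have div: "\<exists>N. B \<le> sum w {n..<N}" for n B
    proof (rule ccontr)
      assume "\<not> (\<exists>N. B \<le> sum w {n..<N})"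
      then have lt: "sum w {n..<N} < B" for N by (simp add: not_le)
      have "summable w"
      proof (rule summableI_nonneg_bounded)
        show "0 \<le> w i" for i using w by (simp add: less_imp_le)
        show "sum w {..<N} \<le> sum w {..<n} + B" for N
        proof -
          have "sum w {..<N} \<le> sum w ({..<n} \<union> {n..<N})"
            using w by (intro sum_mono2) (auto intro: less_imp_le)
          also have "\<dots> = sum w {..<n} + sum w {n..<N}" by (intro sum.union_disjoint) auto
          finally show ?thesis using lt[of N] by simp
        qed
      qed
      then show False using \<open>\<not> summable w\<close> by simp
    qed
    define K where "K = max (4 ^ CARD('d)) ((2 * sqrt CARD('d)) ^ CARD('d) / (2 * r) ^ CARD('d))"
    have "0 \<le> K" by (simp add: K_def le_max_iff_disj)
    interpret random_translates M v \<kappa> T w K \<tau>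
    proof (unfold random_translates_def random_translates_axioms_def, intro conjI allI assms \<kappa>)
      show "T i \<in> borel_measurable borel" for i
        by (rule contraction_borel[OF T \<sigma>])
      show "w i * shifted_mass \<kappa> (T i) (dcube n c) u \<le> K * (1 / 2 ^ n) powr \<tau>" for i n c u
        unfolding w_def K_def \<kappa>_def by (rule cube_mass_le[OF T p sv \<sigma> r r4 \<tau>0])
    qed (use w \<open>0 \<le> K\<close> in \<open>auto intro: less_imp_le\<close>)
    define c where "c = (1 - 2 powr (t - real CARD('d))) / 32"
    have c: "0 < c" using td by (simp add: c_def powr_less_one)
    have "AE \<omega> in M. \<forall>D\<in>{D :: (real ^ 'd) set. dyadic_cube D}. \<forall>F. F \<subseteq> Collect dyadic_cube \<longrightarrow> W N \<omega> \<inter> interior D \<subseteq> \<Union>F \<longrightarrow>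
        ennreal c * cweight t {D} \<le> cweight t F"
    proof (subst AE_ball_countable[OF countable_dyadic_cubes], intro ballI)
      fix D :: "(real ^ 'd) set" assume "D \<in> {D. dyadic_cube D}"
      then obtain n x where x: "x \<in> torus" and D: "D = dcube n x" by (auto simp: dyadic_cube_iff)
      show "AE \<omega> in M. \<forall>F. F \<subseteq> Collect dyadic_cube \<longrightarrow> W N \<omega> \<inter> interior D \<subseteq> \<Union>F \<longrightarrow>
        ennreal c * cweight t {D} \<le> cweight t F"
        unfolding D c_def using t by (intro AE_content[where N=N] div x \<tau> td hit) auto
    qed
    then show ?thesis
    proof eventually_elim
      case (elim \<omega>)
      then have "content_ge c t (W N \<omega>)" by (auto simp: content_ge_def)
      then show ?case using c t td by (intro content_ge_improve_constant) auto
    qed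
  qed
  have "AE \<omega> in M. \<forall>t\<in>{t \<in> \<rat>. 0 < t \<and> t < s}. \<forall>N. content_ge 1 t (W N \<omega>)"
    using content
    by (subst AE_ball_countable) (auto simp: AE_all_countable intro: countable_subset[OF _ countable_rat])
  then show ?thesis
  proof eventually_elim
    case (elim \<omega>)
    have Wopen: "openin torus_topology (W N \<omega>)" for N
      unfolding W_def by (intro openin_Union) (auto intro!: openin_torus_translate assms(1))
    have "gdelta_in torus_topology (\<Inter>N. W N \<omega>)"
      by (rule gdelta_in_Inter) (auto intro!: open_imp_gdelta_in Wopen)
    moreover have "net_content t ((\<Inter>N. W N \<omega>) \<inter> D) = net_content t D"
      if t: "0 < t" "t < s" and D: "dyadic_cube D" for t and D :: "(real ^ 'd) set"
    proof (rule net_content_eqI[OF _ D])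
      fix F assume F: "F \<subseteq> Collect dyadic_cube" "(\<Inter>N. W N \<omega>) \<inter> D \<subseteq> \<Union>F"
      obtain t' where t': "t' \<in> \<rat>" "t < t'" "t' < s" using Rats_dense_in_real[OF t(2)] by blast
      then have con: "content_ge 1 t' (W N \<omega>)" for N using elim t by auto
      have "cweight t' {D} \<le> cweight t' G"
        if "G \<subseteq> Collect dyadic_cube" "(\<Inter>N. W N \<omega>) \<inter> D \<subseteq> \<Union>G" for G
        using t t' by (intro content_Inter[OF con open_torus_open_Int_interior[OF Wopen] _ D that]) auto
      from content_exponent_antimono[OF this _ _ D F] show "cweight t {D} \<le> cweight t F"
        using t t' by auto
    qed
    ultimately show ?case
      unfolding large_intersection_class_def W_def by blast
  qed
qed

end
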